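(* Let $d \in \mathbb{N}$, $n \in \mathbb{N}_0$, $0 < p,q,r \le \infty$, $\alpha \in \mathbb{R}$, and let $A \in \mathrm{GL}(d,\mathbb{R})$ be a matrix in expansive Jordan normal form. Put $n^* = \alpha + \frac1q - \frac1p$ (with $1/\infty = 0$) and $\lambda_{\max} = \max\{|\lambda| : \lambda \text{ is an eigenvalue of } A\}$. Assume that the embedding $B_{p,r}^\alpha(A) \hookrightarrow W^{n,q}(\mathbb{R}^d)$ holds. Then: (a) $p \le q$. (b) $n \le \frac{\ln(|\det A|)}{\ln(\lambda_{\max})}\cdot n^*$ (and in particular $n^* \ge 0$). (c) If $n = \frac{\ln(|\det A|)}{\ln(\lambda_{\max})}\cdot n^*$, then moreover: (i) $r \le q$; (ii) if $q = \infty$, then $r \le 1$; (iii) if $p = q$, then $r \le 2$; (iv) if $A$ is not asymptotically norm diagonal, then $n = n^* = 0$.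
   Context: $\mathbb{N} = \{1,2,\dots\}$, $\mathbb{N}_0 = \mathbb{N}\cup\{0\}$. A matrix is in expansive normal form if all its eigenvalues are real and $>1$ and its determinant equals $2$; it is in expansive Jordan normal form if in addition it is in Jordan normal form. Such an $A$ is called asymptotically norm diagonal (AND) if the algebraic and geometric multiplicities of its largest eigenvalue coincide. Fourier transform: $\widehat f(\xi) = \int_{\mathbb{R}^d} f(x) e^{-2\pi i \langle \xi, x\rangle}\,dx$, extended to tempered distributions $\mathcal{S}'(\mathbb{R}^d)$. An $A$-wavelet is a Schwartz function $\psi \in \mathcal{S}(\mathbb{R}^d)$ such that $\widehat\psi$ has compact support contained in $\mathbb{R}^d\setminus\{0\}$ and $\sum_{j\in\mathbb{Z}} \widehat\psi((A^T)^{-j}\xi) = 1$ for all $\xi \in \mathbb{R}^d \setminus\{0\}$. A low-pass complement to $\psi$ is a Schwartz function $\psi^i_0 \in \mathcal{S}(\mathbb{R}^d)$ with compactly supported Fourier transform such that $\widehat{\psi^i_0}(\xi) + \sum_{j \in \mathbb{N}} \widehat\psi((A^T)^{-j}\xi) = 1$ for all $\xi\in\mathbb{R}^d$. For $j \ge 1$ put $\psi^i_j(x) = |\det A|^j \psi(A^j x)$. Fix an $A$-wavelet $\psi$ with low-pass complement $\psi_0^i$ (these exist, and different choices give the same spaces with equivalent quasi-norms). Inhomogeneous anisotropic Besov space: $B^\alpha_{p,r}(A)$ is the space of all $f \in \mathcal{S}'(\mathbb{R}^d)$ with $\|f\|_{B^\alpha_{p,r}(A)} = \big\| \big( |\det A|^{j\alpha}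 \|f * \psi^i_j\|_{L^p} \big)_{j\in\mathbb{N}_0} \big\|_{\ell^r(\mathbb{N}_0)} < \infty$. Embedding: by definition, $B^\alpha_{p,r}(A) \hookrightarrow W^{n,q}(\mathbb{R}^d)$ means that for every multiindex $\beta \in \mathbb{N}_0^d$ with $|\beta| \le n$ the operator $\partial_*^\beta : B^\alpha_{p,r}(A) \to L^q(\mathbb{R}^d)$, $\partial_*^\beta f = \sum_{j \in \mathbb{N}_0} \partial^\beta (f * \psi^i_j)$, is well-defined and bounded, the series converging unconditionally in the (quasi-)norm of $L^q(\mathbb{R}^d)$ for every $f$. *)

theory Defs
  imports
    "Jordan_Normal_Form.Spectral_Radius"
    "Jordan_Normal_Form.Jordan_Normal_Form_Uniqueness"
    "HOL-Probability.Essential_Supremum"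
begin

(* Both matrix libraries are used: points of R^d and the action of A come from HOL-Analysis,
   spectral notions and Jordan matrices from the AFP.  Ambiguous names refer to HOL-Analysis. *)
hide_const (open) Matrix.vec Matrix.mat Determinant.det
hide_type (open) Matrix.vec
no_notation Matrix.vec_index (infixl \<open>$\<close> 100)
no_notation Matrix.transpose_mat (\<open>(_\<^sup>T)\<close> [1000])

(* Without a sort constraint, unlike the notation real ^ 'd, so that an order on the index type
   can be required where it is needed. *)
type_synonym 'd rvec = "(real, 'd) Finite_Cartesian_Product.vec"
type_synonym ('a, 'd) sqmat = "(('a, 'd) Finite_Cartesian_Product.vec, 'd) Finite_Cartesian_Product.vec"
type_synonym 'd rfun = "'d rvec \<Rightarrow> complex"

section \<open>Matrices\<close>

(* The order on the index type fixes the order of rows and columns, on which being in Jordan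
   normal form depends. *)
definition jnf_mat :: "('a, 'd::{finite,wellorder}) sqmat \<Rightarrow> 'a Matrix.mat" where
  "jnf_mat A =
     (let idx = (\<lambda>i. sorted_list_of_set (UNIV :: 'd set) ! i) in
      Matrix.mat CARD('d) CARD('d) (\<lambda>(i, j). A $ idx i $ idx j))"

definition complex_eigenvalues :: "(real, 'd::{finite,wellorder}) sqmat \<Rightarrow> complex set" where
  "complex_eigenvalues A = spectrum (jnf_mat (map_matrix complex_of_real A))"

definition expansive_normal_form :: "(real, 'd::{finite,wellorder}) sqmat \<Rightarrow> bool" where
  "expansive_normal_form A \<longleftrightarrow>
     (\<forall>\<mu> \<in> complex_eigenvalues A. \<mu> \<in> \<real> \<and> Re \<mu> > 1) \<and> det A = 2"

definition expansive_jordan_normal_form :: "(real, 'd::{finite,wellorder}) sqmat \<Rightarrow> bool" where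
  "expansive_jordan_normal_form A \<longleftrightarrow>
     expansive_normal_form A \<and> (\<exists>n_as. jnf_mat A = jordan_matrix n_as)"

definition lambda_max :: "(real, 'd::{finite,wellorder}) sqmat \<Rightarrow> real" where
  "lambda_max A = spectral_radius (jnf_mat (map_matrix complex_of_real A))"

(* Meant for matrices in expansive normal form, whose largest eigenvalue is lambda_max A. *)
definition asymptotically_norm_diagonal :: "(real, 'd::{finite,wellorder}) sqmat \<Rightarrow> bool" where
  "asymptotically_norm_diagonal A \<longleftrightarrow>
     Polynomial.order (lambda_max A) (char_poly (jnf_mat A))
       = dim_gen_eigenspace (jnf_mat A) (lambda_max A) 1"

(* Powers have to be introduced by hand: multiplication on the type of matrices is entrywise. *)
definition mat_pow :: "(real, 'd::finite) sqmat \<Rightarrow> nat \<Rightarrow> (real, 'd) sqmat" where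
  "mat_pow A k = ((**) A ^^ k) (mat 1)"

definition mat_powi :: "(real, 'd::finite) sqmat \<Rightarrow> int \<Rightarrow> (real, 'd) sqmat" where
  "mat_powi A j = (if j \<ge> 0 then mat_pow A (nat j) else mat_pow (matrix_inv A) (nat (- j)))"


section \<open>Schwartz functions and tempered distributions\<close>

definition partial_deriv :: "'d::finite \<Rightarrow> 'd rfun \<Rightarrow> 'd rfun" where
  "partial_deriv i f x = vector_derivative (\<lambda>t. f (x + t *\<^sub>R axis i 1)) (at 0)"

definition multi_deriv ::
    "('d \<Rightarrow> nat) \<Rightarrow> 'd::{finite,linorder} rfun \<Rightarrow> 'd rfun" where
  "multi_deriv \<beta> f = foldr (\<lambda>i. partial_deriv i ^^ \<beta> i) (sorted_list_of_set UNIV) f"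

definition smooth :: "'d::finite rfun \<Rightarrow> bool" where
  "smooth f \<longleftrightarrow> (\<forall>is x. foldr partial_deriv is f differentiable (at x))"

definition schwartz :: "'d::{finite,linorder} rfun set" where
  "schwartz = {f. smooth f \<and>
     (\<forall>N \<beta>. bdd_above (range (\<lambda>x. (1 + norm x) ^ N * norm (multi_deriv \<beta> f x))))}"

definition schwartz_seminorm :: "nat \<Rightarrow> 'd::{finite,linorder} rfun \<Rightarrow> real" where
  "schwartz_seminorm N f =
     (\<Sum>\<beta> \<in> {\<beta>. sum \<beta> UNIV \<le> N}. SUP x. (1 + norm x) ^ N * norm (multi_deriv \<beta> f x))"

(* The seminorms above are increasing in N and generate the topology of the Schwartz space, so
   a linear functional is continuous iff it is bounded by a multiple of one of them. *)
definition tempered_distributions ::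
    "('d::{finite,linorder} rfun \<Rightarrow> complex) set" where
  "tempered_distributions = {T \<in> extensional schwartz.
     (\<forall>\<phi> \<in> schwartz. \<forall>\<eta> \<in> schwartz. \<forall>a b.
        T (\<lambda>x. a * \<phi> x + b * \<eta> x) = a * T \<phi> + b * T \<eta>) \<and>
     (\<exists>C N. \<forall>\<phi> \<in> schwartz. norm (T \<phi>) \<le> C * schwartz_seminorm N \<phi>)}"

definition convolve ::
    "('d::finite rfun \<Rightarrow> complex) \<Rightarrow> 'd rfun \<Rightarrow> 'd rfun" where
  "convolve T \<phi> x = T (\<lambda>y. \<phi> (x - y))"

definition fourier :: "'d::finite rfun \<Rightarrow> 'd rfun" where
  "fourier f \<xi> = (LINT x|lborel. f x * cis (- 2 * pi * (\<xi> \<bullet> x)))"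

definition support :: "'d::finite rfun \<Rightarrow> 'd rvec set" where
  "support f = closure {x. f x \<noteq> 0}"


section \<open>Wavelets\<close>

definition A_wavelet ::
    "(real, 'd) sqmat \<Rightarrow> 'd::{finite,linorder} rfun \<Rightarrow> bool" where
  "A_wavelet A \<psi> \<longleftrightarrow> \<psi> \<in> schwartz \<and>
     compact (support (fourier \<psi>)) \<and> support (fourier \<psi>) \<subseteq> UNIV - {0} \<and>
     (\<forall>\<xi>. \<xi> \<noteq> 0 \<longrightarrow>
        ((\<lambda>j. fourier \<psi> (mat_powi (transpose A) (- j) *v \<xi>)) has_sum 1) (UNIV :: int set))"

definition low_pass_complement ::
    "(real, 'd) sqmat \<Rightarrow> 'd::{finite,linorder} rfun \<Rightarrow> 'd rfun \<Rightarrow> bool" where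
  "low_pass_complement A \<psi> \<psi>0 \<longleftrightarrow> \<psi>0 \<in> schwartz \<and>
     compact (support (fourier \<psi>0)) \<and>
     (\<forall>\<xi>. \<exists>s. ((\<lambda>j. fourier \<psi> (mat_powi (transpose A) (- int j) *v \<xi>)) has_sum s) {1..} \<and>
          fourier \<psi>0 \<xi> + s = 1)"

definition dilated ::
    "(real, 'd::finite) sqmat \<Rightarrow> 'd rfun \<Rightarrow> 'd rfun \<Rightarrow> nat \<Rightarrow> 'd rfun" where
  "dilated A \<psi> \<psi>0 j =
     (if j = 0 then \<psi>0 else (\<lambda>x. of_real (\<bar>det A\<bar> ^ j) * \<psi> (mat_pow A j *v x)))"


section \<open>Quasi-norms and function spaces\<close>

(* Used for a > 0 only. *)
definition ennreal_powr :: "ennreal \<Rightarrow> real \<Rightarrow> ennreal" where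
  "ennreal_powr x a = (if x = \<infinity> then \<infinity> else ennreal (enn2real x powr a))"

(* 1/p with the convention 1/\<infinity> = 0 *)
definition recip :: "ennreal \<Rightarrow> real" where
  "recip p = enn2real (inverse p)"

definition quasi_norm :: "'a measure \<Rightarrow> ennreal \<Rightarrow> ('a \<Rightarrow> ennreal) \<Rightarrow> ennreal" where
  "quasi_norm M p u =
     (if p = \<infinity> then esssup M u
      else ennreal_powr (\<integral>\<^sup>+ x. ennreal_powr (u x) (enn2real p) \<partial>M) (recip p))"

definition Lp_norm :: "ennreal \<Rightarrow> 'd::finite rfun \<Rightarrow> ennreal" where
  "Lp_norm p f = quasi_norm lborel p (\<lambda>x. ennreal (norm (f x)))"

definition Lp_space :: "ennreal \<Rightarrow> 'd::finite rfun set" where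
  "Lp_space p = {f \<in> borel_measurable lborel. Lp_norm p f < \<infinity>}"

definition lr_norm :: "ennreal \<Rightarrow> (nat \<Rightarrow> ennreal) \<Rightarrow> ennreal" where
  "lr_norm r u = quasi_norm (count_space UNIV) r u"

definition besov_norm ::
    "(real, 'd) sqmat \<Rightarrow> 'd rfun \<Rightarrow> 'd rfun \<Rightarrow> real \<Rightarrow> ennreal \<Rightarrow> ennreal
      \<Rightarrow> ('d::{finite,linorder} rfun \<Rightarrow> complex) \<Rightarrow> ennreal" where
  "besov_norm A \<psi> \<psi>0 \<alpha> p r f =
     lr_norm r (\<lambda>j. ennreal (\<bar>det A\<bar> powr (real j * \<alpha>)) * Lp_norm p (convolve f (dilated A \<psi> \<psi>0 j)))"

definition besov_space ::
    "(real, 'd) sqmat \<Rightarrow> 'd rfun \<Rightarrow> 'd rfun \<Rightarrow> real \<Rightarrow> ennreal \<Rightarrow> ennreal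
      \<Rightarrow> ('d::{finite,linorder} rfun \<Rightarrow> complex) set" where
  "besov_space A \<psi> \<psi>0 \<alpha> p r =
     {f \<in> tempered_distributions. besov_norm A \<psi> \<psi>0 \<alpha> p r f < \<infinity>}"

(* Convergence of the net of finite partial sums, as for has_sum, but in the quasi-norm of Lq.
   Elements of Lq are represented by functions, so the limit g is unique almost everywhere. *)
definition Lq_unconditional_sum ::
    "ennreal \<Rightarrow> (nat \<Rightarrow> 'd::finite rfun) \<Rightarrow> 'd rfun \<Rightarrow> bool" where
  "Lq_unconditional_sum q h g \<longleftrightarrow> (\<forall>j. h j \<in> Lp_space q) \<and> g \<in> Lp_space q \<and>
     ((\<lambda>F. Lp_norm q (\<lambda>x. (\<Sum>j\<in>F. h j x) - g x)) \<longlongrightarrow> 0) (finite_subsets_at_top UNIV)"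

definition besov_embeds_sobolev ::
    "(real, 'd) sqmat \<Rightarrow> 'd rfun \<Rightarrow> 'd::{finite,linorder} rfun \<Rightarrow> real
      \<Rightarrow> ennreal \<Rightarrow> ennreal \<Rightarrow> nat \<Rightarrow> ennreal \<Rightarrow> bool" where
  "besov_embeds_sobolev A \<psi> \<psi>0 \<alpha> p r n q \<longleftrightarrow>
     (\<forall>\<beta>. sum \<beta> UNIV \<le> n \<longrightarrow>
       (\<exists>C::real. \<forall>f \<in> besov_space A \<psi> \<psi>0 \<alpha> p r. \<exists>g.
          Lq_unconditional_sum q (\<lambda>j. multi_deriv \<beta> (convolve f (dilated A \<psi> \<psi>0 j))) g \<and>
          Lp_norm q g \<le> ennreal C * besov_norm A \<psi> \<psi>0 \<alpha> p r f))"

end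

theory Submission
  imports
    Defs
    "HOL-Probability.Probability"
begin

text \<open>
  The embedding is an inequality between quasi-norms. Each conclusion comes from one family of
  functions for which both sides are known up to constants, and for which the inequality can only
  persist, as the family grows, when the exponents are related as claimed.

  The functions are built from modes. A mode is a superposition of plane waves whose frequencies
  are the images of a small cube of frequencies under the \<open>i\<close>-th power of the transpose of \<open>A\<close>,
  shifted by the image of the vector of ones under its \<open>j\<close>-th power, where \<open>i \<le> j\<close>. So it oscillates
  at scale \<open>j\<close> and lives on the set of points that the \<open>i\<close>-th power of \<open>A\<close> maps into a fixed ball,
  with rapidly decaying tails. As the modes are given by their frequencies, convolutions and
  derivatives act on them by multiplication of the amplitudes (\<open>convolution_wave\<close>,
  \<open>iterated_partial_deriv_wave\<close>). Three facts make both sides of the inequality computable.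

  First, the transpose of \<open>A\<close> is expansive, so each mode meets only boundedly many dyadic blocks, in
  which it keeps its envelope (\<open>exists_scale_separation\<close>, \<open>convolve_test_bound\<close>). This yields upper
  bounds for Besov norms (\<open>exists_scales_constant\<close>, \<open>besov_norm_separated_translates\<close>). Secondly, the
  blocks are finitely many and add up to the function, so that the embedding bounds its actual
  derivative (\<open>embedding_test\<close>). Thirdly, a matrix in expansive Jordan normal form has nonnegative
  entries, so all frequencies have positive coordinates and do not cancel. The \<open>n\<close>-th derivative in
  direction \<open>s\<close> therefore has size at least \<open>growth s j ^ n / 2\<close> near the centre of the mode
  (\<open>Re_dmode_ge\<close>), and \<open>growth s j\<close> dominates the column \<open>s\<close> of the \<open>j\<close>-th power of \<open>A\<close>: it is at
  least the \<open>j\<close>-th power of the largest eigenvalue for a suitable \<open>s\<close>, and larger by a factor of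
  order \<open>j\<close> if the Jordan block is not trivial.

  A single dilated mode (\<open>i = j\<close>) bounds the order of differentiation (\<open>growth_bound\<close>) and excludes
  nontrivial Jordan blocks in the critical case (\<open>not_AND_imp_order_zero\<close>). Translates of a single
  mode give \<open>p \<le> q\<close> (\<open>p_le_q\<close>). In the critical case all scales contribute equally. Then \<open>N\<close> dilated
  modes at different scales have Besov norm of order \<open>N\<close> to the power \<open>1/r\<close>. Pulled apart in space
  they have Sobolev norm of order \<open>N\<close> to the power \<open>1/q\<close> (\<open>r_le_q\<close>), and centred at the same point
  they add up to \<open>N\<close> in the supremum norm (\<open>r_le_1\<close>). For \<open>p = q\<close> one may also take modes of unit size
  (\<open>i = 0\<close>), which overlap and differ in their modulation only, so that for suitable signs their sum
  is of order \<open>sqrt N\<close> (\<open>r_le_2\<close>). The signs are found by averaging (\<open>exists_good_signs\<close>), which makes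
  the sum as large as its square function without any estimate of the interaction of the modes.
\<close>

no_notation Matrix.scalar_prod (infix \<open>\<bullet>\<close> 70)


section \<open>Matrices in expansive Jordan normal form\<close>

lemma jordan_matrix_off_diagonal:
  assumes "i < sum_list (map fst n_as)" "j < sum_list (map fst n_as)" "i \<noteq> j"
  shows "jordan_matrix n_as $$ (i, j) = (0::'a::zero_neq_one) \<or> jordan_matrix n_as $$ (i, j) = 1"
  using assms
proof (induction n_as arbitrary: i j)
  case (Cons na n_as)
  obtain n a where na: "na = (n, a)" by (cases na)
  show ?case
    using Cons.prems Cons.IH[of "i - n" "j - n"]
    by (auto simp: na jordan_matrix_Cons index_mat_four_block)
qed simp

lemma jordan_matrix_large_block:
  assumes "(k, a) \<in> set n_as" "2 \<le> k"
  shows "\<exists>i. Suc i < sum_list (map fst n_as) \<and> jordan_matrix n_as $$ (i, i) = (a::'a::zero_neq_one) \<and>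
    jordan_matrix n_as $$ (Suc i, Suc i) = a \<and> jordan_matrix n_as $$ (i, Suc i) = 1"
  using assms
proof (induction n_as)
  case (Cons na n_as)
  obtain n b where na: "na = (n, b)" by (cases na)
  show ?case
  proof (cases "(k, a) = (n, b)")
    case True
    then show ?thesis
      using Cons.prems by (intro exI[of _ 0]) (auto simp: na jordan_matrix_Cons index_mat_four_block)
  next
    case False
    then obtain i where i: "Suc i < sum_list (map fst n_as)" "jordan_matrix n_as $$ (i, i) = a"
      "jordan_matrix n_as $$ (Suc i, Suc i) = a" "jordan_matrix n_as $$ (i, Suc i) = 1"
      using Cons na by auto
    then show ?thesis
      by (intro exI[of _ "n + i"]) (auto simp: na jordan_matrix_Cons index_mat_four_block)
  qed
qed simp

lemma order_char_poly_jordan_matrix: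
  "Polynomial.order a (char_poly (jordan_matrix n_as)) =
     sum_list (map fst (filter (\<lambda>na. snd na = a) n_as))" for a :: "'a::field"
proof -
  have nz: "(\<Prod>(n, a)\<leftarrow>ms. [:- a, 1:] ^ n) \<noteq> 0" for ms :: "(nat \<times> 'a) list"
    by (induction ms) auto
  have "Polynomial.order a (\<Prod>(n, a)\<leftarrow>n_as. [:- a, 1:] ^ n) =
     sum_list (map fst (filter (\<lambda>na. snd na = a) n_as))"
  proof (induction n_as)
    case (Cons na n_as)
    obtain n b where na: "na = (n, b)" by (cases na)
    have "Polynomial.order a ([:- b, 1:] ^ n) = (if a = b then n else 0)"
    proof (cases "a = b")
      case True
      then show ?thesis by (simp add: order_power_n_n)
    next
      case False
      then have "poly ([:- b, 1:] ^ n) a \<noteq> 0" by (simp add: poly_power)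
      then show ?thesis using False by (simp add: order_0I)
    qed
    moreover have "Polynomial.order a ([:- b, 1:] ^ n * (\<Prod>(n, a)\<leftarrow>n_as. [:- a, 1:] ^ n))
      = Polynomial.order a ([:- b, 1:] ^ n) + Polynomial.order a (\<Prod>(n, a)\<leftarrow>n_as. [:- a, 1:] ^ n)"
      by (rule order_mult) (use nz[of "(n, b) # n_as"] in auto)
    ultimately show ?case
      using Cons.IH by (auto simp: na)
  qed simp
  then show ?thesis by (simp add: jordan_matrix_char_poly)
qed

text \<open>The algebraic multiplicity adds up the sizes of the blocks for an eigenvalue, the geometric
  multiplicity counts these blocks.\<close>

lemma jordan_matrix_defective:
  fixes a :: "'a::field"
  assumes "Polynomial.order a (char_poly (jordan_matrix n_as)) \<noteq> dim_gen_eigenspace (jordan_matrix n_as) a 1"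
  shows "\<exists>k\<ge>2. (k, a) \<in> set n_as"
proof (rule ccontr)
  assume "\<not> ?thesis"
  then have "k < 2" if "(k, a) \<in> set n_as" for k
    using that not_less by blast
  then have "map fst (filter (\<lambda>na. snd na = a) n_as) = map (min 1) (map fst [(n, e)\<leftarrow>n_as . e = a])"
    by (induction n_as) (force simp: min_def)+
  then show False
    using assms by (simp add: order_char_poly_jordan_matrix dim_gen_eigenspace_jordan_matrix comp_def)
qed

text \<open>The enumeration of the index type that is hidden in \<^const>\<open>jnf_mat\<close>.\<close>

definition ith_index :: "nat \<Rightarrow> 'd::{finite,linorder}" where
  "ith_index i = sorted_list_of_set UNIV ! i"

lemma ith_index_strict_mono:
  assumes "i < j" "j < CARD('d::{finite,linorder})"
  shows "ith_index i < (ith_index j :: 'd)"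
  using assms unfolding ith_index_def
  by (intro sorted_wrt_nth_less[of "(<)"]) auto

lemma ith_index_surj: "\<exists>i<CARD('d::{finite,linorder}). x = (ith_index i :: 'd)"
proof -
  have "x \<in> set (sorted_list_of_set UNIV)" by simp
  then show ?thesis unfolding in_set_conv_nth ith_index_def by auto
qed

lemma jnf_mat_carrier: "jnf_mat A \<in> carrier_mat CARD('d) CARD('d)"
  for A :: "('a, 'd::{finite,wellorder}) sqmat"
  by (simp add: jnf_mat_def Let_def)

lemma jnf_mat_index:
  assumes "i < CARD('d)" "j < CARD('d)"
  shows "jnf_mat A $$ (i, j) = A $ ith_index i $ (ith_index j :: 'd::{finite,wellorder})"
  using assms by (simp add: jnf_mat_def ith_index_def Let_def)

lemma spectrum_upper_triangular:
  fixes B :: "complex Matrix.mat"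
  assumes "B \<in> carrier_mat n n" "upper_triangular B"
  shows "spectrum B = {B $$ (i, i) | i. i < n}"
proof -
  have "spectrum B = {k. poly (\<Prod>a\<leftarrow>diag_mat B. [:- a, 1:]) k = 0}"
    using assms by (simp add: spectrum_root_char_poly char_poly_upper_triangular)
  also have "\<dots> = set (diag_mat B)"
    by (auto simp: poly_prod_list prod_list_zero_iff)
  finally show ?thesis using assms by (auto simp: diag_mat_def)
qed

lemma mat_pow_0 [simp]: "mat_pow A 0 = mat 1"
  by (simp add: mat_pow_def)

lemma mat_pow_Suc: "mat_pow A (Suc k) = A ** mat_pow A k"
  by (simp add: mat_pow_def)

lemma mat_pow_add: "mat_pow A (j + k) = mat_pow A j ** mat_pow A k"
  by (induction j) (simp_all add: mat_pow_Suc matrix_mul_assoc)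

lemma mat_pow_Suc2: "mat_pow A (Suc k) = mat_pow A k ** A"
  using mat_pow_add[of A k 1] by (simp add: mat_pow_Suc)

lemma mat_pow_transpose: "mat_pow (transpose A) k = transpose (mat_pow A k)"
  by (induction k) (simp_all add: mat_pow_Suc2[of A] mat_pow_Suc[of "transpose A"] matrix_transpose_mul transpose_mat)

lemma matrix_inv_inverse:
  assumes "invertible M"
  shows "M ** matrix_inv M = mat 1 \<and> matrix_inv M ** M = mat 1"
  using assms unfolding invertible_def matrix_inv_def by (rule someI_ex)

lemma matrix_inv_eqI:
  fixes M :: "(real, 'd::finite) sqmat"
  assumes "M ** N = mat 1"
  shows "matrix_inv M = N"
proof -
  have "N ** M = mat 1" using assms matrix_left_right_inverse by blast
  with assms have "invertible M" unfolding invertible_def by blast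
  note matrix_inv_inverse[OF this]
  then have "matrix_inv M = matrix_inv M ** (M ** N)" "matrix_inv M ** M = mat 1"
    by (simp_all add: assms)
  then show ?thesis by (simp add: matrix_mul_assoc)
qed

locale expansive_jordan =
  fixes A :: "(real, 'd::{finite,wellorder}) sqmat"
  assumes inv: "invertible A" and jordan: "expansive_jordan_normal_form A"
begin

abbreviation "lam \<equiv> lambda_max A"

lemma det_A: "det A = 2"
  using jordan by (simp add: expansive_jordan_normal_form_def expansive_normal_form_def)

lemma off_diagonal: assumes "i \<noteq> j" shows "A $ i $ j \<in> {0, 1}"
proof -
  obtain n_as where J: "jnf_mat A = jordan_matrix n_as"
    using jordan by (auto simp: expansive_jordan_normal_form_def)
  then have dim: "sum_list (map fst n_as) = CARD('d)"
    using jnf_mat_carrier[of A] by (metis carrier_matD(1) jordan_matrix_dim(1))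
  obtain k l where kl: "k < CARD('d)" "l < CARD('d)" "i = ith_index k" "j = ith_index l"
    using ith_index_surj by metis
  then show ?thesis
    using jordan_matrix_off_diagonal[of k n_as l] assms jnf_mat_index[of k l A] by (auto simp: J dim)
qed

lemma upper: assumes "j < i" shows "A $ i $ j = 0"
proof -
  obtain n_as where J: "jnf_mat A = jordan_matrix n_as"
    using jordan by (auto simp: expansive_jordan_normal_form_def)
  then have dim: "sum_list (map fst n_as) = CARD('d)"
    using jnf_mat_carrier[of A] by (metis carrier_matD(1) jordan_matrix_dim(1))
  obtain k l where kl: "k < CARD('d)" "l < CARD('d)" "i = ith_index k" "j = ith_index l"
    using ith_index_surj by metis
  have "l < k" 
    using assms kl ith_index_strict_mono[of k l] by (metis linorder_neqE_nat order_less_asym)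
  then show ?thesis
    using jordan_matrix_upper_triangular[of k n_as l] jnf_mat_index[of k l A] kl by (auto simp: J dim)
qed

lemma complex_eigenvalues_eq: "complex_eigenvalues A = range (\<lambda>i. complex_of_real (A $ i $ i))"
proof -
  let ?B = "jnf_mat (map_matrix complex_of_real A)"
  have "upper_triangular ?B"
    unfolding upper_triangular_def
    using jnf_mat_carrier[of "map_matrix complex_of_real A"] ith_index_strict_mono[where 'd='d]
    by (auto simp: jnf_mat_index map_matrix_def upper)
  then have "complex_eigenvalues A = {?B $$ (i, i) | i. i < CARD('d)}"
    unfolding complex_eigenvalues_def by (intro spectrum_upper_triangular jnf_mat_carrier)
  also have "\<dots> = (\<lambda>i. ?B $$ (i, i)) ` {..<CARD('d)}" by auto
  also have "\<dots> = (\<lambda>i. complex_of_real (A $ ith_index i $ ith_index i)) ` {..<CARD('d)}"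
    by (rule image_cong) (auto simp: jnf_mat_index map_matrix_def)
  also have "\<dots> = range (\<lambda>i. complex_of_real (A $ i $ i))"
  proof -
    have "UNIV = (ith_index ` {..<CARD('d)} :: 'd set)" using ith_index_surj by blast
    from arg_cong[OF this, of "\<lambda>S. (\<lambda>i. complex_of_real (A $ i $ i)) ` S"]
    show ?thesis by (simp add: image_image)
  qed
  finally show ?thesis .
qed

lemma diagonal_gt_1: "A $ i $ i > 1"
proof -
  have "complex_of_real (A $ i $ i) \<in> complex_eigenvalues A"
    by (simp add: complex_eigenvalues_eq)
  then show ?thesis
    using jordan by (auto simp: expansive_jordan_normal_form_def expansive_normal_form_def)
qed

lemma nonneg: "A $ i $ j \<ge> 0"
  using off_diagonal[of i j] diagonal_gt_1[of i] by (cases "i = j") auto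

lemma lambda_max_diagonal: "\<exists>s. A $ s $ s = lam"
proof -
  have "lam \<in> norm ` complex_eigenvalues A"
    unfolding lambda_max_def complex_eigenvalues_def
    by (rule spectral_radius_mem_max(1)[OF jnf_mat_carrier]) simp
  then show ?thesis
    using nonneg by (force simp: complex_eigenvalues_eq)
qed

lemma lambda_max_gt_1: "lam > 1"
  using lambda_max_diagonal diagonal_gt_1 by metis

lemma not_AND_superdiagonal:
  assumes "\<not> asymptotically_norm_diagonal A"
  shows "\<exists>s t. s \<noteq> t \<and> A $ s $ s = lam \<and> A $ t $ t = lam \<and> A $ s $ t = 1"
proof -
  obtain n_as where J: "jnf_mat A = jordan_matrix n_as"
    using jordan by (auto simp: expansive_jordan_normal_form_def)
  then have dim: "sum_list (map fst n_as) = CARD('d)"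
    using jnf_mat_carrier[of A] by (metis carrier_matD(1) jordan_matrix_dim(1))
  obtain k where "2 \<le> k" "(k, lam) \<in> set n_as"
    using assms jordan_matrix_defective[of lam n_as] unfolding asymptotically_norm_diagonal_def J by auto
  then obtain i where i: "Suc i < CARD('d)" "jnf_mat A $$ (i, i) = lam"
      "jnf_mat A $$ (Suc i, Suc i) = lam" "jnf_mat A $$ (i, Suc i) = 1"
    using jordan_matrix_large_block[of k lam n_as] dim unfolding J by auto
  have "ith_index i < (ith_index (Suc i) :: 'd)"
    using i by (intro ith_index_strict_mono) auto
  then show ?thesis
    using i by (intro exI[of _ "ith_index i"] exI[of _ "ith_index (Suc i)"]) (auto simp: jnf_mat_index)
qed

lemma mat_pow_nonneg: "mat_pow A k $ i $ j \<ge> 0"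
  by (induction k arbitrary: i j)
     (auto simp: mat_pow_Suc matrix_matrix_mult_def mat_def nonneg intro!: sum_nonneg)

lemma mat_pow_diagonal_ge: "mat_pow A k $ i $ i \<ge> (A $ i $ i) ^ k"
proof (induction k)
  case (Suc k)
  have "(A $ i $ i) ^ Suc k \<le> A $ i $ i * mat_pow A k $ i $ i"
    using Suc nonneg by (simp add: mult_left_mono)
  also have "\<dots> \<le> (\<Sum>l\<in>UNIV. A $ i $ l * mat_pow A k $ l $ i)"
    by (intro member_le_sum) (auto simp: nonneg mat_pow_nonneg)
  finally show ?case by (simp add: mat_pow_Suc matrix_matrix_mult_def)
qed (simp add: mat_def)

text \<open>Entries of powers are sums over paths of products of entries. All products are nonnegative, and
  the step from \<open>s\<close> to \<open>t\<close> can be taken at any of the \<open>k\<close> times.\<close>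

lemma mat_pow_superdiagonal_ge:
  assumes "s \<noteq> t" "A $ s $ s = a" "A $ t $ t = a" "A $ s $ t = 1"
  shows "mat_pow A k $ s $ t \<ge> real k * a ^ (k - 1)"
proof (induction k)
  case (Suc k)
  have "a \<ge> 0" using assms nonneg by metis
  have "real (Suc k) * a ^ (Suc k - 1) = a * (real k * a ^ (k - 1)) + a ^ k"
    by (cases k) (auto simp: algebra_simps)
  also have "\<dots> \<le> A $ s $ s * mat_pow A k $ s $ t + A $ s $ t * mat_pow A k $ t $ t"
    using Suc mat_pow_diagonal_ge[of t k] assms \<open>a \<ge> 0\<close> by (auto intro!: add_mono mult_left_mono)
  also have "\<dots> = (\<Sum>l\<in>{s, t}. A $ s $ l * mat_pow A k $ l $ t)"
    using assms by simp
  also have "\<dots> \<le> (\<Sum>l\<in>UNIV. A $ s $ l * mat_pow A k $ l $ t)"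
    by (intro sum_mono2) (auto simp: nonneg mat_pow_nonneg)
  finally show ?case by (simp add: mat_pow_Suc matrix_matrix_mult_def)
qed (use assms in \<open>simp add: mat_def\<close>)


abbreviation "iA \<equiv> matrix_inv A"

lemma A_iA: "A ** iA = mat 1" and iA_A: "iA ** A = mat 1"
  using matrix_inv_inverse[OF inv] by auto

lemma pow_A_pow_iA: "mat_pow A k ** mat_pow iA k = mat 1"
proof (induction k)
  case (Suc k)
  have "mat_pow A (Suc k) ** mat_pow iA (Suc k) = mat_pow A k ** (A ** iA) ** mat_pow iA k"
    by (simp only: mat_pow_Suc2[of A] mat_pow_Suc[of iA] matrix_mul_assoc)
  then show ?case by (simp add: A_iA Suc)
qed simp

lemma pow_iA_pow_A: "mat_pow iA k ** mat_pow A k = mat 1"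
  using pow_A_pow_iA matrix_left_right_inverse[of "mat_pow A k" "mat_pow iA k"] by simp

lemma mat_powi_transpose: "mat_powi (transpose A) (- int k) = transpose (mat_pow iA k)"
proof -
  have "matrix_inv (transpose A) = transpose iA"
    by (rule matrix_inv_eqI) (simp add: iA_A transpose_mat flip: matrix_transpose_mul)
  then show ?thesis
    by (cases "k = 0") (simp_all add: mat_powi_def mat_pow_transpose transpose_mat)
qed

text \<open>In a weighted maximum norm whose weights grow fast along the order of the indices, the
  superdiagonal part of \<open>A\<close> is negligible, so that \<open>A\<close> expands by a factor close to its smallest
  eigenvalue.\<close>

lemma entries_inverse_power_decay:
  "\<exists>C \<rho>. 0 < \<rho> \<and> \<rho> < 1 \<and> C \<ge> 1 \<and> (\<forall>k i j. \<bar>mat_pow iA k $ i $ j\<bar> \<le> C * \<rho> ^ k)"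
proof -
  define \<mu> where "\<mu> = Min (range (\<lambda>i. A $ i $ i))"
  have \<mu>: "\<mu> > 1" "\<And>i. \<mu> \<le> A $ i $ i"
    unfolding \<mu>_def by (auto simp: diagonal_gt_1)
  define \<rho> where "\<rho> = (1 + \<mu>) / 2"
  have \<rho>: "\<rho> > 1" using \<mu> by (simp add: \<rho>_def)
  \<comment> \<open>The off-diagonal entries of a row are at most one. With these weights they take away at most
      half of the excess of the diagonal entry over one.\<close>
  define L where "L = max 1 (2 * real CARD('d) / (\<mu> - 1))"
  have L: "L \<ge> 1" "real CARD('d) / L \<le> (\<mu> - 1) / 2"
    using \<mu> by (auto simp: L_def field_simps max_def)
  define w :: "'d \<Rightarrow> real" where "w i = L ^ card {l. l < i}" for i
  have w1: "w i \<ge> 1" for i using L by (simp add: w_def)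
  have w_mono: "w i * L \<le> w l" if "i < l" for i l
  proof -
    have "Suc (card {m. m < i}) \<le> card {m. m < l}"
        unfolding Suc_le_eq using that by (intro psubset_card_mono) auto
    from power_increasing[OF this L(1)] show ?thesis by (simp add: w_def mult.commute)
  qed
  define W where "W x = Max (range (\<lambda>i. w i * \<bar>x $ i\<bar>))" for x :: "'d rvec"
  have W_ge: "w i * \<bar>x $ i\<bar> \<le> W x" for x i
    by (simp add: W_def)
  have W_expand: "\<rho> * W x \<le> W (A *v x)" for x
  proof -
    have "W x \<in> range (\<lambda>i. w i * \<bar>x $ i\<bar>)"
      unfolding W_def by (intro Max_in) auto
    then obtain i where i: "W x = w i * \<bar>x $ i\<bar>" by auto
    have W0: "W x \<ge> 0" using i w1[of i] by simp
    have small: "w i * (A $ i $ l * \<bar>x $ l\<bar>) \<le> W x / L" if "l \<noteq> i" for l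
    proof (cases "i < l")
      case True
      have "w i * \<bar>x $ l\<bar> * L \<le> W x"
        using mult_right_mono[OF w_mono[OF True], of "\<bar>x $ l\<bar>"] W_ge[of l x] by (simp add: algebra_simps)
      then have "w i * \<bar>x $ l\<bar> \<le> W x / L" using L by (simp add: field_simps)
      then show ?thesis using off_diagonal[of i l] that W0 L by auto
    next
      case False
      then show ?thesis using upper[of l i] that W0 L by auto
    qed
    have "\<mu> * W x \<le> w i * (A $ i $ i * \<bar>x $ i\<bar>)"
      using mult_right_mono[OF \<mu>(2)[of i], of "w i * \<bar>x $ i\<bar>"] w1[of i] by (simp add: i algebra_simps)
    also have "\<dots> = w i * \<bar>(A *v x) $ i - (\<Sum>l\<in>UNIV - {i}. A $ i $ l * x $ l)\<bar>"
      by (simp add: matrix_vector_mult_def sum.remove[of UNIV i] abs_mult nonneg)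
    also have "\<dots> \<le> w i * (\<bar>(A *v x) $ i\<bar> + (\<Sum>l\<in>UNIV - {i}. A $ i $ l * \<bar>x $ l\<bar>))"
    proof -
      have "\<bar>\<Sum>l\<in>UNIV - {i}. A $ i $ l * x $ l\<bar> \<le> (\<Sum>l\<in>UNIV - {i}. A $ i $ l * \<bar>x $ l\<bar>)"
        by (rule order.trans[OF sum_abs]) (simp add: abs_mult nonneg)
      then show ?thesis using w1[of i] by (intro mult_left_mono) auto
    qed
    also have "\<dots> = w i * \<bar>(A *v x) $ i\<bar> + (\<Sum>l\<in>UNIV - {i}. w i * (A $ i $ l * \<bar>x $ l\<bar>))"
      by (simp add: distrib_left sum_distrib_left)
    also have "\<dots> \<le> W (A *v x) + (\<Sum>l\<in>UNIV - {i}. W x / L)"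
      by (intro add_mono sum_mono small W_ge) auto
    also have "\<dots> \<le> W (A *v x) + real CARD('d) * (W x / L)"
      using W0 L by (intro add_left_mono) (auto intro!: divide_right_mono mult_right_mono simp: card_Diff_subset)
    also have "\<dots> = W (A *v x) + real CARD('d) / L * W x" by simp
    also have "\<dots> \<le> W (A *v x) + (\<mu> - 1) / 2 * W x"
      using L W0 by (intro add_left_mono mult_right_mono) auto
    finally show ?thesis by (simp add: \<rho>_def field_simps)
  qed
  have W_pow: "\<rho> ^ k * W (mat_pow iA k *v x) \<le> W x" for k x
  proof (induction k)
    case (Suc k)
    have "A *v (mat_pow iA (Suc k) *v x) = mat_pow iA k *v x"
      by (simp add: mat_pow_Suc matrix_vector_mul_assoc matrix_mul_assoc A_iA)
    with W_expand[of "mat_pow iA (Suc k) *v x"]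
    have "\<rho> * W (mat_pow iA (Suc k) *v x) \<le> W (mat_pow iA k *v x)" by simp
    then have "\<rho> ^ k * (\<rho> * W (mat_pow iA (Suc k) *v x)) \<le> \<rho> ^ k * W (mat_pow iA k *v x)"
      using \<rho> by (intro mult_left_mono) auto
    then show ?case using Suc by (simp add: algebra_simps)
  qed simp
  define C where "C = Max (range w)"
  have C: "w j \<le> C" for j by (simp add: C_def)
  have "\<bar>mat_pow iA k $ i $ j\<bar> \<le> C * (1 / \<rho>) ^ k" for k i j
  proof -
    let ?e = "axis j 1 :: 'd rvec"
    have "W ?e \<le> C"
      using C w1 order.trans[OF w1 C] 
      unfolding W_def by (subst Max_le_iff) (auto simp: axis_def order.trans[OF zero_le_one])
    have "mat_pow iA k $ i $ j = (mat_pow iA k *v ?e) $ i"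
      by (simp add: matrix_vector_mul_component inner_axis)
    then have "\<bar>mat_pow iA k $ i $ j\<bar> \<le> W (mat_pow iA k *v ?e)"
      using W_ge[of i "mat_pow iA k *v ?e"] mult_right_mono[OF w1[of i], of "\<bar>(mat_pow iA k *v ?e) $ i\<bar>"] by simp
    then have "\<rho> ^ k * \<bar>mat_pow iA k $ i $ j\<bar> \<le> \<rho> ^ k * W (mat_pow iA k *v ?e)"
      using \<rho> by (intro mult_left_mono) auto
    also have "\<dots> \<le> C" using W_pow[of k ?e] \<open>W ?e \<le> C\<close> by simp
    finally show ?thesis using \<rho> by (simp add: field_simps power_divide)
  qed
  then show ?thesis
    using \<rho> order.trans[OF w1 C] by (intro exI[of _ C] exI[of _ "1 / \<rho>"]) auto
qed

text \<open>Dilating a function by a power of \<open>A\<close> moves its frequencies by the same power of the transpose.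
  The negative powers are expressed by \<^const>\<open>mat_powi\<close>, the form in which they occur in the
  definition of wavelets.\<close>

definition up :: "nat \<Rightarrow> 'd rvec \<Rightarrow> 'd rvec" where
  "up k \<xi> = mat_pow (transpose A) k *v \<xi>"

definition down :: "nat \<Rightarrow> 'd rvec \<Rightarrow> 'd rvec" where
  "down k \<xi> = mat_powi (transpose A) (- int k) *v \<xi>"

lemma up_add: "up (j + k) \<xi> = up j (up k \<xi>)"
  by (simp add: up_def mat_pow_add matrix_vector_mul_assoc)

lemma down_eq: "down k \<xi> = transpose (mat_pow iA k) *v \<xi>"
  by (simp add: down_def mat_powi_transpose)

lemma down_add: "down (j + k) \<xi> = down j (down k \<xi>)"
proof -
  have "mat_pow iA (j + k) = mat_pow iA k ** mat_pow iA j" by (metis add.commute mat_pow_add)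
  then show ?thesis
    by (simp only: down_eq matrix_transpose_mul matrix_vector_mul_assoc)
qed

lemma up_down: "up k (down k \<xi>) = \<xi>" and down_up: "down k (up k \<xi>) = \<xi>"
  by (simp_all only: down_eq up_def mat_pow_transpose matrix_vector_mul_assoc pow_A_pow_iA pow_iA_pow_A
      transpose_mat matrix_vector_mul_lid flip: matrix_transpose_mul)

lemma down_up_le: "m \<le> j \<Longrightarrow> down m (up j \<xi>) = up (j - m) \<xi>"
  using up_add[of m "j - m" \<xi>] by (simp add: down_up)

lemma down_up_ge: "j \<le> m \<Longrightarrow> down m (up j \<xi>) = down (m - j) \<xi>"
  using down_add[of "m - j" j "up j \<xi>"] by (simp add: down_up)

lemma inner_up: "x \<bullet> up k \<xi> = (mat_pow A k *v x) \<bullet> \<xi>"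
  unfolding up_def mat_pow_transpose transpose_matrix_vector
  by (metis dot_lmul_matrix inner_commute)

lemma up_index: "up k \<xi> $ i = (\<Sum>l\<in>UNIV. mat_pow A k $ l $ i * \<xi> $ l)"
  by (simp add: up_def mat_pow_transpose vector_matrix_mult_def mult.commute)

lemma down_decay:
  "\<exists>C \<rho>. 0 < \<rho> \<and> \<rho> < 1 \<and> C \<ge> 1 \<and> (\<forall>k \<xi> i c. (\<forall>l. \<bar>\<xi> $ l\<bar> \<le> c) \<longrightarrow> \<bar>down k \<xi> $ i\<bar> \<le> C * \<rho> ^ k * c)"
proof -
  obtain C \<rho> where C: "0 < \<rho>" "\<rho> < 1" "C \<ge> 1" "\<And>k i j. \<bar>mat_pow iA k $ i $ j\<bar> \<le> C * \<rho> ^ k"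
    using entries_inverse_power_decay by blast
  have "\<bar>down k \<xi> $ i\<bar> \<le> (real CARD('d) * C) * \<rho> ^ k * c" if "\<And>l. \<bar>\<xi> $ l\<bar> \<le> c" for k \<xi> i c
  proof -
    have "\<bar>down k \<xi> $ i\<bar> \<le> (\<Sum>l\<in>UNIV. \<bar>mat_pow iA k $ l $ i * \<xi> $ l\<bar>)"
      by (simp add: down_eq matrix_vector_mult_def Finite_Cartesian_Product.transpose_def)
    also have "\<dots> \<le> (\<Sum>l\<in>(UNIV::'d set). C * \<rho> ^ k * c)"
      unfolding abs_mult using C that by (intro sum_mono mult_mono) auto
    finally show ?thesis by simp
  qed
  moreover have "real CARD('d) * C \<ge> 1"
    using C mult_mono[of 1 "real CARD('d)" 1 C] by (simp add: Suc_leI)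
  ultimately show ?thesis using C by blast
qed

lemma pow_iA_bounded:
  "\<exists>C\<ge>1. \<forall>k x i c. (\<forall>l. \<bar>x $ l\<bar> \<le> c) \<longrightarrow> \<bar>(mat_pow iA k *v x) $ i\<bar> \<le> C * c"
proof -
  obtain C \<rho> where C: "0 < \<rho>" "\<rho> < 1" "C \<ge> 1" "\<And>k i j. \<bar>mat_pow iA k $ i $ j\<bar> \<le> C * \<rho> ^ k"
    using entries_inverse_power_decay by blast
  have C': "\<bar>mat_pow iA k $ i $ j\<bar> \<le> C" for k i j
  proof -
    have "C * \<rho> ^ k \<le> C * 1" using C(1-3) by (intro mult_left_mono power_le_one) auto
    then show ?thesis using C(4)[of k i j] by linarith
  qed
  have "\<bar>(mat_pow iA k *v x) $ i\<bar> \<le> (real CARD('d) * C) * c" if "\<And>l. \<bar>x $ l\<bar> \<le> c" for k x i c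
  proof -
    have "\<bar>(mat_pow iA k *v x) $ i\<bar> \<le> (\<Sum>l\<in>UNIV. \<bar>mat_pow iA k $ i $ l * x $ l\<bar>)"
      by (simp add: matrix_vector_mult_def)
    also have "\<dots> \<le> (\<Sum>l\<in>(UNIV::'d set). C * c)"
      unfolding abs_mult using C C' that by (intro sum_mono mult_mono) auto
    finally show ?thesis by simp
  qed
  moreover have "real CARD('d) * C \<ge> 1"
    using C mult_mono[of 1 "real CARD('d)" 1 C] by (simp add: Suc_leI)
  ultimately show ?thesis by blast
qed

lemma up_ge_power:
  assumes "\<And>l. \<zeta> $ l \<ge> c" "c \<ge> 0"
  shows "up k \<zeta> $ i \<ge> c * (A $ i $ i) ^ k"
proof -
  have "c * (A $ i $ i) ^ k \<le> mat_pow A k $ i $ i * \<zeta> $ i"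
    using assms mat_pow_diagonal_ge[of i k] nonneg by (subst mult.commute) (intro mult_mono mat_pow_nonneg)
  also have "\<dots> \<le> (\<Sum>l\<in>UNIV. mat_pow A k $ l $ i * \<zeta> $ l)"
    using assms by (intro member_le_sum) (auto intro!: mult_nonneg_nonneg mat_pow_nonneg intro: order.trans)
  finally show ?thesis by (simp add: up_index)
qed

end

section \<open>Linear changes of variables\<close>

text \<open>Lebesgue measure is determined by its values on boxes, and a linear map changes the volume of
  a box by its determinant.\<close>

lemma lborel_matrix:
  fixes B :: "real ^ 'd::{finite,wellorder} ^ 'd::{finite,wellorder}"
  assumes "invertible B"
  shows "lborel = density (distr lborel borel ((*v) B)) (\<lambda>_. ennreal \<bar>det B\<bar>)"
proof (rule lborel_eqI)
  from assms obtain B' where B': "B ** B' = mat 1" "B' ** B = mat 1"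
    unfolding invertible_def by blast
  have meas [measurable]: "(*v) B \<in> borel_measurable borel"
    by (intro borel_measurable_continuous_onI continuous_intros)
  have det: "\<bar>det B\<bar> * \<bar>det B'\<bar> = 1"
    using det_mul[of B B'] B' by (simp flip: abs_mult)
  fix l u :: "'d rvec" assume le: "\<And>b. b \<in> Basis \<Longrightarrow> l \<bullet> b \<le> u \<bullet> b"
  have vim: "(*v) B -` box l u = (*v) B' ` box l u"
  proof (intro equalityI subsetI)
    fix x assume "x \<in> (*v) B -` box l u"
    moreover have "x = B' *v (B *v x)" by (simp add: matrix_vector_mul_assoc B')
    ultimately show "x \<in> (*v) B' ` box l u" by blast
  next
    fix x assume "x \<in> (*v) B' ` box l u"
    then show "x \<in> (*v) B -` box l u" by (auto simp: matrix_vector_mul_assoc B')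
  qed
  have img: "(*v) B' ` box l u \<in> lmeasurable"
    "measure lebesgue ((*v) B' ` box l u) = \<bar>det B'\<bar> * measure lebesgue (box l u)"
    using measurable_linear_image[of "(*v) B'" "box l u"] measure_linear_image[of "(*v) B'" "box l u"] by auto
  have sets: "(*v) B -` box l u \<in> sets borel"
    using measurable_sets[OF meas, of "box l u"] by simp
  have "emeasure lborel ((*v) B -` box l u) = emeasure lebesgue ((*v) B' ` box l u)"
    using sets by (simp add: vim)
  also have "\<dots> = ennreal (\<bar>det B'\<bar> * measure lebesgue (box l u))"
    using img by (simp add: emeasure_eq_measure2)
  finally have "emeasure (density (distr lborel borel ((*v) B)) (\<lambda>_. ennreal \<bar>det B\<bar>)) (box l u)
      = ennreal \<bar>det B\<bar> * ennreal (\<bar>det B'\<bar> * measure lebesgue (box l u))"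
    by (simp add: emeasure_density nn_integral_cmult emeasure_distr)
  also have "\<dots> = ennreal (measure lebesgue (box l u))"
    using det by (simp flip: ennreal_mult' mult.assoc)
  also have "\<dots> = (\<Prod>b\<in>Basis. (u - l) \<bullet> b)"
    using le by (simp add: measure_lborel_box_eq)
  finally show "emeasure (density (distr lborel borel ((*v) B)) (\<lambda>_. ennreal \<bar>det B\<bar>)) (box l u)
      = (\<Prod>b\<in>Basis. (u - l) \<bullet> b)" .
qed simp

lemma nn_integral_lborel_matrix:
  fixes B :: "real ^ 'd::{finite,wellorder} ^ 'd::{finite,wellorder}"
  assumes "invertible B" "f \<in> borel_measurable borel"
  shows "ennreal \<bar>det B\<bar> * (\<integral>\<^sup>+x. f (B *v x) \<partial>lborel) = (\<integral>\<^sup>+x. f x \<partial>lborel)"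
proof -
  note assms(2)[measurable]
  have [measurable]: "(*v) B \<in> borel_measurable borel"
    by (intro borel_measurable_continuous_onI continuous_intros)
  show ?thesis
    by (subst (2) lborel_matrix[OF assms(1)])
       (simp add: nn_integral_density nn_integral_distr nn_integral_cmult)
qed

lemma integral_lborel_matrix:
  fixes B :: "real ^ 'd::{finite,wellorder} ^ 'd::{finite,wellorder}"
    and f :: "'d rvec \<Rightarrow> 'b::{banach,second_countable_topology}"
  assumes "invertible B" "f \<in> borel_measurable borel"
  shows "\<bar>det B\<bar> *\<^sub>R (LINT x|lborel. f (B *v x)) = (LINT x|lborel. f x)"
proof -
  note assms(2)[measurable]
  have [measurable]: "(*v) B \<in> borel_measurable borel"
    by (intro borel_measurable_continuous_onI continuous_intros)
  show ?thesis
    by (subst (2) lborel_matrix[OF assms(1)]) (simp add: integral_density integral_distr)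
qed

lemma integrable_lborel_matrix:
  fixes B :: "real ^ 'd::{finite,wellorder} ^ 'd::{finite,wellorder}"
    and f :: "'d rvec \<Rightarrow> 'b::{banach,second_countable_topology}"
  assumes "invertible B" "integrable lborel f"
  shows "integrable lborel (\<lambda>x. f (B *v x))"
proof -
  have [measurable]: "(*v) B \<in> borel_measurable borel"
    by (intro borel_measurable_continuous_onI continuous_intros)
  have [measurable]: "f \<in> borel_measurable borel" using assms(2) by auto
  have "det B \<noteq> 0" using assms(1) invertible_det_nz by blast
  have "ennreal \<bar>det B\<bar> * (\<integral>\<^sup>+x. norm (f (B *v x)) \<partial>lborel) < \<infinity>"
    using nn_integral_lborel_matrix[OF assms(1), of "\<lambda>x. norm (f x)"] assms(2)
    by (simp add: integrable_iff_bounded)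
  then show ?thesis
    using \<open>det B \<noteq> 0\<close> by (auto simp: integrable_iff_bounded ennreal_mult_less_top)
qed

lemma lborel_reflect:
  fixes t :: "'a::euclidean_space"
  shows "lborel = distr lborel borel (\<lambda>x. t - x)"
  using lborel_affine[of "-1" t] by (simp add: density_1)

lemma lborel_shift:
  fixes t :: "'a::euclidean_space"
  shows "lborel = distr lborel borel (\<lambda>x. x - t)"
  using lborel_affine[of 1 "- t"] by (simp add: density_1)

lemma integral_lborel_reflect:
  fixes f :: "'a::euclidean_space \<Rightarrow> complex"
  assumes [measurable]: "f \<in> borel_measurable borel"
  shows "(LINT x|lborel. f (t - x)) = (LINT x|lborel. f x)"
  by (subst (2) lborel_reflect[of t]) (simp add: integral_distr)

lemma integrable_lborel_reflect:
  fixes f :: "'a::euclidean_space \<Rightarrow> complex"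
  assumes "integrable lborel f"
  shows "integrable lborel (\<lambda>x. f (t - x))"
proof -
  have "integrable (distr lborel borel (\<lambda>x. t - x)) f"
    using assms lborel_reflect[of t] by simp
  then show ?thesis by (subst (asm) integrable_distr_eq) (use assms in auto)
qed

lemma nn_integral_lborel_shift:
  fixes t :: "'a::euclidean_space"
  assumes [measurable]: "f \<in> borel_measurable borel"
  shows "(\<integral>\<^sup>+x. f (x - t) \<partial>lborel) = (\<integral>\<^sup>+x. f x \<partial>lborel)"
  by (subst (2) lborel_shift[of t]) (simp add: nn_integral_distr)

section \<open>Partial derivatives and Schwartz functions\<close>

text \<open>The mean value theorem, first in direction \<open>u\<close> and then in direction \<open>v\<close>. The second difference on
  the left is symmetric in both directions, which makes mixed derivatives commute.\<close>

lemma second_difference_mean_value: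
  fixes F :: "'a::real_normed_vector \<Rightarrow> real"
  assumes "\<And>x. ((\<lambda>t. F (x + t *\<^sub>R u)) has_real_derivative Fu x) (at 0)"
    and "\<And>x. ((\<lambda>t. Fu (x + t *\<^sub>R v)) has_real_derivative Fuv x) (at 0)"
    and "h > 0"
  shows "\<exists>\<sigma> \<tau>. 0 < \<sigma> \<and> \<sigma> < h \<and> 0 < \<tau> \<and> \<tau> < h \<and>
    F (x + h *\<^sub>R u + h *\<^sub>R v) - F (x + h *\<^sub>R u) - F (x + h *\<^sub>R v) + F x = h * h * Fuv (x + \<sigma> *\<^sub>R u + \<tau> *\<^sub>R v)"
proof -
  have D: "((\<lambda>t. G (y + t *\<^sub>R w)) has_real_derivative Gw (y + s *\<^sub>R w)) (at s)"
    if "\<And>x. ((\<lambda>t. G (x + t *\<^sub>R w)) has_real_derivative Gw x) (at 0)" for G Gw y s and w :: 'a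
    using that[of "y + s *\<^sub>R w"] DERIV_shift[of "\<lambda>t. G (y + t *\<^sub>R w)" "Gw (y + s *\<^sub>R w)" 0 s]
    by (simp add: algebra_simps)
  define \<phi> where "\<phi> s = F (x + h *\<^sub>R v + s *\<^sub>R u) - F (x + s *\<^sub>R u)" for s
  have "\<exists>z>0. z < h \<and> \<phi> h - \<phi> 0 = (h - 0) * (Fu (x + h *\<^sub>R v + z *\<^sub>R u) - Fu (x + z *\<^sub>R u))"
    unfolding \<phi>_def by (rule MVT2[OF \<open>h > 0\<close>]) (rule DERIV_diff[OF D[OF assms(1)] D[OF assms(1)]])
  then obtain \<sigma> where \<sigma>: "0 < \<sigma>" "\<sigma> < h"
    "\<phi> h - \<phi> 0 = h * (Fu (x + h *\<^sub>R v + \<sigma> *\<^sub>R u) - Fu (x + \<sigma> *\<^sub>R u))" by auto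
  have "\<exists>z>0. z < h \<and> Fu (x + \<sigma> *\<^sub>R u + h *\<^sub>R v) - Fu (x + \<sigma> *\<^sub>R u + 0 *\<^sub>R v) = (h - 0) * Fuv (x + \<sigma> *\<^sub>R u + z *\<^sub>R v)"
    by (rule MVT2[OF \<open>h > 0\<close>]) (rule D[OF assms(2)])
  then obtain \<tau> where \<tau>: "0 < \<tau>" "\<tau> < h"
    "Fu (x + \<sigma> *\<^sub>R u + h *\<^sub>R v) - Fu (x + \<sigma> *\<^sub>R u) = h * Fuv (x + \<sigma> *\<^sub>R u + \<tau> *\<^sub>R v)" by auto
  show ?thesis
    using \<sigma> \<tau> by (intro exI[of _ \<sigma>] exI[of _ \<tau>]) (simp add: \<phi>_def algebra_simps)
qed

lemma mixed_derivatives_commute_real: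
  fixes F :: "'a::real_normed_vector \<Rightarrow> real"
  assumes "\<And>x. ((\<lambda>t. F (x + t *\<^sub>R u)) has_real_derivative Fu x) (at 0)"
    and "\<And>x. ((\<lambda>t. F (x + t *\<^sub>R v)) has_real_derivative Fv x) (at 0)"
    and "\<And>x. ((\<lambda>t. Fu (x + t *\<^sub>R v)) has_real_derivative Fuv x) (at 0)"
    and "\<And>x. ((\<lambda>t. Fv (x + t *\<^sub>R u)) has_real_derivative Fvu x) (at 0)"
    and cont: "isCont Fuv x" "isCont Fvu x"
  shows "Fuv x = Fvu x"
proof (rule ccontr)
  assume "Fuv x \<noteq> Fvu x"
  define e where "e = \<bar>Fuv x - Fvu x\<bar> / 2"
  have "e > 0" using \<open>Fuv x \<noteq> Fvu x\<close> by (simp add: e_def)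
  obtain d where d: "d > 0" "\<And>y. dist y x < d \<Longrightarrow> dist (Fuv y) (Fuv x) < e"
      "\<And>y. dist y x < d \<Longrightarrow> dist (Fvu y) (Fvu x) < e"
  proof -
    from cont(1) \<open>e > 0\<close> obtain d1 where d1: "d1 > 0" "\<forall>y. dist y x < d1 \<longrightarrow> dist (Fuv y) (Fuv x) < e"
      unfolding continuous_at_eps_delta by blast
    from cont(2) \<open>e > 0\<close> obtain d2 where "d2 > 0" "\<forall>y. dist y x < d2 \<longrightarrow> dist (Fvu y) (Fvu x) < e"
      unfolding continuous_at_eps_delta by blast
    with d1 show ?thesis using that[of "min d1 d2"] by auto
  qed
  define h where "h = d / (1 + norm u + norm v)"
  have "h > 0" using d by (simp add: h_def add_nonneg_pos add_pos_nonneg)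
  have near: "dist (x + \<sigma> *\<^sub>R a + \<tau> *\<^sub>R b) x < d"
    if "0 < \<sigma>" "\<sigma> < h" "0 < \<tau>" "\<tau> < h" "norm a + norm b = norm u + norm v" for \<sigma> \<tau> and a b :: 'a
  proof -
    have "dist (x + \<sigma> *\<^sub>R a + \<tau> *\<^sub>R b) x \<le> \<sigma> * norm a + \<tau> * norm b"
      using that norm_triangle_ineq[of "\<sigma> *\<^sub>R a" "\<tau> *\<^sub>R b"] by (simp add: dist_norm)
    also have "\<dots> \<le> h * norm a + h * norm b"
      using that by (intro add_mono mult_right_mono) auto
    also have "\<dots> = h * (norm u + norm v)" using that by (metis distrib_left)
    also have "\<dots> < h * (1 + norm u + norm v)" using \<open>h > 0\<close> by (intro mult_strict_left_mono) auto
    also have "\<dots> = d" 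
    proof -
      have "1 + norm u + norm v \<noteq> 0" using norm_ge_zero[of u] norm_ge_zero[of v] by linarith
      then show ?thesis by (simp add: h_def)
    qed
    finally show ?thesis .
  qed
  let ?D = "F (x + h *\<^sub>R u + h *\<^sub>R v) - F (x + h *\<^sub>R u) - F (x + h *\<^sub>R v) + F x"
  obtain s1 t1 where 1: "0 < s1" "s1 < h" "0 < t1" "t1 < h" "?D = h * h * Fuv (x + s1 *\<^sub>R u + t1 *\<^sub>R v)"
    using second_difference_mean_value[OF assms(1,3) \<open>h > 0\<close>, of x] by blast
  obtain s2 t2 where 2: "0 < s2" "s2 < h" "0 < t2" "t2 < h" "?D = h * h * Fvu (x + s2 *\<^sub>R v + t2 *\<^sub>R u)"
    using second_difference_mean_value[OF assms(2,4) \<open>h > 0\<close>, of x] by (auto simp: algebra_simps)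
  have "Fuv (x + s1 *\<^sub>R u + t1 *\<^sub>R v) = Fvu (x + s2 *\<^sub>R v + t2 *\<^sub>R u)"
    using 1 2 \<open>h > 0\<close> by simp
  then show False
    using d(2)[OF near[of s1 t1 u v]] d(3)[OF near[of s2 t2 v u]] 1 2
    unfolding e_def dist_real_def by (simp add: add.commute) argo
qed

lemma partial_deriv_has_vector_derivative:
  assumes "f differentiable (at x)"
  shows "((\<lambda>t. f (x + t *\<^sub>R axis i 1)) has_vector_derivative partial_deriv i f x) (at 0)"
proof -
  have "(\<lambda>t. f (x + t *\<^sub>R axis i 1)) differentiable (at 0)"
    by (rule differentiable_compose[of f]) (use assms in \<open>auto intro!: derivative_intros\<close>)
  then show ?thesis
    unfolding partial_deriv_def using vector_derivative_works by blast
qed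

lemma partial_deriv_eqI:
  assumes "((\<lambda>t. f (x + t *\<^sub>R axis i 1)) has_vector_derivative D) (at 0)"
  shows "partial_deriv i f x = D"
  unfolding partial_deriv_def using assms by (rule vector_derivative_at)

lemma partial_deriv_eq_derivative:
  assumes "(f has_derivative D) (at x)"
  shows "partial_deriv i f x = D (axis i 1)"
proof (rule partial_deriv_eqI)
  have "((\<lambda>t. x + t *\<^sub>R axis i 1) has_derivative (\<lambda>t. t *\<^sub>R axis i (1::real))) (at (0::real))"
    by (auto intro!: derivative_eq_intros)
  then have "((\<lambda>t. f (x + t *\<^sub>R axis i 1)) has_derivative (\<lambda>t. D (t *\<^sub>R axis i 1))) (at 0)"
    using assms has_derivative_compose[of "\<lambda>t. x + t *\<^sub>R axis i 1" _ 0 UNIV f D] by simp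
  then show "((\<lambda>t. f (x + t *\<^sub>R axis i 1)) has_vector_derivative D (axis i 1)) (at 0)"
    using assms by (simp add: has_vector_derivative_def linear_scale[OF has_derivative_linear[OF assms]])
qed

lemma smooth_differentiable: "smooth f \<Longrightarrow> f differentiable (at x)"
  unfolding smooth_def by (metis foldr_Nil id_apply)

lemma smooth_foldr_partial_deriv: "smooth f \<Longrightarrow> smooth (foldr partial_deriv is f)"
  unfolding smooth_def by (metis foldr_append)

lemma smooth_partial_deriv: "smooth f \<Longrightarrow> smooth (partial_deriv i f)"
  using smooth_foldr_partial_deriv[of f "[i]"] by simp

lemma partial_deriv_commute:
  fixes f :: "'d::finite rfun"
  assumes "smooth f"
  shows "partial_deriv i (partial_deriv j f) = partial_deriv j (partial_deriv i f)"
proof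
  fix x :: "'d rvec"
  have D: "((\<lambda>t. g (y + t *\<^sub>R axis k 1)) has_vector_derivative partial_deriv k g y) (at 0)"
    if "smooth g" for g :: "'d rfun" and k y
    using that by (intro partial_deriv_has_vector_derivative smooth_differentiable)
  have part: "((\<lambda>t. P (g (y + t *\<^sub>R axis k 1))) has_real_derivative P (partial_deriv k g y)) (at 0)"
    if "smooth g" "bounded_linear P" for P and g :: "'d rfun" and k y
    using bounded_linear.has_vector_derivative[OF that(2) D[OF that(1)]]
    by (simp add: has_real_derivative_iff_has_vector_derivative)
  have cont: "isCont (\<lambda>y. P (g y)) x" if "smooth g" "bounded_linear P" for P :: "complex \<Rightarrow> real" and g :: "'d rfun"
    using that smooth_differentiable[of g x]
    by (intro continuous_intros bounded_linear.isCont[of P] differentiable_imp_continuous_within)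
  have "P (partial_deriv i (partial_deriv j f) x) = P (partial_deriv j (partial_deriv i f) x)"
    if "bounded_linear P" for P :: "complex \<Rightarrow> real"
    by (rule mixed_derivatives_commute_real[of "\<lambda>y. P (f y)" "axis j 1" "\<lambda>y. P (partial_deriv j f y)"
          "axis i 1" "\<lambda>y. P (partial_deriv i f y)"
          "\<lambda>y. P (partial_deriv i (partial_deriv j f) y)" "\<lambda>y. P (partial_deriv j (partial_deriv i f) y)"])
       (intro part cont that assms smooth_partial_deriv)+
  from this[OF bounded_linear_Re] this[OF bounded_linear_Im]
  show "partial_deriv i (partial_deriv j f) x = partial_deriv j (partial_deriv i f) x"
    by (rule complex_eqI)
qed

lemma partial_deriv_foldr_commute:
  assumes "smooth f"
  shows "partial_deriv i (foldr partial_deriv is f) = foldr partial_deriv is (partial_deriv i f)"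
  using assms
  by (induction "is") (simp_all add: partial_deriv_commute smooth_foldr_partial_deriv)

lemma foldr_partial_deriv_mset:
  assumes "smooth f" "mset is = mset js"
  shows "foldr partial_deriv is f = foldr partial_deriv js f"
  using assms(2)
proof (induction "is" arbitrary: js)
  case (Cons i "is")
  then have "i \<in> set js" by (metis list.set_intros(1) set_mset_mset)
  then obtain js1 js2 where js: "js = js1 @ i # js2" by (meson split_list)
  with Cons.prems have "foldr partial_deriv is f = foldr partial_deriv (js1 @ js2) f"
    by (intro Cons.IH) simp
  then show ?case
    using partial_deriv_foldr_commute[OF smooth_foldr_partial_deriv[OF assms(1), of js2], of i js1]
    by (simp add: js)
qed simp

lemma multi_deriv_eq_foldr:
  "multi_deriv \<beta> f = foldr partial_deriv (concat (map (\<lambda>i. replicate (\<beta> i) i) (sorted_list_of_set UNIV))) f"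
proof -
  have "foldr (\<lambda>i. partial_deriv i ^^ \<beta> i) xs f = foldr partial_deriv (concat (map (\<lambda>i. replicate (\<beta> i) i) xs)) f" for xs
    by (induction xs) (simp_all add: foldr_replicate)
  then show ?thesis by (simp add: multi_deriv_def)
qed

lemma foldr_partial_deriv_eq_multi_deriv:
  assumes "smooth f"
  shows "foldr partial_deriv is f = multi_deriv (count (mset is)) f"
  unfolding multi_deriv_eq_foldr
proof (rule foldr_partial_deriv_mset[OF assms])
  have *: "count (mset (concat (map (\<lambda>i. replicate (\<beta> i) i) xs))) j = (if j \<in> set xs then \<beta> j else 0)"
    if "distinct xs" for xs :: "'a list" and \<beta> j
    using that by (induction xs) auto
  show "mset is = mset (concat (map (\<lambda>i. replicate (count (mset is) i) i) (sorted_list_of_set UNIV)))"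
    by (rule multiset_eqI) (subst *, auto)
qed

text \<open>The definition of Schwartz functions takes derivatives in a fixed order of the coordinates. The
  chain rule for linear substitutions mixes the coordinates, so all orders have to be controlled.\<close>

lemma schwartz_iff:
  "f \<in> schwartz \<longleftrightarrow> smooth f \<and>
     (\<forall>N is. \<exists>C. \<forall>x. (1 + norm x) ^ N * norm (foldr partial_deriv is f x) \<le> C)"
proof (cases "smooth f")
  case True
  have "f \<in> schwartz \<longleftrightarrow> (\<forall>N \<beta>. \<exists>C. \<forall>x. (1 + norm x) ^ N * norm (multi_deriv \<beta> f x) \<le> C)"
    using True by (simp add: schwartz_def bdd_above_def image_iff)
  also have "\<dots> \<longleftrightarrow> (\<forall>N is. \<exists>C. \<forall>x. (1 + norm x) ^ N * norm (foldr partial_deriv is f x) \<le> C)"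
    (is "?L \<longleftrightarrow> ?R")
  proof
    assume ?L
    then show ?R by (simp only: foldr_partial_deriv_eq_multi_deriv[OF True]) blast
  next
    assume ?R
    then show ?L by (simp only: multi_deriv_eq_foldr) blast
  qed
  finally show ?thesis using True by simp
qed (simp add: schwartz_def)

lemma schwartz_bounded_decay:
  assumes "f \<in> schwartz"
  shows "\<exists>C. \<forall>x. (1 + norm x) ^ N * norm (f x) \<le> C"
  using assms unfolding schwartz_iff by (metis foldr_Nil id_apply)

lemma schwartz_continuous: "f \<in> schwartz \<Longrightarrow> continuous_on UNIV f"
  by (auto simp: schwartz_def intro!: continuous_at_imp_continuous_on differentiable_imp_continuous_within
      smooth_differentiable)

lemma schwartz_measurable [measurable_dest]: "f \<in> schwartz \<Longrightarrow> f \<in> borel_measurable borel"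
  by (intro borel_measurable_continuous_onI schwartz_continuous)

lemma partial_deriv_linear:
  assumes "f differentiable (at x)" "g differentiable (at x)"
  shows "partial_deriv i (\<lambda>x. a * f x + b * g x) x = a * partial_deriv i f x + b * partial_deriv i g x"
  by (rule partial_deriv_eqI)
     (intro derivative_intros has_vector_derivative_mult_right partial_deriv_has_vector_derivative assms)

lemma schwartz_linear:
  assumes "f \<in> schwartz" "g \<in> schwartz"
  shows "(\<lambda>x. a * f x + b * g x) \<in> schwartz"
proof -
  note sm = assms[unfolded schwartz_iff, THEN conjunct1]
  have eq: "foldr partial_deriv is (\<lambda>x. a * f x + b * g x) =
      (\<lambda>x. a * foldr partial_deriv is f x + b * foldr partial_deriv is g x)" for "is"
    by (induction "is")
       (auto intro!: ext partial_deriv_linear smooth_differentiable smooth_foldr_partial_deriv sm)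
  have "\<exists>C. \<forall>x. (1 + norm x) ^ N * norm (a * foldr partial_deriv is f x + b * foldr partial_deriv is g x) \<le> C" for N "is"
  proof -
    obtain C1 C2 where C: "\<And>x. (1 + norm x) ^ N * norm (foldr partial_deriv is f x) \<le> C1"
      "\<And>x. (1 + norm x) ^ N * norm (foldr partial_deriv is g x) \<le> C2"
      using assms unfolding schwartz_iff by metis
    have "(1 + norm x) ^ N * norm (a * foldr partial_deriv is f x + b * foldr partial_deriv is g x)
       \<le> (1 + norm x) ^ N * (norm a * norm (foldr partial_deriv is f x) + norm b * norm (foldr partial_deriv is g x))" for x
      by (intro mult_left_mono order.trans[OF norm_triangle_ineq]) (auto simp: norm_mult)
    also have "\<dots> x \<le> norm a * C1 + norm b * C2" for x
      using mult_left_mono[OF C(1)[of x], of "norm a"] mult_left_mono[OF C(2)[of x], of "norm b"]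
      by (simp add: algebra_simps)
    finally show ?thesis by blast
  qed
  moreover have "(\<lambda>x. a * foldr partial_deriv is f x + b * foldr partial_deriv is g x) differentiable (at x)" for "is" x
    by (intro differentiable_add differentiable_mult differentiable_const smooth_differentiable
        smooth_foldr_partial_deriv sm)
  ultimately show ?thesis
    unfolding schwartz_iff smooth_def eq by blast
qed

lemma partial_deriv_affine:
  fixes B :: "real ^ 'd ^ 'd"
  assumes "f differentiable (at (c + B *v x))"
  shows "partial_deriv i (\<lambda>x. f (c + B *v x)) x =
    (\<Sum>m\<in>UNIV. complex_of_real (B $ m $ i) * partial_deriv m f (c + B *v x))"
    and "(\<lambda>x. f (c + B *v x)) differentiable (at x)"
proof -
  obtain D where D: "(f has_derivative D) (at (c + B *v x))"
    using assms by (auto simp: differentiable_def)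
  have "((\<lambda>x. c + B *v x) has_derivative (\<lambda>h. B *v h)) (at x)"
    by (auto intro!: derivative_eq_intros bounded_linear_imp_has_derivative matrix_vector_mul_bounded_linear)
  then have D': "((\<lambda>x. f (c + B *v x)) has_derivative (\<lambda>h. D (B *v h))) (at x)"
    using D has_derivative_compose[of "\<lambda>x. c + B *v x" _ x UNIV f D] by simp
  then show "(\<lambda>x. f (c + B *v x)) differentiable (at x)" by (auto simp: differentiable_def)
  have lin: "linear D" by (rule has_derivative_linear[OF D])
  have "B *v axis i 1 = (\<Sum>m\<in>UNIV. B $ m $ i *\<^sub>R axis m 1)"
    by (simp add: vec_eq_iff matrix_vector_mult_basis column_def)
       (simp add: axis_def if_distrib sum.If_cases cong: if_cong)
  then have "D (B *v axis i 1) = (\<Sum>m\<in>UNIV. complex_of_real (B $ m $ i) * D (axis m 1))"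
    by (simp add: linear_sum[OF lin] linear_scale[OF lin]) (simp add: scaleR_conv_of_real)
  then show "partial_deriv i (\<lambda>x. f (c + B *v x)) x =
    (\<Sum>m\<in>UNIV. complex_of_real (B $ m $ i) * partial_deriv m f (c + B *v x))"
    by (simp add: partial_deriv_eq_derivative[OF D'] partial_deriv_eq_derivative[OF D])
qed


text \<open>Only the form of the chain rule matters: the decay of the derivatives of \<open>f\<close> passes to finite linear
  combinations, whatever their coefficients.\<close>

lemma foldr_partial_deriv_affine:
  fixes B :: "(real, 'd::finite) sqmat"
  assumes "smooth f"
  shows "\<exists>T a. finite T \<and> foldr partial_deriv is (\<lambda>x. f (c + B *v x)) =
    (\<lambda>x. \<Sum>js\<in>T. complex_of_real (a js) * foldr partial_deriv js f (c + B *v x))"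
proof (induction "is")
  case Nil
  show ?case by (intro exI[of _ "{[]}"] exI[of _ "\<lambda>_. 1"]) simp
next
  case (Cons i "is")
  then obtain T a where T: "finite T" "foldr partial_deriv is (\<lambda>x. f (c + B *v x)) =
    (\<lambda>x. \<Sum>js\<in>T. complex_of_real (a js) * foldr partial_deriv js f (c + B *v x))" by blast
  note sm = smooth_differentiable[OF smooth_foldr_partial_deriv[OF assms]]
  let ?T = "(\<lambda>(m, js). m # js) ` (UNIV \<times> T)"
  let ?a = "\<lambda>js. B $ hd js $ i * a (tl js)"
  have "partial_deriv i (\<lambda>x. \<Sum>js\<in>T. complex_of_real (a js) * foldr partial_deriv js f (c + B *v x)) x
    = (\<Sum>js\<in>T. complex_of_real (a js) * partial_deriv i (\<lambda>x. foldr partial_deriv js f (c + B *v x)) x)" for x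
    by (rule partial_deriv_eqI)
       (intro has_vector_derivative_sum has_vector_derivative_mult_right partial_deriv_has_vector_derivative
          partial_deriv_affine(2) sm)
  also have "\<dots> x = (\<Sum>js\<in>T. \<Sum>m\<in>UNIV. complex_of_real (B $ m $ i * a js) * foldr partial_deriv (m # js) f (c + B *v x))" for x
    by (simp add: partial_deriv_affine(1)[OF sm] sum_distrib_left mult_ac)
  also have "\<dots> x = (\<Sum>(m, js)\<in>UNIV \<times> T. complex_of_real (B $ m $ i * a js) * foldr partial_deriv (m # js) f (c + B *v x))" for x
    by (subst sum.swap) (simp add: sum.cartesian_product)
  also have "\<dots> x = (\<Sum>js\<in>?T. complex_of_real (?a js) * foldr partial_deriv js f (c + B *v x))" for x
    by (subst sum.reindex) (auto simp: inj_on_def case_prod_unfold)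
  finally show ?case
    using T by (intro exI[of _ ?T] exI[of _ ?a]) auto
qed

lemma schwartz_affine:
  fixes B :: "(real, 'd::{finite,linorder}) sqmat"
  assumes f: "f \<in> schwartz" and "invertible B"
  shows "(\<lambda>x. f (c + B *v x)) \<in> schwartz"
proof -
  have sm: "smooth f" using f by (simp add: schwartz_def)
  obtain B' where B': "B' ** B = mat 1" using assms(2) unfolding invertible_def by blast
  obtain K where K: "K > 0" "\<And>x. norm (B' *v x) \<le> norm x * K"
    using bounded_linear.pos_bounded[OF matrix_vector_mul_bounded_linear[of B']] by blast
  define L where "L = 1 + K * (1 + norm c)"
  have L: "1 + norm x \<le> L * (1 + norm (c + B *v x))" for x
  proof -
    have "x = B' *v ((c + B *v x) - c)" by (simp add: matrix_vector_mul_assoc B')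
    then have "norm x \<le> norm ((c + B *v x) - c) * K" using K(2) by metis
    also have "\<dots> \<le> (norm (c + B *v x) + norm c) * K"
      using K by (intro mult_right_mono norm_triangle_ineq4) auto
    also have "\<dots> \<le> K * (1 + norm c) * (1 + norm (c + B *v x))"
      using K by (simp add: algebra_simps add_nonneg_nonneg)
    finally show ?thesis unfolding L_def distrib_right[of 1] by (intro add_mono) auto
  qed
  have "L \<ge> 0" using K by (simp add: L_def)
  show ?thesis unfolding schwartz_iff
  proof (intro conjI allI)
    show "smooth (\<lambda>x. f (c + B *v x))"
      unfolding smooth_def
    proof (intro allI)
      fix "is" x
      obtain T a where T: "finite T" "foldr partial_deriv is (\<lambda>x. f (c + B *v x)) =
        (\<lambda>x. \<Sum>js\<in>T. complex_of_real (a js) * foldr partial_deriv js f (c + B *v x))"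
        using foldr_partial_deriv_affine[OF sm] by blast
      show "foldr partial_deriv is (\<lambda>x. f (c + B *v x)) differentiable (at x)"
        unfolding T(2)
        by (intro differentiable_sum ballI T(1) differentiable_mult differentiable_const
            partial_deriv_affine(2) smooth_differentiable smooth_foldr_partial_deriv sm)
    qed
    fix N "is"
    obtain T a where T: "finite T" "foldr partial_deriv is (\<lambda>x. f (c + B *v x)) =
        (\<lambda>x. \<Sum>js\<in>T. complex_of_real (a js) * foldr partial_deriv js f (c + B *v x))"
      using foldr_partial_deriv_affine[OF sm] by blast
    obtain C where C: "\<And>js x. (1 + norm x) ^ N * norm (foldr partial_deriv js f x) \<le> C js"
      using f unfolding schwartz_iff by metis
    have "(1 + norm x) ^ N * norm (foldr partial_deriv is (\<lambda>x. f (c + B *v x)) x) \<le> L ^ N * (\<Sum>js\<in>T. \<bar>a js\<bar> * C js)" for x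
    proof -
      have "(1 + norm x) ^ N * norm (foldr partial_deriv is (\<lambda>x. f (c + B *v x)) x)
         \<le> (L * (1 + norm (c + B *v x))) ^ N * (\<Sum>js\<in>T. \<bar>a js\<bar> * norm (foldr partial_deriv js f (c + B *v x)))"
        unfolding T(2) using L \<open>L \<ge> 0\<close>
        by (intro mult_mono power_mono order.trans[OF norm_sum] sum_mono) (auto simp: norm_mult intro!: sum_nonneg)
      also have "\<dots> = L ^ N * (\<Sum>js\<in>T. \<bar>a js\<bar> * ((1 + norm (c + B *v x)) ^ N * norm (foldr partial_deriv js f (c + B *v x))))"
        by (simp add: power_mult_distrib sum_distrib_left mult_ac)
      also have "\<dots> \<le> L ^ N * (\<Sum>js\<in>T. \<bar>a js\<bar> * C js)"
        using \<open>L \<ge> 0\<close> C by (intro mult_left_mono sum_mono) auto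
      finally show ?thesis .
    qed
    then show "\<exists>C. \<forall>x. (1 + norm x) ^ N * norm (foldr partial_deriv is (\<lambda>x. f (c + B *v x)) x) \<le> C" by blast
  qed
qed

lemma schwartz_scale:
  assumes "f \<in> schwartz"
  shows "(\<lambda>x. a * f x) \<in> schwartz"
  using schwartz_linear[OF assms assms, of a 0] by simp

lemma schwartz_reflect:
  assumes "f \<in> schwartz"
  shows "(\<lambda>y. f (x - y)) \<in> schwartz"
proof -
  let ?M = "mat (- 1) :: (real, 'a) sqmat"
  have M: "?M *v v = - v" for v
    by (simp add: vec_eq_iff matrix_vector_mult_def mat_def if_distrib[of "\<lambda>a. a * _"] cong: if_cong)
  have "?M ** ?M = mat 1"
    by (rule iffD2[OF matrix_eq]) (simp add: M flip: matrix_vector_mul_assoc)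
  then have "invertible ?M" unfolding invertible_def by blast
  from schwartz_affine[OF assms this, of x] show ?thesis by (simp add: M)
qed

section \<open>Frequency distributions with rapidly decaying characteristic functions\<close>

text \<open>A tensor product, in place of a power of \<open>1 + norm y\<close>: its integrals and the characteristic function
  that it is to dominate factor over the coordinates.\<close>

definition envelope :: "nat \<Rightarrow> 'd::finite rvec \<Rightarrow> real" where
  "envelope K y = (\<Prod>m\<in>UNIV. 1 / (1 + \<bar>y $ m\<bar>)) ^ K"

lemma envelope_pos: "envelope K y > 0" and envelope_le_1: "envelope K y \<le> 1"
  unfolding envelope_def by (auto intro!: zero_less_power prod_pos power_le_one prod_le_1 prod_nonneg simp: add_pos_nonneg)

lemma envelope_nonneg [simp]: "envelope K y \<ge> 0"
  using envelope_pos[of K y] by simp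

lemma envelope_double: "envelope (2 * L) y = envelope L y ^ 2"
  by (simp add: envelope_def power_mult mult.commute)

lemma envelope_le_coordinate: "envelope K y \<le> (1 / (1 + \<bar>y $ s\<bar>)) ^ K"
  unfolding envelope_def
proof (rule power_mono)
  have "(\<Prod>m\<in>UNIV. 1 / (1 + \<bar>y $ m\<bar>)) = 1 / (1 + \<bar>y $ s\<bar>) * (\<Prod>m\<in>UNIV - {s}. 1 / (1 + \<bar>y $ m\<bar>))"
    by (rule prod.remove) auto
  also have "\<dots> \<le> 1 / (1 + \<bar>y $ s\<bar>) * 1"
    by (intro mult_left_mono prod_le_1) auto
  finally show "(\<Prod>m\<in>UNIV. 1 / (1 + \<bar>y $ m\<bar>)) \<le> 1 / (1 + \<bar>y $ s\<bar>)" by simp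
qed (auto intro: prod_nonneg)

text \<open>Peetre's inequality, coordinate by coordinate.\<close>

lemma envelope_subadditive: "envelope K (u - v) \<le> envelope K u * (1 + norm v) ^ (K * CARD('d))"
  for u v :: "'d::finite rvec"
proof -
  have *: "1 / (1 + \<bar>(u - v) $ m\<bar>) \<le> 1 / (1 + \<bar>u $ m\<bar>) * (1 + norm v)" for m
  proof -
    have "1 + \<bar>u $ m\<bar> \<le> (1 + \<bar>u $ m - v $ m\<bar>) * (1 + \<bar>v $ m\<bar>)"
    proof -
      have "\<bar>u $ m\<bar> \<le> \<bar>u $ m - v $ m\<bar> + \<bar>v $ m\<bar>" by linarith
      moreover have "0 \<le> \<bar>u $ m - v $ m\<bar> * \<bar>v $ m\<bar>" by simp
      ultimately show ?thesis unfolding distrib_left distrib_right mult_1 mult_1_right by linarith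
    qed
    also have "\<dots> \<le> (1 + \<bar>u $ m - v $ m\<bar>) * (1 + norm v)"
      by (intro mult_left_mono add_left_mono component_le_norm_cart) auto
    finally show ?thesis by (simp add: field_simps add_pos_nonneg)
  qed
  have "(\<Prod>m\<in>UNIV. 1 / (1 + \<bar>(u - v) $ m\<bar>)) \<le> (\<Prod>m\<in>(UNIV::'d set). 1 / (1 + \<bar>u $ m\<bar>) * (1 + norm v))"
    by (intro prod_mono conjI *) auto
  also have "\<dots> = (\<Prod>m\<in>UNIV. 1 / (1 + \<bar>u $ m\<bar>)) * (1 + norm v) ^ CARD('d)"
    by (simp add: prod.distrib del: times_divide_eq_left)
  finally have "envelope K (u - v) \<le> ((\<Prod>m\<in>UNIV. 1 / (1 + \<bar>u $ m\<bar>)) * (1 + norm v) ^ CARD('d)) ^ K"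
    unfolding envelope_def by (intro power_mono prod_nonneg) auto
  then show ?thesis
    by (simp add: envelope_def power_mult_distrib flip: power_mult) (simp add: mult.commute)
qed

lemma envelope_measurable [measurable]: "envelope K \<in> borel_measurable borel"
proof -
  have "continuous_on UNIV (envelope K :: 'd::finite rvec \<Rightarrow> real)"
    unfolding envelope_def by (intro continuous_intros ballI) (auto simp: add_nonneg_eq_0_iff)
  then show ?thesis by (rule borel_measurable_continuous_onI)
qed

lemma nn_integral_envelope_finite:
  assumes "real L * a \<ge> 2"
  shows "(\<integral>\<^sup>+y. ennreal (envelope L (y :: 'd::finite rvec) powr a) \<partial>lborel) < \<infinity>"
proof -
  have "envelope L y powr a \<le> (\<Prod>b\<in>Basis. inverse (1 + (y \<bullet> b)\<^sup>2))" for y :: "'d rvec"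
  proof -
    have 1: "(1 / (1 + \<bar>t\<bar>)) powr (real L * a) \<le> inverse (1 + t\<^sup>2)" for t :: real
    proof -
      have "(1 / (1 + \<bar>t\<bar>)) powr (real L * a) = (1 + \<bar>t\<bar>) powr - (real L * a)"
        by (simp add: powr_divide powr_minus_divide)
      also have "\<dots> \<le> (1 + \<bar>t\<bar>) powr - 2" using assms by (intro powr_mono) auto
      also have "\<dots> = inverse ((1 + \<bar>t\<bar>)\<^sup>2)" by (simp add: powr_minus powr_numeral add_pos_nonneg)
      also have "\<dots> \<le> inverse (1 + t\<^sup>2)"
        by (intro le_imp_inverse_le) (auto simp: power2_eq_square algebra_simps add_pos_nonneg)
      finally show ?thesis .
    qed
    have "envelope L y powr a = (\<Prod>m\<in>UNIV. 1 / (1 + \<bar>y $ m\<bar>)) powr (real L * a)"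
      unfolding envelope_def by (subst powr_realpow[symmetric]) (auto intro!: prod_pos simp: add_pos_nonneg powr_powr)
    also have "\<dots> = (\<Prod>m\<in>UNIV. (1 / (1 + \<bar>y $ m\<bar>)) powr (real L * a))"
      by (rule prod_powr_distrib)
    also have "\<dots> \<le> (\<Prod>m\<in>UNIV. inverse (1 + (y $ m)\<^sup>2))"
      by (intro prod_mono conjI 1) auto
    also have "\<dots> = (\<Prod>b\<in>Basis. inverse (1 + (y \<bullet> b)\<^sup>2))"
    proof -
      have B: "(Basis :: 'd rvec set) = (\<lambda>m. axis m 1) ` UNIV" by (auto simp: Basis_vec_def)
      show ?thesis unfolding B by (subst prod.reindex) (auto simp: inj_on_def axis_eq_axis inner_axis)
    qed
    finally show ?thesis .
  qed
  then have "(\<integral>\<^sup>+y. ennreal (envelope L (y :: 'd rvec) powr a) \<partial>lborel)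
      \<le> (\<integral>\<^sup>+y. (\<Prod>b\<in>(Basis :: 'd rvec set). ennreal (inverse (1 + (y \<bullet> b)\<^sup>2))) \<partial>lborel)"
    by (intro nn_integral_mono) (auto simp: prod_ennreal intro!: ennreal_leI)
  also have "\<dots> = (\<Prod>b\<in>(Basis :: 'd rvec set). (\<integral>\<^sup>+t. ennreal (inverse (1 + t\<^sup>2)) \<partial>lborel))"
    by (rule nn_integral_lborel_prod) auto
  also have "\<dots> < \<infinity>"
  proof -
    have "integrable lborel (\<lambda>t::real. inverse (1 + t\<^sup>2))"
      using integrable_inverse_1_plus_square by (simp add: set_integrable_def)
    then have "(\<integral>\<^sup>+t. ennreal (inverse (1 + t\<^sup>2)) \<partial>lborel) < \<infinity>"
      by (simp add: integrable_iff_bounded)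
    then show ?thesis by (simp add: power_less_top_ennreal)
  qed
  finally show ?thesis .
qed

text \<open>The uniform distribution on the interval \<open>[-1, 1]\<close>.\<close>

definition uniform_interval :: "real measure" where
  "uniform_interval = density lborel (\<lambda>t. ennreal (indicator {-1..1} t / 2))"

lemma sets_uniform_interval [measurable_cong, simp]: "sets uniform_interval = sets borel"
  and space_uniform_interval [simp]: "space uniform_interval = UNIV"
  by (simp_all add: uniform_interval_def)

lemma prob_space_uniform_interval: "prob_space uniform_interval"
proof
  have "emeasure uniform_interval UNIV = (\<integral>\<^sup>+t. ennreal (1/2) * indicator {-1..1::real} t \<partial>lborel)"
    unfolding uniform_interval_def
    by (subst emeasure_density) (auto intro!: nn_integral_cong split: split_indicator)
  also have "\<dots> = 1"
  proof -
    have "emeasure lborel {-1..1::real} = ennreal 2" by simp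
    then have "(\<integral>\<^sup>+t. ennreal (1/2) * indicator {-1..1::real} t \<partial>lborel) = ennreal (1/2) * ennreal 2"
      by (subst nn_integral_cmult_indicator) auto
    also have "\<dots> = ennreal (1/2 * 2)" by (rule ennreal_mult[symmetric]) auto
    finally show ?thesis by simp
  qed
  finally show "emeasure uniform_interval (space uniform_interval) = 1" by simp
qed

text \<open>Clamping changes nothing almost everywhere, but turns almost sure bounds into bounds everywhere.\<close>

definition clamp1 :: "real \<Rightarrow> real" where "clamp1 t = max (-1) (min 1 t)"

text \<open>The integral equals \<open>sin s / s\<close>.\<close>

lemma sinc_decay:
  "norm (LINT t|uniform_interval. cis (s * clamp1 t)) \<le> 2 / (1 + \<bar>s\<bar>)"
proof -
  interpret prob_space uniform_interval by (rule prob_space_uniform_interval)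
  have [measurable]: "cis \<in> borel_measurable borel"
    by (intro borel_measurable_continuous_onI continuous_intros)
  have le1: "norm (LINT t|uniform_interval. cis (s * clamp1 t)) \<le> 1"
  proof -
    have "norm (LINT t|uniform_interval. cis (s * clamp1 t)) \<le> (LINT t|uniform_interval. norm (cis (s * clamp1 t)))"
      by (rule integral_norm_bound)
    also have "\<dots> = 1" using prob_space by simp
    finally show ?thesis .
  qed
  have "norm (LINT t|uniform_interval. cis (s * clamp1 t)) \<le> 1 / \<bar>s\<bar>" if "s \<noteq> 0"
  proof -
    have "(LINT t|uniform_interval. cis (s * clamp1 t)) = (LINT t|lborel. (indicator {-1..1} t / 2) *\<^sub>R cis (s * clamp1 t))"
      unfolding uniform_interval_def
      by (rule integral_density) (auto simp: clamp1_def split: split_indicator)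
    also have "\<dots> = (LINT t|lborel. indicator {-1..1} t *\<^sub>R (cis (s * t) / 2))"
      by (intro Bochner_Integration.integral_cong)
         (auto simp: clamp1_def scaleR_conv_of_real split: split_indicator)
    also have "\<dots> = cis (s * 1) / (2 * \<i> * s) - cis (s * (-1)) / (2 * \<i> * s)"
    proof (rule integral_FTC_atLeastAtMost)
      fix x :: real
      show "((\<lambda>t. cis (s * t) / (2 * \<i> * s)) has_vector_derivative cis (s * x) / 2) (at x within {-1..1})"
      proof -
        have "((\<lambda>z. exp (\<i> * s * z) / (2 * \<i> * s)) has_field_derivative exp (\<i> * s * x) / 2) (at (complex_of_real x))"
          using that by (auto intro!: derivative_eq_intros)
        from has_vector_derivative_real_field[OF this] show ?thesis
          by (simp add: cis_conv_exp mult_ac)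
      qed
    qed (auto intro!: continuous_intros)
    finally have "norm (LINT t|uniform_interval. cis (s * clamp1 t)) \<le> norm (cis (s * 1) / (2 * \<i> * s)) + norm (cis (s * (-1)) / (2 * \<i> * s))"
      by (metis norm_triangle_ineq4)
    then show ?thesis using that by (simp add: norm_divide norm_mult)
  qed
  with le1 show ?thesis
  proof (cases "\<bar>s\<bar> \<le> 1")
    case True
    then have "1 \<le> 2 / (1 + \<bar>s\<bar>)" by (simp add: field_simps add_pos_nonneg)
    with le1 show ?thesis by linarith
  next
    case False
    then have "1 / \<bar>s\<bar> \<le> 2 / (1 + \<bar>s\<bar>)" by (simp add: field_simps add_pos_nonneg)
    moreover have "s \<noteq> 0" using False by auto
    ultimately show ?thesis using \<open>s \<noteq> 0 \<Longrightarrow> _\<close> by linarith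
  qed
qed

definition cube :: "real \<Rightarrow> 'd::finite rvec set" where
  "cube \<delta> = {\<eta>. \<forall>m. \<bar>\<eta> $ m\<bar> \<le> \<delta>}"

lemma cube_borel [measurable]: "(cube \<delta> :: 'a::finite rvec set) \<in> sets borel"
proof -
  have "(cube \<delta> :: 'a rvec set) = (\<Inter>m\<in>UNIV. {\<eta>. \<bar>\<eta> $ m\<bar> \<le> \<delta>})" by (auto simp: cube_def)
  moreover have "closed (\<Inter>m\<in>UNIV. {\<eta> :: 'a rvec. \<bar>\<eta> $ m\<bar> \<le> \<delta>})"
    by (intro closed_INT ballI closed_Collect_le continuous_intros)
  ultimately show ?thesis by (simp add: borel_closed)
qed

text \<open>In each coordinate, take the sum of \<open>K\<close> independent uniformly distributed variables. Its
  characteristic function is the \<open>K\<close>-th power of a sinc function.\<close>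

lemma exists_spectral_distribution:
  assumes "\<delta> > 0" "K > 0"
  shows "\<exists>(\<nu> :: 'd::finite rvec measure) C. prob_space \<nu> \<and> space \<nu> = cube \<delta> \<and>
    sets \<nu> = sets (restrict_space borel (cube \<delta>)) \<and>
    (\<forall>y. norm (LINT \<eta>|\<nu>. cis (2 * pi * (y \<bullet> \<eta>))) \<le> C * envelope K y)"
proof -
  define ix where "ix = {..<K} \<times> (UNIV :: 'd set)"
  interpret finite_product_prob_space "\<lambda>_. uniform_interval" ix
  proof -
    interpret U: prob_space uniform_interval by (rule prob_space_uniform_interval)
    show "finite_product_prob_space (\<lambda>_. uniform_interval) ix"
      by unfold_locales (auto simp: ix_def)
  qed
  let ?P = "\<Pi>\<^sub>M i\<in>ix. uniform_interval"
  define Q :: "(nat \<times> 'd \<Rightarrow> real) \<Rightarrow> 'd rvec" where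
    "Q \<theta> = (\<chi> m. \<delta> / K * (\<Sum>l<K. clamp1 (\<theta> (l, m))))" for \<theta>
  have [measurable]: "clamp1 \<in> borel_measurable borel" unfolding clamp1_def by measurable
  have [measurable]: "cis \<in> borel_measurable borel"
    by (intro borel_measurable_continuous_onI continuous_intros)
  have Qm: "Q \<in> borel_measurable ?P"
  proof (subst borel_measurable_euclidean_space, intro ballI)
    fix b :: "'d rvec" assume "b \<in> Basis"
    then obtain m where b: "b = axis m 1" by (auto simp: Basis_vec_def)
    have "(\<lambda>\<theta>. clamp1 (\<theta> (l, m))) \<in> borel_measurable ?P" if "l < K" for l
    proof -
      have "(\<lambda>\<theta>. \<theta> (l, m)) \<in> measurable ?P uniform_interval"
        by (rule measurable_component_singleton) (use that in \<open>simp add: ix_def\<close>)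
      moreover have "clamp1 \<in> measurable uniform_interval borel" by measurable
      ultimately show ?thesis by (rule measurable_compose)
    qed
    then show "(\<lambda>\<theta>. Q \<theta> \<bullet> b) \<in> borel_measurable ?P"
      unfolding Q_def by (simp add: b inner_axis)
  qed
  have Qc: "Q \<theta> \<in> cube \<delta>" for \<theta>
  proof -
    have "\<bar>\<Sum>l<K. clamp1 (\<theta> (l, m))\<bar> \<le> real K" for m
    proof -
      have "\<bar>\<Sum>l<K. clamp1 (\<theta> (l, m))\<bar> \<le> (\<Sum>l<K. 1)"
        by (rule order.trans[OF sum_abs sum_mono]) (auto simp: clamp1_def)
      then show ?thesis by simp
    qed
    then show ?thesis
      using assms by (auto simp: cube_def Q_def abs_mult field_simps)
  qed
  define \<nu> where "\<nu> = distr ?P (restrict_space borel (cube \<delta>)) Q"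
  have Qr: "Q \<in> measurable ?P (restrict_space borel (cube \<delta>))"
    by (intro measurable_restrict_space2 Qm) (auto simp: Qc)
  have inner: "(LINT \<eta>|\<nu>. cis (2 * pi * (y \<bullet> \<eta>))) = (\<Prod>(l, m)\<in>ix. LINT t|uniform_interval. cis (2 * pi * \<delta> / K * y $ m * clamp1 t))" for y
  proof -
    have "(LINT \<eta>|\<nu>. cis (2 * pi * (y \<bullet> \<eta>))) = (LINT \<theta>|?P. cis (2 * pi * (y \<bullet> Q \<theta>)))"
      unfolding \<nu>_def by (rule integral_distr[OF Qr]) (intro measurable_restrict_space1, measurable)
    also have "\<dots> = (LINT \<theta>|?P. (\<Prod>i\<in>ix. cis (2 * pi * \<delta> / K * y $ (snd i) * clamp1 (\<theta> i))))"
    proof (intro Bochner_Integration.integral_cong refl)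
      fix \<theta>
      have "2 * pi * (y \<bullet> Q \<theta>) = (\<Sum>m\<in>UNIV. \<Sum>l<K. 2 * pi * \<delta> / K * y $ m * clamp1 (\<theta> (l, m)))"
        by (simp add: inner_vec_def Q_def sum_distrib_left mult_ac)
      also have "\<dots> = (\<Sum>i\<in>ix. 2 * pi * \<delta> / K * y $ (snd i) * clamp1 (\<theta> i))"
        unfolding ix_def by (subst sum.swap) (simp add: sum.cartesian_product case_prod_unfold)
      finally show "cis (2 * pi * (y \<bullet> Q \<theta>)) = (\<Prod>i\<in>ix. cis (2 * pi * \<delta> / K * y $ (snd i) * clamp1 (\<theta> i)))"
        by (simp add: cis_conv_exp exp_sum[symmetric] ix_def sum_distrib_left)
    qed
    also have "\<dots> = (\<Prod>i\<in>ix. LINT t|uniform_interval. cis (2 * pi * \<delta> / K * y $ (snd i) * clamp1 t))"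
    proof (rule product_integral_prod)
      show "integrable uniform_interval (\<lambda>t. cis (2 * pi * \<delta> / K * y $ (snd i) * clamp1 t))" for i
        by (rule finite_measure.integrable_const_bound[OF prob_space.finite_measure[OF prob_space_uniform_interval], of _ 1]) auto
    qed (simp add: ix_def)
    finally show ?thesis by (simp add: case_prod_unfold)
  qed
  define c where "c = min 1 (2 * pi * \<delta> / K)"
  have c: "0 < c" using assms by (simp add: c_def)
  have "norm (LINT \<eta>|\<nu>. cis (2 * pi * (y \<bullet> \<eta>))) \<le> (2 / c) ^ (K * CARD('d)) * envelope K y" for y
  proof -
    have 1: "norm (LINT t|uniform_interval. cis (2 * pi * \<delta> / K * y $ m * clamp1 t)) \<le> 2 / c * (1 / (1 + \<bar>y $ m\<bar>))" for m
    proof -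
      have "c * (1 + \<bar>y $ m\<bar>) \<le> 1 + \<bar>2 * pi * \<delta> / K * y $ m\<bar>"
      proof -
        have "c * (1 + \<bar>y $ m\<bar>) = c + c * \<bar>y $ m\<bar>" by (simp add: algebra_simps)
        also have "\<dots> \<le> 1 + 2 * pi * \<delta> / K * \<bar>y $ m\<bar>"
          by (intro add_mono mult_right_mono) (auto simp: c_def)
        also have "\<dots> = 1 + \<bar>2 * pi * \<delta> / K * y $ m\<bar>" using assms by (simp add: abs_mult)
        finally show ?thesis .
      qed
      then have "2 / (1 + \<bar>2 * pi * \<delta> / K * y $ m\<bar>) \<le> 2 / (c * (1 + \<bar>y $ m\<bar>))"
        using c by (intro divide_left_mono mult_pos_pos) (auto simp: add_pos_nonneg)
      then show ?thesis using sinc_decay[of "2 * pi * \<delta> / K * y $ m"] by simp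
    qed
    have "norm (LINT \<eta>|\<nu>. cis (2 * pi * (y \<bullet> \<eta>))) \<le> (\<Prod>(l, m)\<in>ix. 2 / c * (1 / (1 + \<bar>y $ m\<bar>)))"
      unfolding inner prod_norm[symmetric] case_prod_unfold by (intro prod_mono conjI 1) auto
    also have "\<dots> = (\<Prod>l<K. \<Prod>m\<in>UNIV. 2 / c * (1 / (1 + \<bar>y $ m\<bar>)))"
      unfolding ix_def by (rule prod.cartesian_product[symmetric])
    also have "\<dots> = (2 / c) ^ (K * CARD('d)) * envelope K y"
      by (simp only: prod.distrib prod_constant envelope_def power_mult_distrib card_lessThan)
         (simp add: mult.commute[of K] flip: power_mult)
    finally show ?thesis .
  qed
  moreover have "prob_space \<nu>" unfolding \<nu>_def by (rule prob_space_distr[OF Qr])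
  moreover have "space \<nu> = cube \<delta>" "sets \<nu> = sets (restrict_space borel (cube \<delta>))"
    by (simp_all add: \<nu>_def space_restrict_space)
  ultimately show ?thesis by blast
qed

section \<open>Quasi-norms\<close>

lemma positive_exponent_cases:
  fixes p :: ennreal
  assumes "0 < p"
  obtains "p = \<top>" | P where "p = ennreal P" "P > 0"
  using assms by (cases p) auto

lemma recip_top [simp]: "recip \<top> = 0"
  by (simp add: recip_def)

lemma recip_ennreal: "P > 0 \<Longrightarrow> recip (ennreal P) = 1 / P"
  by (simp add: recip_def inverse_ennreal inverse_eq_divide)

lemma recip_le_imp_le:
  assumes "0 < p" "0 < q" "recip q \<le> recip p"
  shows "p \<le> q"
proof (cases rule: positive_exponent_cases[OF \<open>0 < q\<close>])
  case (2 Q)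
  note q = 2
  show ?thesis
  proof (cases rule: positive_exponent_cases[OF \<open>0 < p\<close>])
    case 1
    then show ?thesis using assms q by (simp add: recip_ennreal)
  next
    case (2 P)
    then show ?thesis using assms q by (simp add: recip_ennreal field_simps ennreal_leI)
  qed
qed simp

lemma ennreal_powr_ennreal: "x \<ge> 0 \<Longrightarrow> ennreal_powr (ennreal x) a = ennreal (x powr a)"
  by (simp add: ennreal_powr_def)

lemma ennreal_powr_mono:
  assumes "x \<le> y" "a \<ge> 0"
  shows "ennreal_powr x a \<le> ennreal_powr y a"
proof (cases "y = \<infinity>")
  case False
  then have "x \<noteq> \<infinity>" using assms(1) by (auto simp: top_unique)
  with False show ?thesis
    using assms by (auto simp: ennreal_powr_def less_top intro!: ennreal_leI powr_mono2 enn2real_mono)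
qed (simp add: ennreal_powr_def)

lemma Lp_norm_top: "Lp_norm \<top> g = esssup lborel (\<lambda>x. ennreal (norm (g x)))"
  by (simp add: Lp_norm_def quasi_norm_def)

lemma Lp_norm_ennreal:
  assumes "P > 0"
  shows "Lp_norm (ennreal P) g = ennreal_powr (\<integral>\<^sup>+x. ennreal (norm (g x) powr P) \<partial>lborel) (1 / P)"
  using assms by (simp add: Lp_norm_def quasi_norm_def recip_ennreal ennreal_powr_ennreal)

lemma Lp_norm_cong_AE:
  assumes "f \<in> borel_measurable borel" "g \<in> borel_measurable borel" "AE x in lborel. f x = g x" "0 < p"
  shows "Lp_norm p f = Lp_norm p g"
proof (cases rule: positive_exponent_cases[OF \<open>0 < p\<close>])
  case 1
  have "esssup lborel (\<lambda>x. ennreal (norm (f x))) = esssup lborel (\<lambda>x. ennreal (norm (g x)))"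
    by (rule esssup_AE_cong) (use assms in auto)
  then show ?thesis using 1 by (simp add: Lp_norm_top)
next
  case (2 P)
  have "(\<integral>\<^sup>+x. ennreal (norm (f x) powr P) \<partial>lborel) = (\<integral>\<^sup>+x. ennreal (norm (g x) powr P) \<partial>lborel)"
    by (rule nn_integral_cong_AE) (use assms(3) in auto)
  then show ?thesis using 2 by (simp add: Lp_norm_ennreal)
qed

lemma Lp_norm_upper:
  assumes "P > 0" "(\<integral>\<^sup>+x. ennreal (norm (g x) powr P) \<partial>lborel) \<le> ennreal B" "B \<ge> 0"
  shows "Lp_norm (ennreal P) g \<le> ennreal (B powr (1 / P))"
  using ennreal_powr_mono[OF assms(2), of "1 / P"] assms by (simp add: Lp_norm_ennreal ennreal_powr_ennreal)

lemma Lp_norm_ge_nn_integral: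
  assumes "P > 0" "B \<ge> 0" "ennreal B \<le> (\<integral>\<^sup>+x. ennreal (norm (g x) powr P) \<partial>lborel)"
  shows "ennreal (B powr (1 / P)) \<le> Lp_norm (ennreal P) g"
  using ennreal_powr_mono[OF assms(3), of "1 / P"] assms by (simp add: Lp_norm_ennreal ennreal_powr_ennreal)

lemma Lp_norm_lower:
  assumes "0 < q" "E \<in> sets borel" "emeasure lborel E = ennreal m" "m > 0" "c \<ge> 0"
    and "\<And>x. x \<in> E \<Longrightarrow> c \<le> norm (g x)"
  shows "ennreal (c * m powr recip q) \<le> Lp_norm q g"
proof (cases rule: positive_exponent_cases[OF \<open>0 < q\<close>])
  case 1
  have "ennreal c \<le> esssup lborel (\<lambda>x. ennreal (norm (g x)))"
  proof (rule ccontr)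
    assume "\<not> ?thesis"
    moreover have "AE x in lborel. ennreal (norm (g x)) \<le> esssup lborel (\<lambda>x. ennreal (norm (g x)))"
      by (rule esssup_AE)
    ultimately have "AE x in lborel. x \<notin> E"
    proof (elim AE_mp, intro AE_I2 impI)
      fix x assume "\<not> ennreal c \<le> esssup lborel (\<lambda>x. ennreal (norm (g x)))"
        "ennreal (norm (g x)) \<le> esssup lborel (\<lambda>x. ennreal (norm (g x)))"
      then have "\<not> ennreal c \<le> ennreal (norm (g x))" by (meson order.trans)
      then show "x \<notin> E" using assms(6)[of x] by (auto simp: ennreal_leI)
    qed
    then have "emeasure lborel E = 0"
      using assms(2) by (subst (asm) AE_iff_measurable[of E]) auto
    then show False using assms by simp
  qed
  then show ?thesis using 1 \<open>m > 0\<close> by (simp add: Lp_norm_top)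
next
  case (2 P)
  have "ennreal (c powr P * m) = (\<integral>\<^sup>+x. ennreal (c powr P) * indicator E x \<partial>lborel)"
    using assms by (subst nn_integral_cmult_indicator) (auto simp: ennreal_mult)
  also have "\<dots> \<le> (\<integral>\<^sup>+x. ennreal (norm (g x) powr P) \<partial>lborel)"
    using assms 2 by (intro nn_integral_mono) (auto split: split_indicator intro!: ennreal_leI powr_mono2)
  finally have "ennreal ((c powr P * m) powr (1 / P)) \<le> Lp_norm q g"
    using 2 assms by (auto intro!: Lp_norm_ge_nn_integral)
  moreover have "(c powr P * m) powr (1 / P) = c * m powr (1 / P)"
    using 2 assms by (simp add: powr_mult powr_powr)
  ultimately show ?thesis using 2 by (simp add: recip_ennreal)
qed

text \<open>At most one centre is close to a given point. Every other term is a square of an envelope whose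
  value at that point is at most \<open>1/N\<close>, so that all of them together do not exceed the largest
  envelope. This replaces the triangle inequality for exponents below one.\<close>

lemma envelope_sum_separated:
  fixes \<tau> :: "nat \<Rightarrow> 'd::finite rvec"
  assumes sep: "\<And>k l. k < N \<Longrightarrow> l < N \<Longrightarrow> k \<noteq> l \<Longrightarrow> \<bar>\<tau> k $ s - \<tau> l $ s\<bar> \<ge> 2 * real N"
    and "L \<ge> 1" "N \<ge> 1"
  shows "\<exists>k<N. (\<Sum>k<N. envelope (2 * L) (x - \<tau> k)) \<le> 2 * envelope L (x - \<tau> k)"
proof -
  have "(\<lambda>k. envelope L (x - \<tau> k)) ` {..<N} \<noteq> {}" using \<open>N \<ge> 1\<close> by (simp add: lessThan_empty_iff)
  then have "Max ((\<lambda>k. envelope L (x - \<tau> k)) ` {..<N}) \<in> (\<lambda>k. envelope L (x - \<tau> k)) ` {..<N}"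
    by (intro Max_in) auto
  then obtain k0 where k0: "k0 < N" "Max ((\<lambda>k. envelope L (x - \<tau> k)) ` {..<N}) = envelope L (x - \<tau> k0)" by auto
  have max: "envelope L (x - \<tau> k) \<le> envelope L (x - \<tau> k0)" if "k < N" for k
    unfolding k0(2)[symmetric] using that by (intro Max_ge) auto
  have small: "envelope L (x - \<tau> k) \<le> 1 / real N" if "\<bar>x $ s - \<tau> k $ s\<bar> \<ge> real N" for k
  proof -
    have "envelope L (x - \<tau> k) \<le> (1 / (1 + \<bar>(x - \<tau> k) $ s\<bar>)) ^ L" by (rule envelope_le_coordinate)
    also have "\<dots> \<le> (1 / (1 + \<bar>(x - \<tau> k) $ s\<bar>)) ^ 1"
      using \<open>L \<ge> 1\<close> by (intro power_decreasing) auto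
    also have "\<dots> \<le> 1 / real N" using that \<open>N \<ge> 1\<close> by (auto intro!: divide_left_mono mult_pos_pos)
    finally show ?thesis .
  qed
  obtain k1 where k1: "k1 < N" "\<And>k. k < N \<Longrightarrow> k \<noteq> k1 \<Longrightarrow> \<bar>x $ s - \<tau> k $ s\<bar> \<ge> real N"
  proof (cases "\<exists>k1<N. \<bar>x $ s - \<tau> k1 $ s\<bar> < real N")
    case True
    then obtain k1 where k1: "k1 < N" "\<bar>x $ s - \<tau> k1 $ s\<bar> < real N" by blast
    have "\<bar>x $ s - \<tau> k $ s\<bar> \<ge> real N" if "k < N" "k \<noteq> k1" for k
      using sep[of k k1] k1 that by linarith
    then show ?thesis using that k1 by blast
  next
    case False
    then show ?thesis using that[of 0] \<open>N \<ge> 1\<close> by fastforce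
  qed
  have "(\<Sum>k<N. envelope (2 * L) (x - \<tau> k)) = envelope (2 * L) (x - \<tau> k1) + (\<Sum>k\<in>{..<N} - {k1}. envelope (2 * L) (x - \<tau> k))"
    using k1 by (subst sum.remove[of _ k1]) auto
  also have "\<dots> \<le> envelope L (x - \<tau> k0) + (\<Sum>k\<in>{..<N} - {k1}. 1 / real N * envelope L (x - \<tau> k0))"
  proof (intro add_mono sum_mono)
    have "envelope (2 * L) (x - \<tau> k1) \<le> envelope L (x - \<tau> k1)"
      using envelope_pos[of L "x - \<tau> k1"] envelope_le_1[of L "x - \<tau> k1"]
      unfolding envelope_double power2_eq_square by (simp add: mult_left_le)
    then show "envelope (2 * L) (x - \<tau> k1) \<le> envelope L (x - \<tau> k0)" using max[OF k1(1)] by simp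
    fix k assume "k \<in> {..<N} - {k1}"
    then show "envelope (2 * L) (x - \<tau> k) \<le> 1 / real N * envelope L (x - \<tau> k0)"
      using small[of k] k1 max[of k] envelope_pos[of L] unfolding envelope_double power2_eq_square
      by (intro mult_mono) (auto intro: less_imp_le)
  qed
  also have "\<dots> = (1 + real (N - 1) / real N) * envelope L (x - \<tau> k0)"
    using k1 by (simp add: card_Diff_singleton algebra_simps)
  also have "\<dots> \<le> 2 * envelope L (x - \<tau> k0)"
    using envelope_pos[of L "x - \<tau> k0"] \<open>N \<ge> 1\<close> by (intro mult_right_mono) (auto simp: field_simps)
  finally show ?thesis using k0(1) by blast
qed

text \<open>Widely separated profiles interact so weakly that the quasi-norm of their sum grows like
  \<open>N\<close> to the power \<open>1/p\<close>. For \<open>N = 1\<close> this is the scaling behaviour of a single profile.\<close>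

lemma Lp_norm_separated_sum_bound:
  fixes p :: ennreal
  assumes "0 < p" "\<And>P. p = ennreal P \<Longrightarrow> 0 < P \<Longrightarrow> real L * P \<ge> 2" "L \<ge> 1"
  shows "\<exists>W\<ge>0. \<forall>g C \<sigma> N s. \<forall>B :: (real, 'd::{finite,wellorder}) sqmat. invertible B \<longrightarrow>
     g \<in> borel_measurable borel \<longrightarrow> C \<ge> 0 \<longrightarrow> N \<ge> 1 \<longrightarrow>
     (\<forall>k<N. \<forall>l<N. k \<noteq> l \<longrightarrow> \<bar>\<sigma> k $ s - \<sigma> l $ s\<bar> \<ge> 2 * real N) \<longrightarrow>
     (\<forall>x. norm (g x) \<le> C * (\<Sum>k<N. envelope (2 * L) (B *v x - \<sigma> k))) \<longrightarrow>
     Lp_norm p g \<le> ennreal (C * W * real N powr recip p * \<bar>det B\<bar> powr - recip p)"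
proof (cases rule: positive_exponent_cases[OF \<open>0 < p\<close>])
  case 1
  have "Lp_norm p g \<le> ennreal (C * 2 * real N powr recip p * \<bar>det B\<bar> powr - recip p)"
    if H: "invertible B" "g \<in> borel_measurable borel" "C \<ge> 0" "N \<ge> 1"
     "\<forall>k<N. \<forall>l<N. k \<noteq> l \<longrightarrow> \<bar>\<sigma> k $ s - \<sigma> l $ s\<bar> \<ge> 2 * real N"
     "\<And>x. norm (g x) \<le> C * (\<Sum>k<N. envelope (2 * L) (B *v x - \<sigma> k))" for g C \<sigma> N s and B :: "(real, 'd) sqmat"
  proof -
    have "norm (g x) \<le> C * 2" for x
    proof -
      obtain k where "(\<Sum>k<N. envelope (2 * L) (B *v x - \<sigma> k)) \<le> 2 * envelope L (B *v x - \<sigma> k)"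
        using envelope_sum_separated[of N \<sigma> s L "B *v x"] H(4,5) assms(3) by blast
      also have "\<dots> \<le> 2 * 1" by (intro mult_left_mono envelope_le_1) auto
      finally show ?thesis using H(6)[of x] mult_left_mono[OF _ H(3)] by (metis mult.right_neutral order.trans)
    qed
    moreover have "det B \<noteq> 0" using H(1) invertible_det_nz by blast
    ultimately show ?thesis
      unfolding 1 Lp_norm_top using H(2,4) by (intro esssup_I) (auto intro!: ennreal_leI)
  qed
  then show ?thesis by (intro exI[of _ "2::real"] conjI allI impI) (simp, blast)
next
  case (2 P)
  define I where "I = enn2real (\<integral>\<^sup>+y. ennreal (envelope L (y :: 'd rvec) powr P) \<partial>lborel)"
  have I: "(\<integral>\<^sup>+y. ennreal (envelope L (y :: 'd rvec) powr P) \<partial>lborel) = ennreal I" "I \<ge> 0"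
    unfolding I_def using nn_integral_envelope_finite[of L P, where 'd='d] assms(2) 2 by (auto simp: less_top)
  have "Lp_norm p g \<le> ennreal (C * (2 * I powr (1 / P)) * real N powr recip p * \<bar>det B\<bar> powr - recip p)"
    if H: "invertible B" "g \<in> borel_measurable borel" "C \<ge> 0" "N \<ge> 1"
     "\<forall>k<N. \<forall>l<N. k \<noteq> l \<longrightarrow> \<bar>\<sigma> k $ s - \<sigma> l $ s\<bar> \<ge> 2 * real N"
     "\<And>x. norm (g x) \<le> C * (\<Sum>k<N. envelope (2 * L) (B *v x - \<sigma> k))" for g C \<sigma> N s and B :: "(real, 'd) sqmat"
  proof -
    let ?e = "\<lambda>k x. ennreal (envelope L (B *v x - \<sigma> k) powr P)"
    have det: "\<bar>det B\<bar> > 0" using H(1) invertible_det_nz by auto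
    have [measurable]: "(*v) B \<in> borel_measurable borel"
      by (intro borel_measurable_continuous_onI continuous_intros)
    have integral_e: "(\<integral>\<^sup>+x. ?e k x \<partial>lborel) = ennreal (I / \<bar>det B\<bar>)" for k
    proof -
      have "ennreal \<bar>det B\<bar> * (\<integral>\<^sup>+x. ?e k x \<partial>lborel) = ennreal I"
        using nn_integral_lborel_matrix[OF H(1), of "\<lambda>x. ennreal (envelope L (x - \<sigma> k) powr P)"]
          nn_integral_lborel_shift[of "\<lambda>x :: 'd rvec. ennreal (envelope L x powr P)" "\<sigma> k"] by (simp add: I)
      also have "\<dots> = ennreal \<bar>det B\<bar> * ennreal (I / \<bar>det B\<bar>)"
        using det I by (simp flip: ennreal_mult)
      finally show ?thesis using det by (simp add: ennreal_mult_cancel_left)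
    qed
    have "(\<integral>\<^sup>+x. ennreal (norm (g x) powr P) \<partial>lborel) \<le> (\<integral>\<^sup>+x. ennreal ((2 * C) powr P) * (\<Sum>k<N. ?e k x) \<partial>lborel)"
    proof (intro nn_integral_mono)
      fix x
      obtain k where k: "k < N" "(\<Sum>k<N. envelope (2 * L) (B *v x - \<sigma> k)) \<le> 2 * envelope L (B *v x - \<sigma> k)"
        using envelope_sum_separated[of N \<sigma> s L "B *v x"] H(4,5) assms(3) by blast
      have "norm (g x) \<le> C * (2 * envelope L (B *v x - \<sigma> k))"
        using H(6)[of x] mult_left_mono[OF k(2) H(3)] by simp
      then have "norm (g x) powr P \<le> (2 * C * envelope L (B *v x - \<sigma> k)) powr P"
        using 2 by (intro powr_mono2) (auto simp: mult_ac)
      also have "\<dots> = (2 * C) powr P * envelope L (B *v x - \<sigma> k) powr P"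
        using H(3) by (simp add: powr_mult)
      also have "\<dots> \<le> (2 * C) powr P * (\<Sum>k<N. envelope L (B *v x - \<sigma> k) powr P)"
        using k by (intro mult_left_mono member_le_sum) auto
      finally show "ennreal (norm (g x) powr P) \<le> ennreal ((2 * C) powr P) * (\<Sum>k<N. ?e k x)"
        by (subst sum_ennreal) (auto simp: ennreal_leI sum_nonneg simp flip: ennreal_mult)
    qed
    also have "\<dots> = ennreal ((2 * C) powr P) * (\<Sum>k<N. (\<integral>\<^sup>+x. ?e k x \<partial>lborel))"
      by (simp add: nn_integral_cmult nn_integral_sum del: sum_ennreal)
    also have "\<dots> = ennreal ((2 * C) powr P * (real N * (I / \<bar>det B\<bar>)))"
      unfolding integral_e using I by (simp add: ennreal_mult ennreal_of_nat_eq_real_of_nat del: times_divide_eq_right)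
    finally have "Lp_norm p g \<le> ennreal (((2 * C) powr P * (real N * (I / \<bar>det B\<bar>))) powr (1 / P))"
      unfolding 2 using 2 I by (intro Lp_norm_upper) auto
    also have "((2 * C) powr P * (real N * (I / \<bar>det B\<bar>))) powr (1 / P)
        = C * (2 * I powr (1 / P)) * real N powr recip p * \<bar>det B\<bar> powr - recip p"
      using 2 I H(3) by (simp add: powr_mult powr_divide powr_powr recip_ennreal powr_minus_divide)
    finally show ?thesis .
  qed
  then show ?thesis using I by (intro exI[of _ "2 * I powr (1 / P)"] conjI allI impI) (simp, blast)
qed

lemma lr_norm_finite_support:
  assumes "0 < r" "finite S" "real (card S) \<le> N" "N \<ge> 1" "B \<ge> 0"
    and "\<And>j. j \<in> S \<Longrightarrow> u j \<le> ennreal B" "\<And>j. j \<notin> S \<Longrightarrow> u j = 0"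
  shows "lr_norm r u \<le> ennreal (B * N powr recip r)"
proof (cases rule: positive_exponent_cases[OF \<open>0 < r\<close>])
  case 1
  have "u j \<le> ennreal B" for j using assms(6,7)[of j] by (cases "j \<in> S") auto
  then have "esssup (count_space UNIV) u \<le> ennreal B"
    by (intro esssup_I) auto
  then show ?thesis using 1 assms by (simp add: lr_norm_def quasi_norm_def)
next
  case (2 R)
  have "(\<integral>\<^sup>+j. ennreal_powr (u j) R \<partial>count_space UNIV) \<le> (\<integral>\<^sup>+j. ennreal (B powr R) * indicator S j \<partial>count_space UNIV)"
  proof (intro nn_integral_mono)
    fix j
    show "ennreal_powr (u j) R \<le> ennreal (B powr R) * indicator S j"
    proof (cases "j \<in> S")
      case True
      then show ?thesis
        using ennreal_powr_mono[OF assms(6)[OF True], of R] 2 assms(5) by (simp add: ennreal_powr_ennreal)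
    next
      case False
      then show ?thesis using 2 assms(7) by (simp add: ennreal_powr_def)
    qed
  qed
  also have "\<dots> = ennreal (B powr R) * ennreal (real (card S))"
    using assms(2) by (subst nn_integral_cmult_indicator) (auto simp: ennreal_of_nat_eq_real_of_nat)
  also have "\<dots> \<le> ennreal (B powr R * N)"
    using assms by (subst ennreal_mult[symmetric]) (auto intro!: ennreal_leI mult_left_mono)
  finally have "lr_norm r u \<le> ennreal_powr (ennreal (B powr R * N)) (1 / R)"
    using 2 by (simp add: lr_norm_def quasi_norm_def recip_ennreal ennreal_powr_mono)
  also have "\<dots> = ennreal (B * N powr recip r)"
    using 2 assms by (simp add: ennreal_powr_ennreal powr_mult powr_powr recip_ennreal)
  finally show ?thesis .
qed

text \<open>The net of partial sums is eventually constant, so its limit in quasi-norm is determined almost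
  everywhere.\<close>

lemma Lq_unconditional_sum_finite:
  assumes "0 < q" "Lq_unconditional_sum q h g" "finite S" "\<And>j. j \<notin> S \<Longrightarrow> h j = (\<lambda>_. 0)"
  shows "Lp_norm q g = Lp_norm q (\<lambda>x. \<Sum>j\<in>S. h j x)"
proof -
  let ?s = "\<lambda>x. \<Sum>j\<in>S. h j x"
  have meas: "h j \<in> borel_measurable borel" "g \<in> borel_measurable borel" for j
    using assms(2) by (auto simp: Lq_unconditional_sum_def Lp_space_def)
  then have meas_s: "?s \<in> borel_measurable borel" by auto
  have "eventually (\<lambda>F. S \<subseteq> F \<and> finite F) (finite_subsets_at_top UNIV)"
    using assms(3) by (auto simp: eventually_finite_subsets_at_top)
  then have "eventually (\<lambda>F. Lp_norm q (\<lambda>x. (\<Sum>j\<in>F. h j x) - g x) = Lp_norm q (\<lambda>x. ?s x - g x)) (finite_subsets_at_top UNIV)"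
  proof eventually_elim
    case (elim F)
    then have "(\<Sum>j\<in>F. h j x) = ?s x" for x
      using assms(4) by (intro sum.mono_neutral_right) auto
    then show ?case by simp
  qed
  moreover have "((\<lambda>F. Lp_norm q (\<lambda>x. (\<Sum>j\<in>F. h j x) - g x)) \<longlongrightarrow> 0) (finite_subsets_at_top UNIV)"
    using assms(2) by (simp add: Lq_unconditional_sum_def)
  ultimately have "((\<lambda>F. Lp_norm q (\<lambda>x. ?s x - g x)) \<longlongrightarrow> 0) (finite_subsets_at_top (UNIV :: nat set))"
    by (simp add: tendsto_cong)
  then have "Lp_norm q (\<lambda>x. ?s x - g x) = 0"
    using tendsto_const_iff[OF finite_subsets_at_top_neq_bot] by blast
  then have "AE x in lborel. ?s x - g x = 0"
  proof (cases rule: positive_exponent_cases[OF \<open>0 < q\<close>])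
    case 1
    assume "Lp_norm q (\<lambda>x. ?s x - g x) = 0"
    then show ?thesis
      using esssup_AE[of "\<lambda>x. ennreal (norm (?s x - g x))" lborel] by (simp add: 1 Lp_norm_top)
  next
    case (2 Q)
    assume "Lp_norm q (\<lambda>x. ?s x - g x) = 0"
    then have "(\<integral>\<^sup>+x. ennreal (norm (?s x - g x) powr Q) \<partial>lborel) = 0"
      using 2 by (auto simp: Lp_norm_ennreal ennreal_powr_def enn2real_eq_0_iff split: if_splits)
    then show ?thesis
      using meas meas_s 2 by (subst (asm) nn_integral_0_iff_AE) auto
  qed
  then have "AE x in lborel. g x = ?s x" by auto
  then show ?thesis by (intro Lp_norm_cong_AE meas meas_s \<open>0 < q\<close>)
qed

section \<open>Random signs\<close>

definition sign_on :: "'k set \<Rightarrow> 'k \<Rightarrow> real" where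
  "sign_on X k = (if k \<in> X then 1 else -1)"

text \<open>Averaging over the sign of one more term symmetrises every function of the sum.\<close>

lemma sum_signs_insert:
  fixes a :: "'k \<Rightarrow> real" and F :: "real \<Rightarrow> real"
  assumes "finite J" "k \<notin> J"
  shows "(\<Sum>X\<in>Pow (insert k J). F (\<Sum>l\<in>insert k J. sign_on X l * a l)) =
    (\<Sum>X\<in>Pow J. F ((\<Sum>l\<in>J. sign_on X l * a l) - a k) + F ((\<Sum>l\<in>J. sign_on X l * a l) + a k))"
proof -
  have inj: "inj_on (insert k) (Pow J)" using assms by (auto simp: inj_on_def)
  have disj: "Pow J \<inter> insert k ` Pow J = {}" using assms by auto
  have 1: "(\<Sum>l\<in>insert k J. sign_on X l * a l) = (\<Sum>l\<in>J. sign_on X l * a l) - a k" if "X \<subseteq> J" for X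
    using assms that by (subst sum.insert) (auto simp: sign_on_def)
  have 2: "(\<Sum>l\<in>insert k J. sign_on (insert k X) l * a l) = (\<Sum>l\<in>J. sign_on X l * a l) + a k" for X
  proof -
    have "(\<Sum>l\<in>J. sign_on (insert k X) l * a l) = (\<Sum>l\<in>J. sign_on X l * a l)"
      using assms by (intro sum.cong) (auto simp: sign_on_def)
    then show ?thesis using assms by (simp add: sign_on_def)
  qed
  have "(\<Sum>X\<in>Pow (insert k J). F (\<Sum>l\<in>insert k J. sign_on X l * a l)) =
     (\<Sum>X\<in>Pow J. F (\<Sum>l\<in>insert k J. sign_on X l * a l)) + (\<Sum>X\<in>Pow J. F (\<Sum>l\<in>insert k J. sign_on (insert k X) l * a l))"
    unfolding Pow_insert using assms disj by (simp add: sum.union_disjoint sum.reindex[OF inj] comp_def)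
  also have "\<dots> = (\<Sum>X\<in>Pow J. F ((\<Sum>l\<in>J. sign_on X l * a l) - a k)) + (\<Sum>X\<in>Pow J. F ((\<Sum>l\<in>J. sign_on X l * a l) + a k))"
    unfolding 2 by (intro arg_cong2[where f="(+)"] sum.cong refl) (simp add: 1)
  finally show ?thesis by (simp add: sum.distrib)
qed

lemma sum_signs_square:
  fixes a :: "'k \<Rightarrow> real"
  assumes "finite J"
  shows "(\<Sum>X\<in>Pow J. (\<Sum>k\<in>J. sign_on X k * a k) ^ 2) = 2 ^ card J * (\<Sum>k\<in>J. a k ^ 2)"
  using assms
proof (induction J rule: finite_induct)
  case (insert k J)
  have "(\<Sum>X\<in>Pow (insert k J). (\<Sum>l\<in>insert k J. sign_on X l * a l) ^ 2) =
     (\<Sum>X\<in>Pow J. 2 * (\<Sum>l\<in>J. sign_on X l * a l) ^ 2 + 2 * a k ^ 2)"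
    unfolding sum_signs_insert[OF insert.hyps, of "\<lambda>t. t ^ 2"]
    by (intro sum.cong refl) (simp add: power2_eq_square algebra_simps)
  also have "\<dots> = 2 * (2 ^ card J * (\<Sum>k\<in>J. a k ^ 2)) + 2 ^ card J * (2 * a k ^ 2)"
    using insert by (simp add: sum.distrib flip: sum_distrib_left) (simp add: card_Pow)
  finally show ?case using insert.hyps by (simp add: algebra_simps)
qed simp

text \<open>Khinchin's inequality for the fourth moment: in the induction, the odd powers of the new term cancel.\<close>

lemma sum_signs_fourth_power:
  fixes a :: "'k \<Rightarrow> real"
  assumes "finite J"
  shows "(\<Sum>X\<in>Pow J. (\<Sum>k\<in>J. sign_on X k * a k) ^ 4) \<le> 2 ^ card J * (3 * (\<Sum>k\<in>J. a k ^ 2) ^ 2)"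
  using assms
proof (induction J rule: finite_induct)
  case (insert k J)
  let ?S = "\<lambda>X. \<Sum>l\<in>J. sign_on X l * a l" and ?Q = "\<Sum>k\<in>J. a k ^ 2"
  have "(\<Sum>X\<in>Pow (insert k J). (\<Sum>l\<in>insert k J. sign_on X l * a l) ^ 4) =
     (\<Sum>X\<in>Pow J. 2 * ?S X ^ 4 + 12 * a k ^ 2 * ?S X ^ 2 + 2 * a k ^ 4)"
    unfolding sum_signs_insert[OF insert.hyps, of "\<lambda>t. t ^ 4"]
    by (intro sum.cong refl) (simp add: power2_eq_square power4_eq_xxxx algebra_simps)
  also have "\<dots> = 2 * (\<Sum>X\<in>Pow J. ?S X ^ 4) + 12 * a k ^ 2 * (\<Sum>X\<in>Pow J. ?S X ^ 2) + 2 ^ card J * (2 * a k ^ 4)"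
    using insert by (simp add: sum.distrib flip: sum_distrib_left) (simp add: card_Pow)
  also have "\<dots> \<le> 2 * (2 ^ card J * (3 * ?Q ^ 2)) + 12 * a k ^ 2 * (2 ^ card J * ?Q) + 2 ^ card J * (2 * a k ^ 4)"
    using insert.IH insert.hyps by (intro add_mono mult_left_mono) (auto simp: sum_signs_square)
  also have "\<dots> \<le> 2 ^ card J * (6 * (?Q + a k ^ 2) ^ 2)"
  proof -
    have "2 * (3 * q ^ 2) + 12 * u * q + 2 * u ^ 2 \<le> 6 * (q + u) ^ 2" for q u :: real
      by (simp add: power2_eq_square algebra_simps)
    from this[of ?Q "a k ^ 2"]
    have "2 * (3 * ?Q ^ 2) + 12 * a k ^ 2 * ?Q + 2 * a k ^ 4 \<le> 6 * (?Q + a k ^ 2) ^ 2"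
      by simp
    from mult_left_mono[OF this, of "2 ^ card J"] show ?thesis by (simp add: algebra_simps)
  qed
  finally show ?case using insert.hyps by (simp add: algebra_simps)
qed simp

text \<open>The Paley-Zygmund inequality for random signs: comparing the second and the fourth moment shows
  that a fixed proportion of all choices of signs makes the sum as large as its mean square.\<close>

lemma many_large_sign_sums_real:
  fixes a :: "'k \<Rightarrow> real"
  assumes "finite J"
  shows "2 ^ card J \<le> 12 * real (card {X \<in> Pow J. (\<Sum>k\<in>J. a k ^ 2) / 2 \<le> (\<Sum>k\<in>J. sign_on X k * a k) ^ 2})"
proof -
  define Q where "Q = (\<Sum>k\<in>J. a k ^ 2)"
  define S where "S X = (\<Sum>k\<in>J. sign_on X k * a k)" for X
  define G where "G = {X \<in> Pow J. Q / 2 \<le> S X ^ 2}"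
  have fin: "finite (Pow J)" "G \<subseteq> Pow J" using assms by (auto simp: G_def)
  have "Q \<ge> 0" by (simp add: Q_def sum_nonneg)
  have "2 ^ card J \<le> 12 * real (card G)"
  proof (cases "Q = 0")
    case True
    then have "G = Pow J" by (auto simp: G_def)
    then show ?thesis using assms by (simp add: card_Pow)
  next
    case False
    \<comment> \<open>Small sums contribute at most half of the second moment. By the Cauchy-Schwarz inequality, the
      large ones cannot supply the other half unless there are many of them.\<close>
    have "2 ^ card J * Q = (\<Sum>X\<in>Pow J. S X ^ 2)"
      unfolding S_def Q_def using assms by (rule sum_signs_square[symmetric])
    also have "\<dots> = (\<Sum>X\<in>Pow J - G. S X ^ 2) + (\<Sum>X\<in>G. S X ^ 2)"
      by (rule sum.subset_diff) (use fin in auto)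
    also have "(\<Sum>X\<in>Pow J - G. S X ^ 2) \<le> (\<Sum>X\<in>Pow J. Q / 2)"
      using \<open>Q \<ge> 0\<close> fin
      by (intro order.trans[OF sum_mono[of "Pow J - G" _ "\<lambda>_. Q / 2"] sum_mono2]) (auto simp: G_def)
    finally have "2 ^ card J * Q / 2 \<le> (\<Sum>X\<in>G. S X ^ 2)"
      using assms by (simp add: card_Pow)
    then have "(2 ^ card J * Q / 2) ^ 2 \<le> (\<Sum>X\<in>G. S X ^ 2) ^ 2"
      using \<open>Q \<ge> 0\<close> by (intro power_mono) auto
    also have "\<dots> \<le> (\<Sum>X\<in>G. (S X ^ 2) ^ 2) * (\<Sum>X\<in>G. 1 ^ 2)"
      using Cauchy_Schwarz_ineq_sum[of "\<lambda>X. S X ^ 2" "\<lambda>_. 1" G] by simp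
    also have "\<dots> \<le> (2 ^ card J * (3 * Q ^ 2)) * real (card G)"
    proof -
      have "(\<Sum>X\<in>G. (S X ^ 2) ^ 2) \<le> (\<Sum>X\<in>Pow J. S X ^ 4)"
        using fin by (simp flip: power_mult) (intro sum_mono2, auto)
      also have "\<dots> \<le> 2 ^ card J * (3 * Q ^ 2)"
        unfolding S_def Q_def using assms by (rule sum_signs_fourth_power)
      finally show ?thesis by (simp add: mult_right_mono)
    qed
    finally have "(2 ^ card J * Q ^ 2) * 2 ^ card J \<le> (2 ^ card J * Q ^ 2) * (12 * real (card G))"
      by (simp add: power2_eq_square algebra_simps)
    then show ?thesis
      using False by simp
  qed
  then show ?thesis unfolding G_def S_def Q_def .
qed

lemma many_large_sign_sums:
  fixes a :: "'k \<Rightarrow> complex"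
  assumes "finite J"
  shows "2 ^ card J \<le> 12 * real (card {X \<in> Pow J. (\<Sum>k\<in>J. norm (a k) ^ 2) / 4 \<le> norm (\<Sum>k\<in>J. of_real (sign_on X k) * a k) ^ 2})"
proof -
  let ?S = "\<lambda>X. \<Sum>k\<in>J. of_real (sign_on X k) * a k"
  have "\<exists>b. (\<Sum>k\<in>J. norm (a k) ^ 2) / 4 \<le> (\<Sum>k\<in>J. b k ^ 2) / 2 \<and> (\<forall>X. (\<Sum>k\<in>J. sign_on X k * b k) ^ 2 \<le> norm (?S X) ^ 2)"
  proof (cases "(\<Sum>k\<in>J. Re (a k) ^ 2) \<ge> (\<Sum>k\<in>J. Im (a k) ^ 2)")
    case True
    moreover have "(\<Sum>k\<in>J. sign_on X k * Re (a k)) ^ 2 \<le> norm (?S X) ^ 2" for X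
      unfolding cmod_power2 by simp
    ultimately show ?thesis by (intro exI[of _ "\<lambda>k. Re (a k)"]) (auto simp: cmod_power2 sum.distrib)
  next
    case False
    moreover have "(\<Sum>k\<in>J. sign_on X k * Im (a k)) ^ 2 \<le> norm (?S X) ^ 2" for X
      unfolding cmod_power2 by simp
    ultimately show ?thesis by (intro exI[of _ "\<lambda>k. Im (a k)"]) (auto simp: cmod_power2 sum.distrib)
  qed
  then obtain b where b: "(\<Sum>k\<in>J. norm (a k) ^ 2) / 4 \<le> (\<Sum>k\<in>J. b k ^ 2) / 2"
    "\<And>X. (\<Sum>k\<in>J. sign_on X k * b k) ^ 2 \<le> norm (?S X) ^ 2" by blast
  have "{X \<in> Pow J. (\<Sum>k\<in>J. b k ^ 2) / 2 \<le> (\<Sum>k\<in>J. sign_on X k * b k) ^ 2}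
     \<subseteq> {X \<in> Pow J. (\<Sum>k\<in>J. norm (a k) ^ 2) / 4 \<le> norm (?S X) ^ 2}"
  proof
    fix X assume X: "X \<in> {X \<in> Pow J. (\<Sum>k\<in>J. b k ^ 2) / 2 \<le> (\<Sum>k\<in>J. sign_on X k * b k) ^ 2}"
    then have "(\<Sum>k\<in>J. b k ^ 2) / 2 \<le> (\<Sum>k\<in>J. sign_on X k * b k) ^ 2" by blast
    then have "(\<Sum>k\<in>J. norm (a k) ^ 2) / 4 \<le> norm (?S X) ^ 2"
      using b(1) b(2)[of X] by linarith
    then show "X \<in> {X \<in> Pow J. (\<Sum>k\<in>J. norm (a k) ^ 2) / 4 \<le> norm (?S X) ^ 2}" using X by blast
  qed
  then have "card {X \<in> Pow J. (\<Sum>k\<in>J. b k ^ 2) / 2 \<le> (\<Sum>k\<in>J. sign_on X k * b k) ^ 2}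
     \<le> card {X \<in> Pow J. (\<Sum>k\<in>J. norm (a k) ^ 2) / 4 \<le> norm (?S X) ^ 2}"
    using assms by (intro card_mono) auto
  then show ?thesis using many_large_sign_sums_real[OF assms, of b] by linarith
qed

text \<open>Averaging over the signs yields one choice that is good for the integral.\<close>

lemma exists_good_signs:
  fixes a :: "'k \<Rightarrow> 'x \<Rightarrow> complex" and b :: "'x \<Rightarrow> real"
  assumes J: "finite J" and P: "P > 0"
    and [measurable]: "\<And>k. k \<in> J \<Longrightarrow> a k \<in> borel_measurable M" "b \<in> borel_measurable M"
    and b: "\<And>x. b x \<ge> 0" "\<And>x. b x ^ 2 \<le> (\<Sum>k\<in>J. norm (a k x) ^ 2)"
  shows "\<exists>X\<subseteq>J. (\<integral>\<^sup>+x. ennreal ((b x / 2) powr P) \<partial>M)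
    \<le> 12 * (\<integral>\<^sup>+x. ennreal (norm (\<Sum>k\<in>J. of_real (sign_on X k) * a k x) powr P) \<partial>M)"
proof -
  define S where "S X x = (\<Sum>k\<in>J. of_real (sign_on X k) * a k x)" for X x
  define I where "I X = (\<integral>\<^sup>+x. ennreal (norm (S X x) powr P) \<partial>M)" for X
  have [measurable]: "S X \<in> borel_measurable M" for X unfolding S_def by measurable
  have "I ` Pow J \<noteq> {}" "finite (I ` Pow J)" using J by auto
  then have "Max (I ` Pow J) \<in> I ` Pow J" by (intro Max_in)
  then obtain X where X: "X \<subseteq> J" "Max (I ` Pow J) = I X" by auto
  have pt: "ennreal (2 ^ card J) * ennreal ((b x / 2) powr P) \<le> 12 * (\<Sum>X\<in>Pow J. ennreal (norm (S X x) powr P))" for x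
  proof -
    let ?G = "{X \<in> Pow J. (\<Sum>k\<in>J. norm (a k x) ^ 2) / 4 \<le> norm (S X x) ^ 2}"
    have G: "(b x / 2) powr P \<le> norm (S X x) powr P" if "X \<in> ?G" for X
    proof -
      have "(b x / 2) ^ 2 \<le> norm (S X x) ^ 2"
        using b(2)[of x] that by (auto simp: power_divide)
      then have "b x / 2 \<le> norm (S X x)" by (rule power2_le_imp_le) simp
      then show ?thesis using b(1)[of x] P by (intro powr_mono2) auto
    qed
    have "2 ^ card J * (b x / 2) powr P \<le> 12 * real (card ?G) * (b x / 2) powr P"
      using many_large_sign_sums[OF J, of "\<lambda>k. a k x"] by (intro mult_right_mono) (auto simp: S_def)
    also have "\<dots> = 12 * (\<Sum>X\<in>?G. (b x / 2) powr P)" by simp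
    also have "\<dots> \<le> 12 * (\<Sum>X\<in>Pow J. norm (S X x) powr P)"
      using J G by (intro mult_left_mono order.trans[OF sum_mono[of ?G] sum_mono2[of "Pow J" ?G]]) auto
    finally have "ennreal (2 ^ card J * (b x / 2) powr P) \<le> ennreal (12 * (\<Sum>X\<in>Pow J. norm (S X x) powr P))"
      by (rule ennreal_leI)
    then show ?thesis by (simp add: ennreal_mult sum_nonneg)
  qed
  have "ennreal (2 ^ card J) * (\<integral>\<^sup>+x. ennreal ((b x / 2) powr P) \<partial>M)
      \<le> (\<integral>\<^sup>+x. 12 * (\<Sum>X\<in>Pow J. ennreal (norm (S X x) powr P)) \<partial>M)"
    by (subst nn_integral_cmult[symmetric], measurable) (intro nn_integral_mono pt)
  also have "\<dots> = 12 * (\<Sum>X\<in>Pow J. I X)"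
    unfolding I_def by (simp add: nn_integral_cmult nn_integral_sum del: sum_ennreal)
  also have "\<dots> \<le> 12 * (\<Sum>Y\<in>Pow J. I X)"
    using X(2) J by (intro mult_left_mono sum_mono) (auto simp flip: X(2))
  also have "\<dots> = ennreal (2 ^ card J) * (12 * I X)"
    using J by (simp add: card_Pow ennreal_of_nat_eq_real_of_nat mult_ac)
  finally have "(\<integral>\<^sup>+x. ennreal ((b x / 2) powr P) \<partial>M) \<le> 12 * I X"
    by (subst (asm) ennreal_mult_le_mult_iff) auto
  then show ?thesis using X(1) unfolding I_def S_def by blast
qed

section \<open>Superpositions of plane waves\<close>

lemma cis_measurable [measurable]: "cis \<in> borel_measurable borel"
  by (intro borel_measurable_continuous_onI continuous_intros)

lemma fourier_measurable [measurable]: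
  assumes [measurable]: "f \<in> borel_measurable borel"
  shows "fourier f \<in> borel_measurable borel"
  unfolding fourier_def by measurable

lemma fourier_bounded:
  assumes "integrable lborel f"
  shows "norm (fourier f \<xi>) \<le> (LINT x|lborel. norm (f x))"
proof -
  have "norm (fourier f \<xi>) \<le> (LINT x|lborel. norm (f x * cis (- 2 * pi * (\<xi> \<bullet> x))))"
    unfolding fourier_def by (rule integral_norm_bound)
  then show ?thesis by (simp add: norm_mult)
qed

lemma integrable_schwartz:
  fixes f :: "'d::{finite,linorder} rfun"
  assumes "f \<in> schwartz"
  shows "integrable lborel (\<lambda>x. (1 + C * norm x) ^ N * norm (f x))"
proof -
  define D where "D = max 1 \<bar>C\<bar>"
  have [measurable]: "f \<in> borel_measurable borel" using assms by (rule schwartz_measurable)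
  obtain B where B: "\<And>x. (1 + norm x) ^ (N + 2 * CARD('d)) * norm (f x) \<le> B"
    using schwartz_bounded_decay[OF assms] by blast
  have le: "norm ((1 + C * norm x) ^ N * norm (f x)) \<le> D ^ N * B * envelope 2 x" for x
  proof -
    have "\<bar>1 + C * norm x\<bar> \<le> 1 + \<bar>C\<bar> * norm x"
      by (rule order.trans[OF abs_triangle_ineq]) (simp add: abs_mult)
    also have "\<dots> \<le> D * 1 + D * norm x" unfolding D_def by (intro add_mono mult_right_mono) auto
    finally have "\<bar>1 + C * norm x\<bar> \<le> D * (1 + norm x)" by (simp add: algebra_simps)
    then have 1: "\<bar>1 + C * norm x\<bar> ^ N \<le> D ^ N * (1 + norm x) ^ N"
      by (subst power_mult_distrib[symmetric]) (intro power_mono, auto)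
    have 2: "1 \<le> envelope 2 x * (1 + norm x) ^ (2 * CARD('d))"
      using envelope_subadditive[of 2 x x] by (simp add: envelope_def)
    have "norm ((1 + C * norm x) ^ N * norm (f x)) \<le> D ^ N * (1 + norm x) ^ N * norm (f x) * 1"
      using 1 by (simp add: abs_mult power_abs mult_right_mono)
    also have "\<dots> \<le> D ^ N * (1 + norm x) ^ N * norm (f x) * (envelope 2 x * (1 + norm x) ^ (2 * CARD('d)))"
      using 2 by (intro mult_left_mono) (auto simp: D_def)
    also have "\<dots> = D ^ N * ((1 + norm x) ^ (N + 2 * CARD('d)) * norm (f x)) * envelope 2 x"
      by (simp add: power_add mult_ac)
    also have "\<dots> \<le> D ^ N * B * envelope 2 x"
      using B[of x] envelope_pos[of 2 x] by (intro mult_right_mono mult_left_mono) (auto simp: D_def less_imp_le)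
    finally show ?thesis .
  qed
  have "integrable lborel (\<lambda>x :: 'd rvec. envelope 2 x)"
    using nn_integral_envelope_finite[of 2 1, where 'd='d] envelope_pos[of 2]
    by (simp add: integrable_iff_bounded powr_one less_imp_le)
  then have "integrable lborel (\<lambda>x. D ^ N * B * envelope 2 (x :: 'd rvec))" by simp
  then show ?thesis
  proof (rule Bochner_Integration.integrable_bound)
    show "AE x in lborel. norm ((1 + C * norm x) ^ N * norm (f x)) \<le> norm (D ^ N * B * envelope 2 x)"
      by (intro AE_I2 order.trans[OF le]) simp
  qed measurable
qed

lemma integrable_schwartz': "f \<in> schwartz \<Longrightarrow> integrable lborel (f :: 'd::{finite,linorder} rfun)"
  using integrable_schwartz[of f 0 0] integrable_norm_cancel[of lborel f]
  by (simp add: schwartz_measurable)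

text \<open>Restricted to Schwartz functions, as tempered distributions are extensional.\<close>

definition distribution_of :: "'d::{finite,linorder} rfun \<Rightarrow> 'd rfun \<Rightarrow> complex" where
  "distribution_of f = (\<lambda>\<phi>\<in>schwartz. LINT y|lborel. f y * \<phi> y)"

lemma integrable_bounded_mult:
  fixes f g :: "'a::euclidean_space \<Rightarrow> complex"
  assumes "f \<in> borel_measurable borel" "\<And>x. norm (f x) \<le> B" "integrable lborel g"
  shows "integrable lborel (\<lambda>x. f x * g x)"
proof (rule Bochner_Integration.integrable_bound)
  show "integrable lborel (\<lambda>x. of_real B * g x)" using assms(3) by simp
  show "(\<lambda>x. f x * g x) \<in> borel_measurable lborel" using assms by measurable
  show "AE x in lborel. norm (f x * g x) \<le> norm (of_real B * g x)"
    using order.trans[OF assms(2) abs_ge_self] by (auto simp: norm_mult intro!: mult_right_mono)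
qed

lemma finite_multi_indices: "finite {\<beta> :: 'd::finite \<Rightarrow> nat. sum \<beta> UNIV \<le> N}"
proof (rule finite_subset)
  have "\<beta> m \<le> N" if "sum \<beta> UNIV \<le> N" for \<beta> :: "'d \<Rightarrow> nat" and m
    using member_le_sum[of m UNIV \<beta>] that by simp
  then show "{\<beta> :: 'd \<Rightarrow> nat. sum \<beta> UNIV \<le> N} \<subseteq> (UNIV \<rightarrow>\<^sub>E {..N})" by auto
  show "finite ((UNIV :: 'd set) \<rightarrow>\<^sub>E {..N})" by (rule finite_PiE) auto
qed

lemma multi_deriv_0: "multi_deriv (\<lambda>_. 0) f = f"
proof -
  have "foldr (\<lambda>i. partial_deriv i ^^ 0) xs f = f" for xs by (induction xs) auto
  then show ?thesis by (simp add: multi_deriv_def)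
qed

lemma weighted_norm_le_seminorm:
  assumes "\<phi> \<in> schwartz"
  shows "(1 + norm x) ^ N * norm (\<phi> x) \<le> schwartz_seminorm N \<phi>"
proof -
  let ?s = "\<lambda>\<beta>. SUP x. (1 + norm x) ^ N * norm (multi_deriv \<beta> \<phi> x)"
  have bdd: "bdd_above (range (\<lambda>x. (1 + norm x) ^ N * norm (multi_deriv \<beta> \<phi> x)))" for \<beta>
    using assms by (simp add: schwartz_def)
  have nn: "?s \<beta> \<ge> 0" for \<beta>
    by (rule order.trans[OF _ cSUP_upper[OF UNIV_I bdd]]) simp
  have "(1 + norm x) ^ N * norm (\<phi> x) \<le> ?s (\<lambda>_. 0)"
    using cSUP_upper[OF UNIV_I bdd, of x "\<lambda>_. 0"] by (simp add: multi_deriv_0)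
  also have "\<dots> \<le> schwartz_seminorm N \<phi>"
    unfolding schwartz_seminorm_def by (rule member_le_sum) (auto simp: nn finite_multi_indices)
  finally show ?thesis .
qed

lemma distribution_of_tempered:
  fixes f :: "'d::{finite,linorder} rfun"
  assumes f: "f \<in> borel_measurable borel" "\<And>x. norm (f x) \<le> B"
  shows "distribution_of f \<in> tempered_distributions"
proof -
  have int: "integrable lborel (\<lambda>y. f y * \<phi> y)" if "\<phi> \<in> schwartz" for \<phi>
    by (rule integrable_bounded_mult[OF f integrable_schwartz'[OF that]])
  have lin: "distribution_of f (\<lambda>x. a * \<phi> x + b * \<eta> x) = a * distribution_of f \<phi> + b * distribution_of f \<eta>"
    if "\<phi> \<in> schwartz" "\<eta> \<in> schwartz" for \<phi> \<eta> a b
  proof -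
    have "(LINT y|lborel. f y * (a * \<phi> y + b * \<eta> y)) = (LINT y|lborel. a * (f y * \<phi> y) + b * (f y * \<eta> y))"
      by (simp add: algebra_simps)
    also have "\<dots> = a * (LINT y|lborel. f y * \<phi> y) + b * (LINT y|lborel. f y * \<eta> y)"
      using int that by simp
    finally show ?thesis using that by (simp add: distribution_of_def schwartz_linear)
  qed
  let ?N = "2 * CARD('d)"
  define I where "I = (LINT x|lborel. envelope 2 (x :: 'd rvec))"
  have envelope_int: "integrable lborel (\<lambda>x :: 'd rvec. envelope 2 x)"
    using nn_integral_envelope_finite[of 2 1, where 'd='d] envelope_pos[of 2]
    by (simp add: integrable_iff_bounded powr_one less_imp_le)
  have bound: "norm (distribution_of f \<phi>) \<le> (B * I) * schwartz_seminorm ?N \<phi>" if "\<phi> \<in> schwartz" for \<phi>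
  proof -
    have le: "norm (f x * \<phi> x) \<le> B * schwartz_seminorm ?N \<phi> * envelope 2 x" for x
    proof -
      have "1 \<le> envelope 2 x * (1 + norm x) ^ ?N"
        using envelope_subadditive[of 2 x x] by (simp add: envelope_def)
      from mult_right_mono[OF this, of "norm (\<phi> x)"]
      have "norm (\<phi> x) \<le> envelope 2 x * ((1 + norm x) ^ ?N * norm (\<phi> x))" by (simp add: mult_ac)
      also have "\<dots> \<le> envelope 2 x * schwartz_seminorm ?N \<phi>"
        using envelope_pos[of 2 x] by (intro mult_left_mono weighted_norm_le_seminorm that) (auto simp: less_imp_le)
      finally have "norm (f x) * norm (\<phi> x) \<le> B * (envelope 2 x * schwartz_seminorm ?N \<phi>)"
        using f(2)[of x] order.trans[OF norm_ge_zero f(2)[of x]] by (intro mult_mono) auto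
      then show ?thesis by (simp add: norm_mult mult_ac)
    qed
    have "norm (distribution_of f \<phi>) \<le> (LINT y|lborel. norm (f y * \<phi> y))"
      using that by (simp add: distribution_of_def)
    also have "\<dots> \<le> (LINT y|lborel. B * schwartz_seminorm ?N \<phi> * envelope 2 (y :: 'd rvec))"
      by (rule Bochner_Integration.integral_mono) (use le int[OF that] envelope_int in auto)
    finally show ?thesis by (simp add: I_def mult_ac)
  qed
  have "distribution_of f \<in> extensional schwartz" by (simp add: distribution_of_def)
  with lin bound show ?thesis unfolding tempered_distributions_def by blast
qed

lemma convolve_distribution_of:
  assumes "\<phi> \<in> schwartz"
  shows "convolve (distribution_of f) \<phi> x = (LINT y|lborel. f y * \<phi> (x - y))"
  using schwartz_reflect[OF assms, of x] by (simp add: convolve_def distribution_of_def)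

text \<open>Functions given by their frequencies. On finite sums over \<open>k \<in> J\<close> of continuous superpositions of
  plane waves, derivatives and convolutions act by multiplication of the amplitudes, so that neither
  Fourier inversion nor the Fourier transform of a distribution is needed.\<close>

locale waves = prob_space \<nu> for \<nu> :: "'t measure" +
  fixes J :: "nat set" and \<omega> :: "nat \<Rightarrow> 't \<Rightarrow> 'd::{finite,wellorder} rvec" and R :: real
  assumes finite_modes: "finite J"
    and freq_measurable [measurable]: "\<And>k. \<omega> k \<in> borel_measurable \<nu>"
    and freq_bounded: "\<And>k \<eta>. k \<in> J \<Longrightarrow> \<eta> \<in> space \<nu> \<Longrightarrow> norm (\<omega> k \<eta>) \<le> R"
begin

definition amplitudes :: "(nat \<Rightarrow> 't \<Rightarrow> complex) set" where
  "amplitudes = {c. (\<forall>k. c k \<in> borel_measurable \<nu>) \<and> (\<exists>B. \<forall>k\<in>J. \<forall>\<eta>\<in>space \<nu>. norm (c k \<eta>) \<le> B)}"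

definition wave :: "(nat \<Rightarrow> 't \<Rightarrow> complex) \<Rightarrow> 'd rfun" where
  "wave c x = (\<Sum>k\<in>J. LINT \<eta>|\<nu>. c k \<eta> * cis (2 * pi * (x \<bullet> \<omega> k \<eta>)))"

lemma amplitudes_measurable [measurable_dest]: "c \<in> amplitudes \<Longrightarrow> c k \<in> borel_measurable \<nu>"
  by (simp add: amplitudes_def)

lemma amplitudes_integrable:
  assumes "c \<in> amplitudes" "k \<in> J" "g \<in> borel_measurable \<nu>" "\<And>\<eta>. \<eta> \<in> space \<nu> \<Longrightarrow> norm (g \<eta>) \<le> norm (c k \<eta>)"
  shows "integrable \<nu> (g :: 't \<Rightarrow> complex)"
proof -
  obtain B where "\<forall>\<eta>\<in>space \<nu>. norm (c k \<eta>) \<le> B" using assms(1,2) by (auto simp: amplitudes_def)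
  then show ?thesis
    using assms(3,4) by (intro integrable_const_bound[of _ B]) (auto intro: order.trans)
qed

lemma wave_integrable:
  assumes [measurable]: "c \<in> amplitudes" and "k \<in> J"
  shows "integrable \<nu> (\<lambda>\<eta>. c k \<eta> * cis (2 * pi * (x \<bullet> \<omega> k \<eta>)))"
  by (rule amplitudes_integrable[OF assms]) (auto simp: norm_mult)

lemma mode_measurable:
  assumes "c \<in> amplitudes"
  shows "(\<lambda>z. c k (snd z) * cis (2 * pi * (fst z \<bullet> \<omega> k (snd z)))) \<in> borel_measurable (borel \<Otimes>\<^sub>M \<nu>)"
proof -
  have [measurable]: "(\<lambda>z. c k (snd z)) \<in> borel_measurable (borel \<Otimes>\<^sub>M \<nu>)"
      "(\<lambda>z. \<omega> k (snd z)) \<in> borel_measurable (borel \<Otimes>\<^sub>M \<nu>)" for k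
    by (rule measurable_compose[OF measurable_snd]; simp add: assms amplitudes_measurable freq_measurable)+
  show ?thesis by measurable
qed

lemma mode_integral_measurable:
  assumes "c \<in> amplitudes"
  shows "(\<lambda>x. LINT \<eta>|\<nu>. c k \<eta> * cis (2 * pi * (x \<bullet> \<omega> k \<eta>))) \<in> borel_measurable borel"
  using mode_measurable[OF assms, of k]
  by (intro borel_measurable_lebesgue_integral) (simp add: case_prod_unfold)

lemma wave_measurable:
  assumes "c \<in> amplitudes"
  shows "wave c \<in> borel_measurable borel"
  unfolding wave_def by (intro borel_measurable_sum mode_integral_measurable assms)

lemma wave_bounded:
  assumes "c \<in> amplitudes"
  shows "\<exists>B. \<forall>x. norm (wave c x) \<le> B"
proof -
  have "norm (wave c x) \<le> (\<Sum>k\<in>J. LINT \<eta>|\<nu>. norm (c k \<eta>))" for x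
    unfolding wave_def
  proof (rule order.trans[OF norm_sum sum_mono])
    fix k assume "k \<in> J"
    have "norm (LINT \<eta>|\<nu>. c k \<eta> * cis (2 * pi * (x \<bullet> \<omega> k \<eta>))) \<le> (LINT \<eta>|\<nu>. norm (c k \<eta> * cis (2 * pi * (x \<bullet> \<omega> k \<eta>))))"
      by (rule integral_norm_bound)
    then show "norm (LINT \<eta>|\<nu>. c k \<eta> * cis (2 * pi * (x \<bullet> \<omega> k \<eta>))) \<le> (LINT \<eta>|\<nu>. norm (c k \<eta>))"
      by (simp add: norm_mult)
  qed
  then show ?thesis by blast
qed

lemma amplitudes_mult:
  assumes [measurable]: "c \<in> amplitudes" "\<And>k. e k \<in> borel_measurable \<nu>"
    and "\<And>k \<eta>. k \<in> J \<Longrightarrow> \<eta> \<in> space \<nu> \<Longrightarrow> norm (e k \<eta>) \<le> B"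
  shows "(\<lambda>k \<eta>. e k \<eta> * c k \<eta>) \<in> amplitudes"
proof -
  obtain B' where B': "\<And>k \<eta>. k \<in> J \<Longrightarrow> \<eta> \<in> space \<nu> \<Longrightarrow> norm (c k \<eta>) \<le> B'"
    using assms(1) by (auto simp: amplitudes_def)
  have "norm (e k \<eta> * c k \<eta>) \<le> \<bar>B\<bar> * \<bar>B'\<bar>" if "k \<in> J" "\<eta> \<in> space \<nu>" for k \<eta>
    unfolding norm_mult using assms(3)[OF that] B'[OF that] by (intro mult_mono) auto
  then show ?thesis unfolding amplitudes_def by (intro CollectI conjI allI) (measurable, blast)
qed

lemma freq_index_measurable [measurable]: "(\<lambda>\<eta>. \<omega> k \<eta> $ s) \<in> borel_measurable \<nu>"
proof -
  have "(\<lambda>\<eta>. \<omega> k \<eta> \<bullet> axis s 1) \<in> borel_measurable \<nu>" by measurable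
  then show ?thesis by (simp add: inner_axis)
qed

lemma amplitudes_derivative:
  assumes "c \<in> amplitudes"
  shows "(\<lambda>k \<eta>. (2 * pi * \<i> * complex_of_real (\<omega> k \<eta> $ s)) ^ n * c k \<eta>) \<in> amplitudes"
proof (rule amplitudes_mult[OF assms])
  fix k \<eta> assume "k \<in> J" "\<eta> \<in> space \<nu>"
  then have "\<bar>\<omega> k \<eta> $ s\<bar> \<le> R"
    using freq_bounded component_le_norm_cart order.trans by blast
  then have "norm (2 * pi * \<i> * complex_of_real (\<omega> k \<eta> $ s)) \<le> 2 * pi * R"
    by (simp add: norm_mult)
  then show "norm ((2 * pi * \<i> * complex_of_real (\<omega> k \<eta> $ s)) ^ n) \<le> (2 * pi * R) ^ n"
    unfolding norm_power by (intro power_mono) auto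
qed measurable

text \<open>As the frequencies are bounded, the second order remainder of the exponential is bounded uniformly,
  and differentiation passes under the integral.\<close>

lemma partial_deriv_wave:
  assumes c: "c \<in> amplitudes"
  shows "partial_deriv s (wave c) = wave (\<lambda>k \<eta>. 2 * pi * \<i> * complex_of_real (\<omega> k \<eta> $ s) * c k \<eta>)"
proof
  fix x
  note [measurable] = c
  let ?c = "\<lambda>k \<eta>. 2 * pi * \<i> * complex_of_real (\<omega> k \<eta> $ s) * c k \<eta>"
  have c': "?c \<in> amplitudes" using amplitudes_derivative[OF c, of s 1] by simp
  obtain B where B: "\<And>k \<eta>. k \<in> J \<Longrightarrow> \<eta> \<in> space \<nu> \<Longrightarrow> norm (c k \<eta>) \<le> B"
    using c by (auto simp: amplitudes_def)
  let ?g = "\<lambda>k t \<eta>. c k \<eta> * cis (2 * pi * ((x + t *\<^sub>R axis s 1) \<bullet> \<omega> k \<eta>))"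
  let ?g' = "\<lambda>k \<eta>. ?c k \<eta> * cis (2 * pi * (x \<bullet> \<omega> k \<eta>))"
  have "((\<lambda>t. LINT \<eta>|\<nu>. ?g k t \<eta>) has_vector_derivative (LINT \<eta>|\<nu>. ?g' k \<eta>)) (at 0)" if k: "k \<in> J" for k
  proof -
    define D where "D = B * (2 * pi * R) ^ 2"
    have pt: "norm (?g k t \<eta> - ?g k 0 \<eta> - t *\<^sub>R ?g' k \<eta>) \<le> D * t ^ 2" if \<eta>: "\<eta> \<in> space \<nu>" for t \<eta>
    proof -
      define u where "u = 2 * pi * \<omega> k \<eta> $ s"
      have "\<bar>\<omega> k \<eta> $ s\<bar> \<le> R"
        using freq_bounded[OF k \<eta>] component_le_norm_cart order.trans by blast
      then have u: "\<bar>u\<bar> \<le> 2 * pi * R" by (simp add: u_def abs_mult)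
      have B0: "B \<ge> 0" using B[OF k \<eta>] norm_ge_zero order.trans by blast
      have "?g k t \<eta> - ?g k 0 \<eta> - t *\<^sub>R ?g' k \<eta> = c k \<eta> * cis (2 * pi * (x \<bullet> \<omega> k \<eta>)) * (cis (t * u) - (1 + \<i> * (t * u)))"
      proof -
        have "2 * pi * ((x + t *\<^sub>R axis s 1) \<bullet> \<omega> k \<eta>) = 2 * pi * (x \<bullet> \<omega> k \<eta>) + t * u"
          by (simp add: u_def inner_add_left inner_axis' algebra_simps)
        then have "cis (2 * pi * ((x + t *\<^sub>R axis s 1) \<bullet> \<omega> k \<eta>)) = cis (2 * pi * (x \<bullet> \<omega> k \<eta>)) * cis (t * u)"
          by (simp add: cis_mult)
        then show ?thesis
          by (simp only: scaleR_conv_of_real[where 'a=complex] u_def) (simp add: algebra_simps)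
      qed
      then have "norm (?g k t \<eta> - ?g k 0 \<eta> - t *\<^sub>R ?g' k \<eta>) = norm (c k \<eta>) * norm (cis (t * u) - (1 + \<i> * (t * u)))"
        by (simp add: norm_mult)
      also have "\<dots> \<le> norm (c k \<eta>) * \<bar>t * u\<bar> ^ 2"
      proof (rule mult_left_mono)
        have "norm (cis (t * u) - (1 + \<i> * (t * u))) * 2 \<le> \<bar>t * u\<bar> ^ 2"
          using iexp_approx1[of "t * u" 1] by (simp add: cis_conv_exp numeral_2_eq_2)
        then show "norm (cis (t * u) - (1 + \<i> * (t * u))) \<le> \<bar>t * u\<bar> ^ 2"
          using norm_ge_zero[of "cis (t * u) - (1 + \<i> * (t * u))"] by linarith
      qed simp
      also have "norm (c k \<eta>) * \<bar>t * u\<bar> ^ 2 = norm (c k \<eta>) * (\<bar>u\<bar> ^ 2 * t ^ 2)"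
        by (simp add: power_mult_distrib abs_mult mult_ac)
      also have "\<dots> \<le> B * ((2 * pi * R) ^ 2 * t ^ 2)"
      proof -
        have "\<bar>u\<bar> ^ 2 * t ^ 2 \<le> (2 * pi * R) ^ 2 * t ^ 2"
          by (rule mult_right_mono[OF power_mono[OF u]]) auto
        then show ?thesis by (rule mult_mono[OF B[OF k \<eta>] _ B0]) simp
      qed
      also have "\<dots> = D * t ^ 2" by (simp add: D_def)
      finally show ?thesis .
    qed
    have aux: "norm ((LINT \<eta>|\<nu>. g \<eta>) - (LINT \<eta>|\<nu>. h \<eta>) - t *\<^sub>R (LINT \<eta>|\<nu>. e \<eta>)) \<le> K"
      if "integrable \<nu> g" "integrable \<nu> h" "integrable \<nu> e" "\<And>\<eta>. \<eta> \<in> space \<nu> \<Longrightarrow> norm (g \<eta> - h \<eta> - t *\<^sub>R e \<eta>) \<le> K"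
      for g h e :: "'t \<Rightarrow> complex" and t K :: real
    proof -
      have "norm (LINT \<eta>|\<nu>. g \<eta> - h \<eta> - t *\<^sub>R e \<eta>) \<le> (LINT \<eta>|\<nu>. norm (g \<eta> - h \<eta> - t *\<^sub>R e \<eta>))"
        by (rule integral_norm_bound)
      also have "\<dots> \<le> (LINT \<eta>|\<nu>. K)"
        by (rule Bochner_Integration.integral_mono) (use that in auto)
      finally show ?thesis using that by (simp add: prob_space)
    qed
    have int: "integrable \<nu> (?g k t)" "integrable \<nu> (?g' k)" for t
      using wave_integrable[OF c k] wave_integrable[OF c' k] by simp_all
    have bound: "norm ((LINT \<eta>|\<nu>. ?g k t \<eta>) - (LINT \<eta>|\<nu>. ?g k 0 \<eta>) - t *\<^sub>R (LINT \<eta>|\<nu>. ?g' k \<eta>)) \<le> D * t ^ 2" for t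
      by (rule aux[OF int(1) int(1) int(2) pt])
    have small_remainder: "(G has_vector_derivative G') (at 0)"
      if "\<And>t. norm (G t - G 0 - t *\<^sub>R G') \<le> D * t ^ 2" for G :: "real \<Rightarrow> complex" and G'
      unfolding has_vector_derivative_def
    proof (rule has_derivativeI_sandwich[of 1])
      fix y :: real assume "y \<noteq> 0" "dist y 0 < 1"
      have "norm (G y - G 0 - (y - 0) *\<^sub>R G') / norm (y - 0) \<le> D * y ^ 2 / \<bar>y\<bar>"
        using that[of y] by (simp add: divide_right_mono)
      also have "\<dots> = D * \<bar>y\<bar>" using \<open>y \<noteq> 0\<close> by (simp add: power2_eq_square abs_if)
      finally show "norm (G y - G 0 - (y - 0) *\<^sub>R G') / norm (y - 0) \<le> D * \<bar>y\<bar>" .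
    next
      show "((\<lambda>y. D * \<bar>y\<bar>) \<longlongrightarrow> 0) (at 0)" by (auto intro!: tendsto_eq_intros)
    qed (auto intro!: bounded_linear_intros)
    from bound show ?thesis by (rule small_remainder[of "\<lambda>t. LINT \<eta>|\<nu>. ?g k t \<eta>"])
  qed
  then show "partial_deriv s (wave c) x = wave ?c x"
    unfolding wave_def by (intro partial_deriv_eqI has_vector_derivative_sum) auto
qed

lemma iterated_partial_deriv_wave:
  assumes "c \<in> amplitudes"
  shows "(partial_deriv s ^^ n) (wave c) = wave (\<lambda>k \<eta>. (2 * pi * \<i> * complex_of_real (\<omega> k \<eta> $ s)) ^ n * c k \<eta>)"
proof (induction n)
  case (Suc n)
  have "(partial_deriv s ^^ Suc n) (wave c) = partial_deriv s ((partial_deriv s ^^ n) (wave c))" by simp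
  then show ?case
    unfolding Suc partial_deriv_wave[OF amplitudes_derivative[OF assms]] by (simp only: power_Suc mult.assoc)
qed simp

lemma amplitudes_fourier:
  assumes "c \<in> amplitudes" "integrable lborel \<phi>"
  shows "(\<lambda>k \<eta>. fourier \<phi> (\<omega> k \<eta>) * c k \<eta>) \<in> amplitudes"
proof (rule amplitudes_mult[OF assms(1)])
  have [measurable]: "fourier \<phi> \<in> borel_measurable borel"
    using assms(2) by (intro fourier_measurable) auto
  show "(\<lambda>\<eta>. fourier \<phi> (\<omega> k \<eta>)) \<in> borel_measurable \<nu>" for k by measurable
qed (rule fourier_bounded[OF assms(2)])

text \<open>Plane waves are eigenfunctions of convolutions, and the eigenvalues form the Fourier transform.\<close>

lemma convolution_wave:
  assumes c: "c \<in> amplitudes" and \<phi>: "integrable lborel \<phi>"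
  shows "(LINT y|lborel. wave c y * \<phi> (x - y)) = wave (\<lambda>k \<eta>. fourier \<phi> (\<omega> k \<eta>) * c k \<eta>) x"
proof -
  note [measurable] = c
  have [measurable]: "\<phi> \<in> borel_measurable borel" using \<phi> by auto
  have \<phi>x: "integrable lborel (\<lambda>y. \<phi> (x - y))" using \<phi> by (rule integrable_lborel_reflect)
  let ?f = "\<lambda>k y \<eta>. c k \<eta> * cis (2 * pi * (y \<bullet> \<omega> k \<eta>)) * \<phi> (x - y)"
  interpret P: pair_sigma_finite lborel \<nu> ..
  have mode: "(LINT y|lborel. (LINT \<eta>|\<nu>. c k \<eta> * cis (2 * pi * (y \<bullet> \<omega> k \<eta>))) * \<phi> (x - y))
      = (LINT \<eta>|\<nu>. fourier \<phi> (\<omega> k \<eta>) * c k \<eta> * cis (2 * pi * (x \<bullet> \<omega> k \<eta>)))" if k: "k \<in> J" for k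
  proof -
    have int: "integrable (lborel \<Otimes>\<^sub>M \<nu>) (\<lambda>(y, \<eta>). ?f k y \<eta>)"
    proof (rule P.Fubini_integrable)
      have "(\<lambda>z. c k (snd z) * cis (2 * pi * (fst z \<bullet> \<omega> k (snd z)))) \<in> borel_measurable (lborel \<Otimes>\<^sub>M \<nu>)"
        using mode_measurable[OF c, of k] by (simp cong: measurable_cong_sets sets_pair_measure_cong)
      moreover have "(\<lambda>z. \<phi> (x - fst z)) \<in> borel_measurable (lborel \<Otimes>\<^sub>M \<nu>)" by measurable
      ultimately have "(\<lambda>z. c k (snd z) * cis (2 * pi * (fst z \<bullet> \<omega> k (snd z))) * \<phi> (x - fst z)) \<in> borel_measurable (lborel \<Otimes>\<^sub>M \<nu>)"
        by (rule borel_measurable_times)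
      then show "(\<lambda>(y, \<eta>). ?f k y \<eta>) \<in> borel_measurable (lborel \<Otimes>\<^sub>M \<nu>)" by (simp add: case_prod_unfold)
      have "(\<lambda>y. LINT \<eta>|\<nu>. norm (case (y, \<eta>) of (y, \<eta>) \<Rightarrow> ?f k y \<eta>)) = (\<lambda>y. (LINT \<eta>|\<nu>. norm (c k \<eta>)) * norm (\<phi> (x - y)))"
        by (simp add: norm_mult)
      then show "integrable lborel (\<lambda>y. LINT \<eta>|\<nu>. norm (case (y, \<eta>) of (y, \<eta>) \<Rightarrow> ?f k y \<eta>))"
        using \<phi>x by simp
      show "AE y in lborel. integrable \<nu> (\<lambda>\<eta>. case (y, \<eta>) of (y, \<eta>) \<Rightarrow> ?f k y \<eta>)"
        using wave_integrable[OF c k] by simp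
    qed
    have "(LINT y|lborel. (LINT \<eta>|\<nu>. c k \<eta> * cis (2 * pi * (y \<bullet> \<omega> k \<eta>))) * \<phi> (x - y))
        = (LINT y|lborel. (LINT \<eta>|\<nu>. ?f k y \<eta>))"
      using wave_integrable[OF c k] by simp
    also have "\<dots> = (LINT \<eta>|\<nu>. (LINT y|lborel. ?f k y \<eta>))"
      by (rule P.Fubini_integral[OF int, symmetric])
    also have "\<dots> = (LINT \<eta>|\<nu>. fourier \<phi> (\<omega> k \<eta>) * c k \<eta> * cis (2 * pi * (x \<bullet> \<omega> k \<eta>)))"
    proof (intro Bochner_Integration.integral_cong refl)
      fix \<eta>
      have "(LINT y|lborel. ?f k y \<eta>) = (LINT y|lborel. ?f k (x - y) \<eta>)"
        by (rule integral_lborel_reflect[symmetric]) measurable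
      also have "\<dots> = (LINT y|lborel. c k \<eta> * cis (2 * pi * (x \<bullet> \<omega> k \<eta>)) * (\<phi> y * cis (- 2 * pi * (\<omega> k \<eta> \<bullet> y))))"
      proof (intro Bochner_Integration.integral_cong refl)
        fix y
        have "2 * pi * ((x - y) \<bullet> \<omega> k \<eta>) = 2 * pi * (x \<bullet> \<omega> k \<eta>) + - 2 * pi * (\<omega> k \<eta> \<bullet> y)"
          by (simp add: inner_diff_left inner_commute[of y] right_diff_distrib)
        then have "cis (2 * pi * ((x - y) \<bullet> \<omega> k \<eta>)) = cis (2 * pi * (x \<bullet> \<omega> k \<eta>)) * cis (- 2 * pi * (\<omega> k \<eta> \<bullet> y))"
          by (simp only: cis_mult)
        then show "?f k (x - y) \<eta> = c k \<eta> * cis (2 * pi * (x \<bullet> \<omega> k \<eta>)) * (\<phi> y * cis (- 2 * pi * (\<omega> k \<eta> \<bullet> y)))"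
          by (simp only: mult_ac diff_diff_eq2 add_diff_cancel_left')
      qed
      also have "\<dots> = c k \<eta> * cis (2 * pi * (x \<bullet> \<omega> k \<eta>)) * fourier \<phi> (\<omega> k \<eta>)"
        unfolding fourier_def by (rule integral_mult_right_zero)
      finally show "(LINT y|lborel. ?f k y \<eta>) = fourier \<phi> (\<omega> k \<eta>) * c k \<eta> * cis (2 * pi * (x \<bullet> \<omega> k \<eta>))"
        by (simp add: mult_ac)
    qed
    finally show ?thesis .
  qed
  have "(LINT y|lborel. wave c y * \<phi> (x - y))
      = (LINT y|lborel. (\<Sum>k\<in>J. (LINT \<eta>|\<nu>. c k \<eta> * cis (2 * pi * (y \<bullet> \<omega> k \<eta>))) * \<phi> (x - y)))"
    by (simp add: wave_def sum_distrib_right)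
  also have "\<dots> = (\<Sum>k\<in>J. (LINT y|lborel. (LINT \<eta>|\<nu>. c k \<eta> * cis (2 * pi * (y \<bullet> \<omega> k \<eta>))) * \<phi> (x - y)))"
  proof (rule Bochner_Integration.integral_sum)
    fix k assume k: "k \<in> J"
    have "norm (LINT \<eta>|\<nu>. c k \<eta> * cis (2 * pi * (y \<bullet> \<omega> k \<eta>))) \<le> (LINT \<eta>|\<nu>. norm (c k \<eta>))" for y
      using integral_norm_bound[of \<nu> "\<lambda>\<eta>. c k \<eta> * cis (2 * pi * (y \<bullet> \<omega> k \<eta>))"] by (simp add: norm_mult)
    then show "integrable lborel (\<lambda>y. (LINT \<eta>|\<nu>. c k \<eta> * cis (2 * pi * (y \<bullet> \<omega> k \<eta>))) * \<phi> (x - y))"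
      by (intro integrable_bounded_mult[OF _ _ \<phi>x] mode_integral_measurable[OF c])
  qed
  also have "\<dots> = wave (\<lambda>k \<eta>. fourier \<phi> (\<omega> k \<eta>) * c k \<eta>) x"
    unfolding wave_def by (intro sum.cong refl mode)
  finally show ?thesis .
qed

end

section \<open>Frequencies adapted to the matrix\<close>

lemma multi_deriv_single:
  "multi_deriv (\<lambda>l. if l = s then n else 0) f = (partial_deriv s ^^ n) f"
proof -
  have "foldr (\<lambda>l. partial_deriv l ^^ (if l = s then n else 0)) xs f = (if s \<in> set xs then (partial_deriv s ^^ n) f else f)"
    if "distinct xs" for xs :: "'a list"
    using that by (induction xs) auto
  then show ?thesis by (simp add: multi_deriv_def)
qed

lemma norm_le_index_bound:
  assumes "\<And>l. \<bar>x $ l\<bar> \<le> c"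
  shows "norm (x :: 'd::finite rvec) \<le> real CARD('d) * c"
  using order.trans[OF norm_le_l1_cart sum_mono[of UNIV "\<lambda>l. \<bar>x $ l\<bar>" "\<lambda>_. c"]] assms by simp

locale besov_setting = expansive_jordan A
  for A :: "(real, 'd::{finite,wellorder}) sqmat" +
  fixes \<psi> \<psi>0 :: "'d rfun"
  assumes wavelet: "A_wavelet A \<psi>" and low_pass: "low_pass_complement A \<psi> \<psi>0"
begin

abbreviation "dil \<equiv> dilated A \<psi> \<psi>0"

lemma schwartz_\<psi>: "\<psi> \<in> schwartz" and schwartz_\<psi>0: "\<psi>0 \<in> schwartz"
  using wavelet low_pass by (simp_all add: A_wavelet_def low_pass_complement_def)

lemma det_mat_pow: "det (mat_pow A k) = 2 ^ k"
  by (induction k) (simp_all add: mat_pow_Suc det_mul det_A)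

lemma invertible_mat_pow: "invertible (mat_pow A k)"
  by (simp add: invertible_det_nz det_mat_pow)

lemma dil_pos: "m \<ge> 1 \<Longrightarrow> dil m = (\<lambda>x. of_real (2 ^ m) * \<psi> (mat_pow A m *v x))"
  by (simp add: dilated_def det_A)

lemma schwartz_dil: "dil m \<in> schwartz"
proof (cases "m = 0")
  case True
  then show ?thesis by (simp add: dilated_def schwartz_\<psi>0)
next
  case False
  then show ?thesis
    using schwartz_scale[OF schwartz_affine[OF schwartz_\<psi> invertible_mat_pow, of 0 m], of "of_real (2 ^ m)"]
    by (simp add: dil_pos)
qed

lemma fourier_dil:
  assumes "m \<ge> 1"
  shows "fourier (dil m) \<xi> = fourier \<psi> (down m \<xi>)"
proof -
  have [measurable]: "\<psi> \<in> borel_measurable borel" by (rule schwartz_measurable[OF schwartz_\<psi>])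
  let ?f = "\<lambda>x. \<psi> x * cis (- 2 * pi * (down m \<xi> \<bullet> x))"
  have "down m \<xi> \<bullet> (mat_pow A m *v x) = \<xi> \<bullet> x" for x
    using inner_up[of x m "down m \<xi>"] by (simp add: up_down inner_commute)
  then have "fourier (dil m) \<xi> = (LINT x|lborel. of_real \<bar>det (mat_pow A m)\<bar> * ?f (mat_pow A m *v x))"
    using assms by (simp add: fourier_def dil_pos det_mat_pow mult.assoc)
  also have "\<dots> = \<bar>det (mat_pow A m)\<bar> *\<^sub>R (LINT x|lborel. ?f (mat_pow A m *v x))"
    unfolding scaleR_conv_of_real[where 'a=complex] by (rule integral_mult_right_zero)
  also have "\<dots> = (LINT x|lborel. ?f x)"
    by (rule integral_lborel_matrix[OF invertible_mat_pow]) measurable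
  finally show ?thesis by (simp add: fourier_def)
qed

text \<open>A cell centred at the vector of ones: its image under a nonnegative matrix again has positive
  coordinates, which are comparable to those of the image of the centre.\<close>

definition frequency_cell :: "'d rvec set" where
  "frequency_cell = {\<zeta>. \<forall>l. \<bar>\<zeta> $ l - 1\<bar> \<le> 1/2}"

lemma frequency_cellD:
  assumes "\<zeta> \<in> frequency_cell"
  shows "1/2 \<le> \<zeta> $ l" "\<bar>\<zeta> $ l\<bar> \<le> 3/2"
proof -
  have "\<bar>\<zeta> $ l - 1\<bar> \<le> 1/2" using assms by (simp add: frequency_cell_def)
  then show "1/2 \<le> \<zeta> $ l" "\<bar>\<zeta> $ l\<bar> \<le> 3/2" by linarith+
qed

text \<open>The powers of the transpose move the cell out to infinity and into the origin, hence away from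
  the support of the Fourier transform of the wavelet.\<close>

lemma exists_scale_separation:
  "\<exists>M\<ge>1. \<forall>k\<ge>M. \<forall>\<zeta>\<in>frequency_cell.
     fourier \<psi> (up k \<zeta>) = 0 \<and> fourier \<psi> (down k \<zeta>) = 0 \<and> fourier \<psi>0 (up k \<zeta>) = 0"
proof -
  have sub: "{\<xi>. fourier f \<xi> \<noteq> 0} \<subseteq> support (fourier f)" for f :: "'d rfun"
    unfolding support_def by (rule closure_subset)
  have "bounded (support (fourier \<psi>))" "bounded (support (fourier \<psi>0))"
    using wavelet low_pass compact_imp_bounded by (auto simp: A_wavelet_def low_pass_complement_def)
  then obtain b1 b2 where "\<And>\<xi>. \<xi> \<in> support (fourier \<psi>) \<Longrightarrow> norm \<xi> \<le> b1"
    "\<And>\<xi>. \<xi> \<in> support (fourier \<psi>0) \<Longrightarrow> norm \<xi> \<le> b2"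
    unfolding bounded_iff by blast
  then have far: "fourier \<psi> \<xi> = 0 \<and> fourier \<psi>0 \<xi> = 0" if "norm \<xi> > max b1 b2" for \<xi>
    using sub[of \<psi>] sub[of \<psi>0] that by fastforce
  have "0 \<in> - support (fourier \<psi>)" "open (- support (fourier \<psi>))"
    using wavelet by (auto simp: A_wavelet_def support_def)
  then obtain r where r: "r > 0" "ball 0 r \<subseteq> - support (fourier \<psi>)"
    unfolding open_contains_ball by blast
  have near: "fourier \<psi> \<xi> = 0" if "norm \<xi> < r" for \<xi>
    using r(2) sub[of \<psi>] that by (auto simp: subset_iff)
  obtain s where s: "A $ s $ s = lam" using lambda_max_diagonal by blast
  obtain M1 where M1: "2 * max b1 b2 < lam ^ M1"
    using real_arch_pow[OF lambda_max_gt_1] by blast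
  obtain C \<rho> where C: "0 < \<rho>" "\<rho> < 1" "C \<ge> 1" "\<And>k \<xi> i c. (\<forall>l. \<bar>\<xi> $ l\<bar> \<le> c) \<Longrightarrow> \<bar>down k \<xi> $ i\<bar> \<le> C * \<rho> ^ k * c"
    using down_decay by blast
  have "0 < r / (real CARD('d) * C * (3/2))" using r C by simp
  then obtain M2 where M2: "\<rho> ^ M2 < r / (real CARD('d) * C * (3/2))"
    using real_arch_pow_inv[OF _ C(2)] by blast
  show ?thesis
  proof (intro exI[of _ "M1 + M2 + 1"] conjI allI ballI impI)
    fix k \<zeta> assume k: "M1 + M2 + 1 \<le> k" and \<zeta>: "\<zeta> \<in> frequency_cell"
    have "1/2 \<le> \<zeta> $ l" "\<bar>\<zeta> $ l\<bar> \<le> 3/2" for l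
      using frequency_cellD[OF \<zeta>] by blast+
    note cell = this
    have "max b1 b2 < 1/2 * lam ^ M1" using M1 by simp
    also have "\<dots> \<le> 1/2 * lam ^ k"
      using k lambda_max_gt_1 by (intro mult_left_mono power_increasing) auto
    also have "\<dots> \<le> up k \<zeta> $ s"
      using up_ge_power[where c = "1/2" and \<zeta> = \<zeta> and k = k and i = s] cell s by simp
    also have "\<dots> \<le> norm (up k \<zeta>)"
      using component_le_norm_cart[of "up k \<zeta>" s] by simp
    finally have up: "max b1 b2 < norm (up k \<zeta>)" .
    then show "fourier \<psi> (up k \<zeta>) = 0" "fourier \<psi>0 (up k \<zeta>) = 0" using far by auto
    have "norm (down k \<zeta>) \<le> real CARD('d) * (C * \<rho> ^ k * (3/2))"
      using C(4)[of \<zeta> "3/2" k] cell by (intro norm_le_index_bound) auto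
    also have "\<dots> \<le> real CARD('d) * (C * \<rho> ^ M2 * (3/2))"
      using k C by (intro mult_left_mono mult_right_mono power_decreasing) auto
    also have "\<dots> < r" using M2 C by (simp add: field_simps)
    finally show "fourier \<psi> (down k \<zeta>) = 0" by (rule near)
  qed simp
qed

text \<open>Frequencies \<open>\<eta>\<close> in this cube may be added at any coarser scale without leaving the cell.\<close>

lemma exists_small_cube:
  "\<exists>\<delta>>0. \<forall>\<eta>\<in>cube \<delta>. \<forall>k l. \<bar>down k \<eta> $ l\<bar> \<le> 1/2"
proof -
  obtain C \<rho> where C: "0 < \<rho>" "\<rho> < 1" "C \<ge> 1" "\<And>k \<xi> i c. (\<forall>l. \<bar>\<xi> $ l\<bar> \<le> c) \<Longrightarrow> \<bar>down k \<xi> $ i\<bar> \<le> C * \<rho> ^ k * c"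
    using down_decay by blast
  have "\<bar>down k \<eta> $ l\<bar> \<le> 1/2" if "\<eta> \<in> cube (1 / (2 * C))" for \<eta> k l
  proof -
    have "\<bar>down k \<eta> $ l\<bar> \<le> C * \<rho> ^ k * (1 / (2 * C))"
      using that by (intro C(4)) (simp add: cube_def)
    also have "\<dots> \<le> C * 1 * (1 / (2 * C))"
      using C by (intro mult_right_mono mult_left_mono power_le_one) auto
    finally show ?thesis using C by simp
  qed
  then show ?thesis using C by (intro exI[of _ "1 / (2 * C)"]) auto
qed

text \<open>Positive powers of \<open>A\<close> only occur up to \<open>M\<close>, negative ones are uniformly bounded.\<close>

lemma mat_pow_comparison:
  "\<exists>C\<ge>0. \<forall>i m y. i < m + M \<longrightarrow> norm (mat_pow A i *v y) \<le> C * norm (mat_pow A m *v y)"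
proof -
  obtain C1 where C1: "C1 \<ge> 1" "\<And>k x i c. (\<forall>l. \<bar>x $ l\<bar> \<le> c) \<Longrightarrow> \<bar>(mat_pow iA k *v x) $ i\<bar> \<le> C1 * c"
    using pow_iA_bounded by blast
  have C1': "norm (mat_pow iA k *v z) \<le> real CARD('d) * C1 * norm z" for k z
    unfolding mult.assoc
    by (intro norm_le_index_bound C1(2)[rule_format]) (rule component_le_norm_cart)
  define C2 where "C2 = (\<Sum>k<M. onorm ((*v) (mat_pow A k)))"
  have on: "onorm ((*v) (mat_pow A k)) \<ge> 0" for k
    by (rule onorm_pos_le[OF matrix_vector_mul_bounded_linear])
  have C2: "norm (mat_pow A k *v z) \<le> C2 * norm z" if "k < M" for k z
  proof -
    have "norm (mat_pow A k *v z) \<le> onorm ((*v) (mat_pow A k)) * norm z"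
      by (rule onorm[OF matrix_vector_mul_bounded_linear])
    also have "\<dots> \<le> C2 * norm z"
      unfolding C2_def using that on by (intro mult_right_mono member_le_sum) auto
    finally show ?thesis .
  qed
  have "C2 \<ge> 0" unfolding C2_def using on by (intro sum_nonneg)
  have "norm (mat_pow A i *v y) \<le> (real CARD('d) * C1 + C2) * norm (mat_pow A m *v y)" if "i < m + M" for i m y
  proof (cases "i \<le> m")
    case True
    have "mat_pow iA (m - i) *v (mat_pow A m *v y) = mat_pow A i *v y"
    proof -
      have "mat_pow A m = mat_pow A (m - i) ** mat_pow A i" using True by (simp flip: mat_pow_add)
      then show ?thesis
        by (simp add: matrix_vector_mul_assoc matrix_mul_assoc pow_iA_pow_A)
    qed
    then have "norm (mat_pow A i *v y) \<le> real CARD('d) * C1 * norm (mat_pow A m *v y)"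
      using C1'[of "m - i" "mat_pow A m *v y"] by simp
    then show ?thesis using \<open>C2 \<ge> 0\<close> by (simp add: distrib_right add_increasing2)
  next
    case False
    then have "mat_pow A i *v y = mat_pow A (i - m) *v (mat_pow A m *v y)"
      by (simp add: matrix_vector_mul_assoc flip: mat_pow_add)
    then have "norm (mat_pow A i *v y) \<le> C2 * norm (mat_pow A m *v y)"
      using C2[of "i - m"] that False by simp
    then show ?thesis using C1(1) by (simp add: distrib_right add_increasing)
  qed
  then show ?thesis using C1 \<open>C2 \<ge> 0\<close> by (intro exI[of _ "real CARD('d) * C1 + C2"]) auto
qed

definition ones :: "'d rvec" where "ones = (\<chi> l. 1)"

text \<open>The scale \<open>j\<close> determines the modulation of a mode, the scale \<open>i\<close> the set on which it lives.\<close>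

definition freq :: "nat \<Rightarrow> nat \<Rightarrow> 'd rvec \<Rightarrow> 'd rvec" where
  "freq i j \<eta> = up j ones + up i \<eta>"

text \<open>The size of the frequencies at scale \<open>j\<close> in direction \<open>s\<close>, hence the factor that a derivative in this
  direction contributes.\<close>

definition growth :: "'d \<Rightarrow> nat \<Rightarrow> real" where
  "growth s j = up j ones $ s"

lemma inner_freq: "x \<bullet> freq i j \<eta> = (mat_pow A j *v x) \<bullet> ones + (mat_pow A i *v x) \<bullet> \<eta>"
  by (simp add: freq_def inner_add_right inner_up)

lemma continuous_up: "continuous_on S (up k)"
  unfolding up_def by (intro continuous_intros)

lemma growth_eq: "growth s j = (\<Sum>l\<in>UNIV. mat_pow A j $ l $ s)"
  by (simp add: growth_def up_index ones_def)

lemma growth_ge_entry: "growth s j \<ge> mat_pow A j $ l $ s"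
  unfolding growth_eq by (rule member_le_sum) (auto simp: mat_pow_nonneg)

lemma growth_nonneg: "growth s j \<ge> 0"
  unfolding growth_eq by (intro sum_nonneg mat_pow_nonneg)

end

text \<open>\<open>M\<close> is a number of scales after which the frequency cell has left the support of the wavelet. The
  random frequency \<open>\<eta>\<close> has distribution \<open>\<nu>\<close>, concentrated on a cube of size \<open>\<delta>\<close>; \<open>D\<close> and \<open>L\<close> measure the
  decay of its characteristic function. The exponent of the envelope is even because one half
  of the decay serves to separate translates.\<close>

locale test_functions = besov_setting A \<psi> \<psi>0 + prob_space \<nu>
  for A :: "(real, 'd::{finite,wellorder}) sqmat" and \<psi> \<psi>0 :: "'d rfun" and \<nu> :: "'d rvec measure" +
  fixes M L :: nat and \<delta> D :: real
  assumes M: "M \<ge> 1"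
    and separation: "\<And>k \<zeta>. k \<ge> M \<Longrightarrow> \<zeta> \<in> frequency_cell \<Longrightarrow>
     fourier \<psi> (up k \<zeta>) = 0 \<and> fourier \<psi> (down k \<zeta>) = 0 \<and> fourier \<psi>0 (up k \<zeta>) = 0"
    and L: "L \<ge> 1" and \<delta>: "\<delta> > 0"
    and down_small: "\<And>\<eta> k l. \<eta> \<in> cube \<delta> \<Longrightarrow> \<bar>down k \<eta> $ l\<bar> \<le> 1/2"
    and space_\<nu>: "space \<nu> = cube \<delta>" and sets_\<nu>: "sets \<nu> = sets (restrict_space borel (cube \<delta>))"
    and decay_\<nu>: "\<And>y. norm (LINT \<eta>|\<nu>. cis (2 * pi * (y \<bullet> \<eta>))) \<le> D * envelope (2 * L) y"
begin

lemma D_nonneg: "D \<ge> 0"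
proof -
  have "0 \<le> D * envelope (2 * L) (0 :: 'd rvec)" using order.trans[OF norm_ge_zero decay_\<nu>[of 0]] .
  then show ?thesis using envelope_pos[of "2 * L" "0 :: 'd rvec"] by (metis zero_le_mult_iff not_less)
qed

lemma measurable_\<nu>: "f \<in> borel_measurable borel \<Longrightarrow> f \<in> borel_measurable \<nu>"
  using measurable_restrict_space1[of f borel borel "cube \<delta>"] measurable_cong_sets[OF sets_\<nu> refl] by blast

lemma freq_measurable: "freq i j \<in> borel_measurable \<nu>"
  by (intro measurable_\<nu> borel_measurable_continuous_onI) (auto simp: freq_def intro!: continuous_intros continuous_up)

lemma freq_in_cell:
  assumes "i \<le> j" "\<eta> \<in> space \<nu>"
  shows "\<exists>\<zeta>\<in>frequency_cell. freq i j \<eta> = up j \<zeta>"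
proof
  let ?\<zeta> = "ones + down (j - i) \<eta>"
  show "?\<zeta> \<in> frequency_cell"
    using down_small[of \<eta> "j - i"] assms by (simp add: frequency_cell_def ones_def space_\<nu>)
  have "up j ?\<zeta> = up j ones + up j (down (j - i) \<eta>)"
    by (simp add: up_def matrix_vector_right_distrib)
  also have "up j (down (j - i) \<eta>) = up i \<eta>"
    using up_add[of i "j - i" "down (j - i) \<eta>"] assms by (simp add: up_down)
  finally show "freq i j \<eta> = up j ?\<zeta>" by (simp add: freq_def)
qed

lemma freq_ge:
  assumes "i \<le> j" "\<eta> \<in> space \<nu>"
  shows "freq i j \<eta> $ s \<ge> growth s j / 2"
proof -
  obtain \<zeta> where \<zeta>: "\<zeta> \<in> frequency_cell" "freq i j \<eta> = up j \<zeta>" using freq_in_cell[OF assms] by blast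
  have "1/2 \<le> \<zeta> $ l" for l
    using frequency_cellD[OF \<zeta>(1)] by blast
  then have "mat_pow A j $ l $ s / 2 \<le> mat_pow A j $ l $ s * \<zeta> $ l" for l
    using mult_left_mono[of "1/2" "\<zeta> $ l" "mat_pow A j $ l $ s"] mat_pow_nonneg[of j l s] by simp
  then show ?thesis
    unfolding \<zeta>(2) up_index growth_eq sum_divide_distrib by (intro sum_mono)
qed

text \<open>The dyadic blocks that can meet the frequencies at scale \<open>j\<close>.\<close>

definition near :: "nat \<Rightarrow> nat \<Rightarrow> bool" where
  "near m j \<longleftrightarrow> j < m + M \<and> m < j + M"

lemma fourier_dil_eq_0:
  assumes "i \<le> j" "2 * M \<le> j" "\<eta> \<in> space \<nu>" "\<not> near m j"
  shows "fourier (dil m) (freq i j \<eta>) = 0"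
proof -
  obtain \<zeta> where \<zeta>: "\<zeta> \<in> frequency_cell" "freq i j \<eta> = up j \<zeta>" using freq_in_cell assms by blast
  consider "m = 0" | "1 \<le> m" "m + M \<le> j" | "1 \<le> m" "j + M \<le> m"
    using assms(4) unfolding near_def by linarith
  then show ?thesis
  proof cases
    case 1
    then show ?thesis using separation[OF _ \<zeta>(1), of j] \<zeta> assms(2) by (simp add: dilated_def)
  next
    case 2
    then show ?thesis using separation[OF _ \<zeta>(1), of "j - m"] \<zeta> by (simp add: fourier_dil down_up_le)
  next
    case 3
    then show ?thesis using separation[OF _ \<zeta>(1), of "m - j"] \<zeta> by (simp add: fourier_dil down_up_ge)
  qed
qed

lemma finite_near: "finite {m. near m j}"
  by (rule finite_subset[of _ "{..<j + M}"]) (auto simp: near_def)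

text \<open>At these frequencies the low-pass complement vanishes, so the dyadic blocks form a partition of
  unity on their own.\<close>

lemma fourier_dil_sum:
  assumes "i \<le> j" "2 * M \<le> j" "\<eta> \<in> space \<nu>" "finite S" "{m. near m j} \<subseteq> S"
  shows "(\<Sum>m\<in>S. fourier (dil m) (freq i j \<eta>)) = 1"
proof -
  obtain \<zeta> where \<zeta>: "\<zeta> \<in> frequency_cell" "freq i j \<eta> = up j \<zeta>" using freq_in_cell assms by blast
  let ?\<xi> = "freq i j \<eta>"
  have 0: "fourier \<psi>0 ?\<xi> = 0" using separation[OF _ \<zeta>(1), of j] \<zeta> assms(2) by simp
  obtain s where "((\<lambda>j. fourier \<psi> (mat_powi (transpose A) (- int j) *v ?\<xi>)) has_sum s) {1..}" "fourier \<psi>0 ?\<xi> + s = 1"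
    using low_pass unfolding low_pass_complement_def by blast
  then have hs: "((\<lambda>j. fourier \<psi> (mat_powi (transpose A) (- int j) *v ?\<xi>)) has_sum 1) {1..}" using 0 by simp
  have "((\<lambda>m. fourier (dil m) ?\<xi>) has_sum 1) {1..}"
    by (rule iffD1[OF has_sum_cong hs]) (simp add: fourier_dil down_def)
  then have "((\<lambda>m. fourier (dil m) ?\<xi>) has_sum 1) S"
  proof (rule iffD1[OF has_sum_cong_neutral, rotated 3])
    show "fourier (dil m) ?\<xi> = 0" if "m \<in> S - {1..}" for m
      using that 0 by (auto simp: dilated_def not_le)
    show "fourier (dil m) ?\<xi> = 0" if "m \<in> {1..} - S" for m
      using that assms by (intro fourier_dil_eq_0) auto
  qed simp
  then show ?thesis using has_sum_finite[OF assms(4)] has_sum_unique by blast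
qed

definition mode :: "nat \<Rightarrow> nat \<Rightarrow> 'd rfun" where
  "mode i j x = (LINT \<eta>|\<nu>. cis (2 * pi * (x \<bullet> freq i j \<eta>)))"

definition dmode :: "nat \<Rightarrow> 'd \<Rightarrow> nat \<Rightarrow> nat \<Rightarrow> 'd rfun" where
  "dmode n s i j x = (LINT \<eta>|\<nu>. (2 * pi * \<i> * complex_of_real (freq i j \<eta> $ s)) ^ n * cis (2 * pi * (x \<bullet> freq i j \<eta>)))"

lemma norm_mode_le: "norm (mode i j x) \<le> D * envelope (2 * L) (mat_pow A i *v x)"
proof -
  have "mode i j x = (LINT \<eta>|\<nu>. cis (2 * pi * ((mat_pow A j *v x) \<bullet> ones)) * cis (2 * pi * ((mat_pow A i *v x) \<bullet> \<eta>)))"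
    unfolding mode_def inner_freq cis_mult by (simp add: distrib_left)
  also have "\<dots> = cis (2 * pi * ((mat_pow A j *v x) \<bullet> ones)) * (LINT \<eta>|\<nu>. cis (2 * pi * ((mat_pow A i *v x) \<bullet> \<eta>)))"
    by (rule integral_mult_right_zero)
  finally show ?thesis using decay_\<nu>[of "mat_pow A i *v x"] by (simp add: norm_mult)
qed

lemma exists_waves:
  assumes "finite J"
  shows "\<exists>R. waves \<nu> J (\<lambda>k. freq (i k) (j k)) R"
proof -
  define R where "R = (\<Sum>k\<in>J. norm (up (j k) ones) + onorm ((*v) (mat_pow (transpose A) (i k))) * (real CARD('d) * \<delta>))"
  have bl: "bounded_linear ((*v) (mat_pow (transpose A) k))" for k
    by (rule matrix_vector_mul_bounded_linear)
  have "norm (freq (i k) (j k) \<eta>) \<le> R" if "k \<in> J" "\<eta> \<in> space \<nu>" for k \<eta>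
  proof -
    have \<eta>: "norm \<eta> \<le> real CARD('d) * \<delta>"
      using that(2) by (intro norm_le_index_bound) (simp add: space_\<nu> cube_def)
    have "norm (freq (i k) (j k) \<eta>) \<le> norm (up (j k) ones) + norm (up (i k) \<eta>)"
      unfolding freq_def by (rule norm_triangle_ineq)
    also have "norm (up (i k) \<eta>) \<le> onorm ((*v) (mat_pow (transpose A) (i k))) * norm \<eta>"
      unfolding up_def by (rule onorm[OF bl])
    also have "\<dots> \<le> onorm ((*v) (mat_pow (transpose A) (i k))) * (real CARD('d) * \<delta>)"
      by (intro mult_left_mono \<eta> onorm_pos_le[OF bl])
    finally have "norm (freq (i k) (j k) \<eta>) \<le> norm (up (j k) ones) + onorm ((*v) (mat_pow (transpose A) (i k))) * (real CARD('d) * \<delta>)"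
      by simp
    also have "\<dots> \<le> R"
      unfolding R_def using that(1) assms \<delta> onorm_pos_le[OF bl]
      by (intro member_le_sum) (auto intro!: add_nonneg_nonneg mult_nonneg_nonneg)
    finally show ?thesis .
  qed
  then show ?thesis using assms freq_measurable
    by (intro exI[of _ R]) (unfold_locales, auto)
qed

text \<open>Convolving a mode with a dyadic block does not spoil its envelope, uniformly in all scales that
  are not much coarser than the mode.\<close>

lemma convolution_mode_bound:
  "\<exists>C\<ge>0. \<forall>i j m \<tau> x. 1 \<le> m \<longrightarrow> i < m + M \<longrightarrow>
     norm (LINT y|lborel. mode i j (y - \<tau>) * dil m (x - y)) \<le> C * envelope (2 * L) (mat_pow A i *v (x - \<tau>))"
proof -
  obtain B where B: "B \<ge> 0" "\<And>i m y. i < m + M \<Longrightarrow> norm (mat_pow A i *v y) \<le> B * norm (mat_pow A m *v y)"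
    using mat_pow_comparison by blast
  let ?N = "2 * L * CARD('d)"
  let ?g = "\<lambda>z. (1 + B * norm z) ^ ?N * norm (\<psi> z)"
  define I where "I = (LINT z|lborel. ?g z)"
  have g: "integrable lborel ?g" by (rule integrable_schwartz[OF schwartz_\<psi>])
  have "I \<ge> 0" unfolding I_def using B by (intro Bochner_Integration.integral_nonneg) auto
  have [measurable]: "\<psi> \<in> borel_measurable borel" by (rule schwartz_measurable[OF schwartz_\<psi>])
  have [measurable]: "(*v) (mat_pow A m) \<in> borel_measurable borel" for m
    by (intro borel_measurable_continuous_onI continuous_intros)
  have "norm (LINT y|lborel. mode i j (y - \<tau>) * dil m (x - y)) \<le> (D * I) * envelope (2 * L) (mat_pow A i *v (x - \<tau>))"
    if m: "1 \<le> m" "i < m + M" for i j m \<tau> x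
  proof -
    let ?e = "envelope (2 * L) (mat_pow A i *v (x - \<tau>))"
    have pt: "norm (mode i j (y - \<tau>) * dil m (x - y)) \<le> D * ?e * (2 ^ m * ?g (mat_pow A m *v (x - y)))" for y
    proof -
      have "norm (mode i j (y - \<tau>)) \<le> D * envelope (2 * L) (mat_pow A i *v (y - \<tau>))" by (rule norm_mode_le)
      also have "mat_pow A i *v (y - \<tau>) = mat_pow A i *v (x - \<tau>) - mat_pow A i *v (x - y)"
        by (simp flip: matrix_vector_mult_diff_distrib)
      also have "D * envelope (2 * L) (mat_pow A i *v (x - \<tau>) - mat_pow A i *v (x - y)) \<le> D * (?e * (1 + norm (mat_pow A i *v (x - y))) ^ ?N)"
        by (intro mult_left_mono envelope_subadditive D_nonneg)
      also have "\<dots> \<le> D * (?e * (1 + B * norm (mat_pow A m *v (x - y))) ^ ?N)"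
        using B(2)[OF m(2)] D_nonneg
        by (intro mult_left_mono power_mono add_left_mono) (auto simp: add_nonneg_nonneg)
      finally have "norm (mode i j (y - \<tau>)) \<le> D * (?e * (1 + B * norm (mat_pow A m *v (x - y))) ^ ?N)" .
      then have "norm (mode i j (y - \<tau>)) * norm (dil m (x - y))
          \<le> D * (?e * (1 + B * norm (mat_pow A m *v (x - y))) ^ ?N) * norm (dil m (x - y))"
        by (rule mult_right_mono) simp
      also have dil_eq: "norm (dil m (x - y)) = 2 ^ m * norm (\<psi> (mat_pow A m *v (x - y)))"
        using m(1) by (simp add: dil_pos norm_mult norm_power)
      also have "D * (?e * (1 + B * norm (mat_pow A m *v (x - y))) ^ ?N) * (2 ^ m * norm (\<psi> (mat_pow A m *v (x - y))))
          = D * ?e * (2 ^ m * ?g (mat_pow A m *v (x - y)))"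
        by (simp only: mult_ac)
      finally show ?thesis unfolding norm_mult dil_eq .
    qed
    have int: "integrable lborel (\<lambda>y. ?g (mat_pow A m *v (x - y)))"
    proof -
      have "integrable lborel (\<lambda>y. ?g (mat_pow A m *v y))"
        by (rule integrable_lborel_matrix[OF invertible_mat_pow g])
      then have "integrable (distr lborel borel (\<lambda>y. x - y)) (\<lambda>y. ?g (mat_pow A m *v y))"
        using lborel_reflect[of x] by simp
      then show ?thesis by (subst (asm) integrable_distr_eq) measurable
    qed
    have eq: "(LINT y|lborel. 2 ^ m * ?g (mat_pow A m *v (x - y))) = I"
    proof -
      have "(LINT y|lborel. ?g (mat_pow A m *v (x - y))) = (LINT y|lborel. ?g (mat_pow A m *v y))"
        by (subst (2) lborel_reflect[of x]) (subst integral_distr, measurable)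
      moreover have "2 ^ m * (LINT y|lborel. ?g (mat_pow A m *v y)) = I"
        using integral_lborel_matrix[OF invertible_mat_pow, of ?g m] g by (simp add: I_def det_mat_pow)
      ultimately show ?thesis by simp
    qed
    have "norm (LINT y|lborel. mode i j (y - \<tau>) * dil m (x - y)) \<le> (LINT y|lborel. D * ?e * (2 ^ m * ?g (mat_pow A m *v (x - y))))"
    proof (cases "integrable lborel (\<lambda>y. mode i j (y - \<tau>) * dil m (x - y))")
      case True
      then show ?thesis
        using pt int by (intro order.trans[OF integral_norm_bound Bochner_Integration.integral_mono]) auto
    next
      case False
      then have "(LINT y|lborel. mode i j (y - \<tau>) * dil m (x - y)) = 0" by (rule not_integrable_integral_eq)
      moreover have "0 \<le> (LINT y|lborel. D * ?e * (2 ^ m * ?g (mat_pow A m *v (x - y))))"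
        using D_nonneg envelope_pos[of "2 * L"] B
        by (intro Bochner_Integration.integral_nonneg mult_nonneg_nonneg) (auto simp: less_imp_le)
      ultimately show ?thesis by simp
    qed
    also have "\<dots> = D * ?e * I" using eq by simp
    finally show ?thesis by (simp add: mult_ac)
  qed
  then show ?thesis using D_nonneg \<open>I \<ge> 0\<close> by (intro exI[of _ "D * I"]) auto
qed

end

section \<open>Test functions\<close>

context test_functions
begin

definition admissible :: "nat set \<Rightarrow> (nat \<Rightarrow> nat) \<Rightarrow> (nat \<Rightarrow> nat) \<Rightarrow> bool" where
  "admissible J i j \<longleftrightarrow> finite J \<and> (\<forall>k\<in>J. i k \<le> j k \<and> 2 * M \<le> j k)"

text \<open>Finite sums of modes with coefficients \<open>a k\<close> and centres \<open>\<tau> k\<close>.\<close>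

definition test :: "nat set \<Rightarrow> (nat \<Rightarrow> nat) \<Rightarrow> (nat \<Rightarrow> nat) \<Rightarrow> (nat \<Rightarrow> real) \<Rightarrow> (nat \<Rightarrow> 'd rvec) \<Rightarrow> 'd rfun" where
  "test J i j a \<tau> x = (\<Sum>k\<in>J. of_real (a k) * mode (i k) (j k) (x - \<tau> k))"

definition dtest :: "nat \<Rightarrow> 'd \<Rightarrow> nat set \<Rightarrow> (nat \<Rightarrow> nat) \<Rightarrow> (nat \<Rightarrow> nat) \<Rightarrow> (nat \<Rightarrow> real) \<Rightarrow> (nat \<Rightarrow> 'd rvec) \<Rightarrow> 'd rfun" where
  "dtest n s J i j a \<tau> x = (\<Sum>k\<in>J. of_real (a k) * dmode n s (i k) (j k) (x - \<tau> k))"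

text \<open>A translation by \<open>\<tau> k\<close> is a modulation on the frequency side.\<close>

definition amplitude :: "(nat \<Rightarrow> nat) \<Rightarrow> (nat \<Rightarrow> nat) \<Rightarrow> (nat \<Rightarrow> real) \<Rightarrow> (nat \<Rightarrow> 'd rvec) \<Rightarrow> nat \<Rightarrow> 'd rvec \<Rightarrow> complex" where
  "amplitude i j a \<tau> k \<eta> = of_real (a k) * cis (- 2 * pi * (\<tau> k \<bullet> freq (i k) (j k) \<eta>))"

lemma amplitude_integral:
  "(LINT \<eta>|\<nu>. e \<eta> * amplitude i j a \<tau> k \<eta> * cis (2 * pi * (x \<bullet> freq (i k) (j k) \<eta>)))
    = of_real (a k) * (LINT \<eta>|\<nu>. e \<eta> * cis (2 * pi * ((x - \<tau> k) \<bullet> freq (i k) (j k) \<eta>)))"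
proof -
  have "e \<eta> * amplitude i j a \<tau> k \<eta> * cis (2 * pi * (x \<bullet> freq (i k) (j k) \<eta>))
      = of_real (a k) * (e \<eta> * cis (2 * pi * ((x - \<tau> k) \<bullet> freq (i k) (j k) \<eta>)))" for \<eta>
  proof -
    have "2 * pi * ((x - \<tau> k) \<bullet> freq (i k) (j k) \<eta>) = - 2 * pi * (\<tau> k \<bullet> freq (i k) (j k) \<eta>) + 2 * pi * (x \<bullet> freq (i k) (j k) \<eta>)"
      by (simp add: inner_diff_left right_diff_distrib)
    then have "cis (2 * pi * ((x - \<tau> k) \<bullet> freq (i k) (j k) \<eta>)) = cis (- 2 * pi * (\<tau> k \<bullet> freq (i k) (j k) \<eta>)) * cis (2 * pi * (x \<bullet> freq (i k) (j k) \<eta>))"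
      by (simp only: cis_mult)
    then show ?thesis unfolding amplitude_def by (simp only: mult_ac)
  qed
  then show ?thesis by (simp only: integral_mult_right_zero)
qed

lemma amplitude_in:
  assumes "waves \<nu> J (\<lambda>k. freq (i k) (j k)) R"
  shows "amplitude i j a \<tau> \<in> waves.amplitudes \<nu> J"
proof -
  interpret W: waves \<nu> J "\<lambda>k. freq (i k) (j k)" R by (rule assms)
  have [measurable]: "freq i j \<in> borel_measurable \<nu>" for i j by (rule freq_measurable)
  have "norm (amplitude i j a \<tau> k \<eta>) \<le> (\<Sum>k\<in>J. \<bar>a k\<bar>)" if "k \<in> J" for k \<eta>
    using that W.finite_modes member_le_sum[of k J "\<lambda>k. \<bar>a k\<bar>"] by (simp add: amplitude_def norm_mult)
  moreover have "amplitude i j a \<tau> k \<in> borel_measurable \<nu>" for k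
    unfolding amplitude_def[abs_def] by measurable
  ultimately show ?thesis unfolding W.amplitudes_def by blast
qed

lemma test_eq_wave:
  assumes "waves \<nu> J (\<lambda>k. freq (i k) (j k)) R"
  shows "test J i j a \<tau> = waves.wave \<nu> J (\<lambda>k. freq (i k) (j k)) (amplitude i j a \<tau>)"
proof -
  interpret W: waves \<nu> J "\<lambda>k. freq (i k) (j k)" R by (rule assms)
  show ?thesis
    using amplitude_integral[of "\<lambda>_. 1"] by (simp add: fun_eq_iff test_def mode_def W.wave_def)
qed

lemma test_measurable_bounded:
  assumes "finite J"
  shows "test J i j a \<tau> \<in> borel_measurable borel" "\<exists>B. \<forall>x. norm (test J i j a \<tau> x) \<le> B"
proof -
  obtain R where W: "waves \<nu> J (\<lambda>k. freq (i k) (j k)) R" using exists_waves[OF assms] by blast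
  interpret W: waves \<nu> J "\<lambda>k. freq (i k) (j k)" R by (rule W)
  show "test J i j a \<tau> \<in> borel_measurable borel" "\<exists>B. \<forall>x. norm (test J i j a \<tau> x) \<le> B"
    unfolding test_eq_wave[OF W] by (intro W.wave_measurable W.wave_bounded amplitude_in[OF W])+
qed

lemma convolve_test:
  assumes W: "waves \<nu> J (\<lambda>k. freq (i k) (j k)) R"
  shows "convolve (distribution_of (test J i j a \<tau>)) (dil m) =
    waves.wave \<nu> J (\<lambda>k. freq (i k) (j k)) (\<lambda>k \<eta>. fourier (dil m) (freq (i k) (j k) \<eta>) * amplitude i j a \<tau> k \<eta>)"
proof
  interpret W: waves \<nu> J "\<lambda>k. freq (i k) (j k)" R by (rule W)
  fix x
  show "convolve (distribution_of (test J i j a \<tau>)) (dil m) x =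
     W.wave (\<lambda>k \<eta>. fourier (dil m) (freq (i k) (j k) \<eta>) * amplitude i j a \<tau> k \<eta>) x"
    unfolding convolve_distribution_of[OF schwartz_dil] test_eq_wave[OF W]
    by (rule W.convolution_wave[OF amplitude_in[OF W] integrable_schwartz'[OF schwartz_dil]])
qed

lemma convolve_test_measurable:
  assumes "finite J"
  shows "convolve (distribution_of (test J i j a \<tau>)) (dil m) \<in> borel_measurable borel"
proof -
  obtain R where W: "waves \<nu> J (\<lambda>k. freq (i k) (j k)) R" using exists_waves[OF assms] by blast
  interpret W: waves \<nu> J "\<lambda>k. freq (i k) (j k)" R by (rule W)
  show ?thesis unfolding convolve_test[OF W]
    by (intro W.wave_measurable W.amplitudes_fourier amplitude_in[OF W] integrable_schwartz' schwartz_dil)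
qed

text \<open>Blocks that miss the frequencies of a mode do not see it, the others keep its envelope.\<close>

lemma convolve_test_bound:
  "\<exists>C\<ge>0. \<forall>J i j a \<tau> m x. admissible J i j \<longrightarrow>
     norm (convolve (distribution_of (test J i j a \<tau>)) (dil m) x) \<le>
     (\<Sum>k\<in>{k \<in> J. near m (j k)}. \<bar>a k\<bar> * (C * envelope (2 * L) (mat_pow A (i k) *v (x - \<tau> k))))"
proof -
  obtain C where C: "C \<ge> 0" "\<And>i j m \<tau> x. 1 \<le> m \<Longrightarrow> i < m + M \<Longrightarrow>
     norm (LINT y|lborel. mode i j (y - \<tau>) * dil m (x - y)) \<le> C * envelope (2 * L) (mat_pow A i *v (x - \<tau>))"
    using convolution_mode_bound by blast
  have "norm (convolve (distribution_of (test J i j a \<tau>)) (dil m) x) \<le>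
     (\<Sum>k\<in>{k \<in> J. near m (j k)}. \<bar>a k\<bar> * (C * envelope (2 * L) (mat_pow A (i k) *v (x - \<tau> k))))"
    if adm: "admissible J i j" for J i j a \<tau> m x
  proof -
    have J: "finite J" using adm by (simp add: admissible_def)
    obtain R where W: "waves \<nu> J (\<lambda>k. freq (i k) (j k)) R" using exists_waves[OF J] by blast
    interpret W: waves \<nu> J "\<lambda>k. freq (i k) (j k)" R by (rule W)
    define T where "T k = (LINT \<eta>|\<nu>. fourier (dil m) (freq (i k) (j k) \<eta>) * amplitude i j a \<tau> k \<eta> * cis (2 * pi * (x \<bullet> freq (i k) (j k) \<eta>)))" for k
    have far: "T k = 0" if "k \<in> J" "\<not> near m (j k)" for k
    proof -
      have "T k = (LINT \<eta>|\<nu>. 0)"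
        unfolding T_def using that adm fourier_dil_eq_0[of "i k" "j k" _ m]
        by (intro Bochner_Integration.integral_cong refl) (simp add: admissible_def)
      then show ?thesis by simp
    qed
    have close: "norm (T k) \<le> \<bar>a k\<bar> * (C * envelope (2 * L) (mat_pow A (i k) *v (x - \<tau> k)))" if "k \<in> J" "near m (j k)" for k
    proof -
      obtain R1 where W1: "waves \<nu> {k} (\<lambda>k. freq (i k) (j k)) R1" using exists_waves[of "{k}"] by blast
      interpret W1: waves \<nu> "{k}" "\<lambda>k. freq (i k) (j k)" R1 by (rule W1)
      have "T k = convolve (distribution_of (test {k} i j a \<tau>)) (dil m) x"
        unfolding convolve_test[OF W1] W1.wave_def T_def by simp
      also have "\<dots> = (LINT y|lborel. of_real (a k) * (mode (i k) (j k) (y - \<tau> k) * dil m (x - y)))"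
        unfolding convolve_distribution_of[OF schwartz_dil] test_def by (simp add: mult.assoc)
      also have "\<dots> = of_real (a k) * (LINT y|lborel. mode (i k) (j k) (y - \<tau> k) * dil m (x - y))"
        by (rule integral_mult_right_zero)
      finally have "norm (T k) = \<bar>a k\<bar> * norm (LINT y|lborel. mode (i k) (j k) (y - \<tau> k) * dil m (x - y))"
        by (simp add: norm_mult)
      moreover have "1 \<le> m" "i k < m + M"
        using that adm M by (auto simp: admissible_def near_def)
      ultimately show ?thesis using C(2)[of m "i k" "j k" "\<tau> k" x] by (simp add: mult_left_mono)
    qed
    have "convolve (distribution_of (test J i j a \<tau>)) (dil m) x = (\<Sum>k\<in>J. T k)"
      unfolding convolve_test[OF W] W.wave_def T_def by simp
    also have "\<dots> = (\<Sum>k\<in>{k \<in> J. near m (j k)}. T k)"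
      using J far by (intro sum.mono_neutral_right) auto
    finally show ?thesis using close by (auto intro!: order.trans[OF norm_sum sum_mono])
  qed
  then show ?thesis using C(1) by blast
qed

lemma convolve_test_eq_0:
  assumes "admissible J i j" "\<And>k. k \<in> J \<Longrightarrow> \<not> near m (j k)"
  shows "convolve (distribution_of (test J i j a \<tau>)) (dil m) = (\<lambda>_. 0)"
proof
  fix x
  obtain C where "norm (convolve (distribution_of (test J i j a \<tau>)) (dil m) x) \<le>
     (\<Sum>k\<in>{k \<in> J. near m (j k)}. \<bar>a k\<bar> * (C * envelope (2 * L) (mat_pow A (i k) *v (x - \<tau> k))))"
    using convolve_test_bound assms(1) by blast
  moreover have "{k \<in> J. near m (j k)} = {}" using assms(2) by blast
  ultimately show "convolve (distribution_of (test J i j a \<tau>)) (dil m) x = 0" by (simp only: sum.empty norm_le_zero_iff)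
qed

text \<open>Only finitely many dyadic blocks of a test function are non-zero, and they add up to the test
  function. The embedding thus bounds its derivative by its Besov norm.\<close>

lemma embedding_test:
  assumes emb: "besov_embeds_sobolev A \<psi> \<psi>0 \<alpha> p r n q" and "0 < q"
  shows "\<exists>C\<ge>0. \<forall>J i j a \<tau> B. admissible J i j \<longrightarrow> B \<ge> 0 \<longrightarrow>
     besov_norm A \<psi> \<psi>0 \<alpha> p r (distribution_of (test J i j a \<tau>)) \<le> ennreal B \<longrightarrow>
     Lp_norm q (dtest n s J i j a \<tau>) \<le> ennreal (C * B)"
proof -
  let ?\<beta> = "\<lambda>l. if l = s then n else 0"
  have "sum ?\<beta> UNIV \<le> n" by simp
  then obtain C where C: "\<And>f. f \<in> besov_space A \<psi> \<psi>0 \<alpha> p r \<Longrightarrow> \<exists>g.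
          Lq_unconditional_sum q (\<lambda>m. multi_deriv ?\<beta> (convolve f (dil m))) g \<and>
          Lp_norm q g \<le> ennreal C * besov_norm A \<psi> \<psi>0 \<alpha> p r f"
    using emb unfolding besov_embeds_sobolev_def by meson
  have "Lp_norm q (dtest n s J i j a \<tau>) \<le> ennreal (max C 0 * B)"
    if adm: "admissible J i j" and B: "B \<ge> 0" "besov_norm A \<psi> \<psi>0 \<alpha> p r (distribution_of (test J i j a \<tau>)) \<le> ennreal B"
    for J i j a \<tau> B
  proof -
    let ?f = "distribution_of (test J i j a \<tau>)"
    let ?c = "amplitude i j a \<tau>"
    let ?\<omega> = "\<lambda>k. freq (i k) (j k)"
    have J: "finite J" and ij: "\<And>k. k \<in> J \<Longrightarrow> i k \<le> j k \<and> 2 * M \<le> j k" using adm by (auto simp: admissible_def)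
    obtain R where W: "waves \<nu> J ?\<omega> R" using exists_waves[OF J] by blast
    interpret W: waves \<nu> J ?\<omega> R by (rule W)
    let ?e = "\<lambda>m k \<eta>. (2 * pi * \<i> * complex_of_real (?\<omega> k \<eta> $ s)) ^ n * (fourier (dil m) (?\<omega> k \<eta>) * ?c k \<eta>)"
    have "?f \<in> tempered_distributions"
      using test_measurable_bounded[OF J] distribution_of_tempered by blast
    then have "?f \<in> besov_space A \<psi> \<psi>0 \<alpha> p r"
      using B(2) le_less_trans by (fastforce simp: besov_space_def)
    then obtain g where g: "Lq_unconditional_sum q (\<lambda>m. multi_deriv ?\<beta> (convolve ?f (dil m))) g"
        "Lp_norm q g \<le> ennreal C * besov_norm A \<psi> \<psi>0 \<alpha> p r ?f"
      using C by blast
    have amp: "(\<lambda>k \<eta>. fourier (dil m) (?\<omega> k \<eta>) * ?c k \<eta>) \<in> W.amplitudes" for m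
      by (intro W.amplitudes_fourier amplitude_in[OF W] integrable_schwartz' schwartz_dil)
    have h: "multi_deriv ?\<beta> (convolve ?f (dil m)) = W.wave (?e m)" for m
      unfolding multi_deriv_single convolve_test[OF W] by (rule W.iterated_partial_deriv_wave[OF amp])
    define S where "S = (\<Union>k\<in>J. {m. near m (j k)})"
    have S: "finite S" unfolding S_def using J finite_near by blast
    have h0: "multi_deriv ?\<beta> (convolve ?f (dil m)) = (\<lambda>_. 0)" if "m \<notin> S" for m
    proof -
      have "(LINT \<eta>|\<nu>. ?e m k \<eta> * cis (2 * pi * (x \<bullet> ?\<omega> k \<eta>))) = 0" if k: "k \<in> J" for k x
      proof -
        have "fourier (dil m) (?\<omega> k \<eta>) = 0" if "\<eta> \<in> space \<nu>" for \<eta>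
          using fourier_dil_eq_0[of "i k" "j k" \<eta> m] that ij[OF k] \<open>m \<notin> S\<close> k by (auto simp: S_def)
        then have "(LINT \<eta>|\<nu>. ?e m k \<eta> * cis (2 * pi * (x \<bullet> ?\<omega> k \<eta>))) = (LINT \<eta>|\<nu>. 0)"
          by (intro Bochner_Integration.integral_cong refl) simp
        then show ?thesis by simp
      qed
      then show ?thesis unfolding h W.wave_def by simp
    qed
    have "(\<Sum>m\<in>S. W.wave (?e m) x) = dtest n s J i j a \<tau> x" for x
    proof -
      have "(\<Sum>m\<in>S. W.wave (?e m) x) = (\<Sum>k\<in>J. \<Sum>m\<in>S. LINT \<eta>|\<nu>. ?e m k \<eta> * cis (2 * pi * (x \<bullet> ?\<omega> k \<eta>)))"
        unfolding W.wave_def by (rule sum.swap)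
      also have "\<dots> = (\<Sum>k\<in>J. of_real (a k) * dmode n s (i k) (j k) (x - \<tau> k))"
      proof (intro sum.cong refl)
        fix k assume k: "k \<in> J"
        have "(\<Sum>m\<in>S. LINT \<eta>|\<nu>. ?e m k \<eta> * cis (2 * pi * (x \<bullet> ?\<omega> k \<eta>)))
            = (LINT \<eta>|\<nu>. (\<Sum>m\<in>S. ?e m k \<eta> * cis (2 * pi * (x \<bullet> ?\<omega> k \<eta>))))"
          by (rule Bochner_Integration.integral_sum[symmetric]) (rule W.wave_integrable[OF W.amplitudes_derivative[OF amp] k])
        also have "\<dots> = (LINT \<eta>|\<nu>. (2 * pi * \<i> * complex_of_real (?\<omega> k \<eta> $ s)) ^ n * ?c k \<eta> * cis (2 * pi * (x \<bullet> ?\<omega> k \<eta>)))"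
        proof (intro Bochner_Integration.integral_cong refl)
          fix \<eta> assume \<eta>: "\<eta> \<in> space \<nu>"
          have "(\<Sum>m\<in>S. fourier (dil m) (?\<omega> k \<eta>)) = 1"
            using ij[OF k] \<eta> S k by (intro fourier_dil_sum) (auto simp: S_def)
          moreover have "(\<Sum>m\<in>S. ?e m k \<eta> * cis (2 * pi * (x \<bullet> ?\<omega> k \<eta>)))
             = (2 * pi * \<i> * complex_of_real (?\<omega> k \<eta> $ s)) ^ n * (\<Sum>m\<in>S. fourier (dil m) (?\<omega> k \<eta>)) * ?c k \<eta> * cis (2 * pi * (x \<bullet> ?\<omega> k \<eta>))"
            unfolding sum_distrib_left sum_distrib_right by (simp only: mult.assoc)
          ultimately show "(\<Sum>m\<in>S. ?e m k \<eta> * cis (2 * pi * (x \<bullet> ?\<omega> k \<eta>)))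
             = (2 * pi * \<i> * complex_of_real (?\<omega> k \<eta> $ s)) ^ n * ?c k \<eta> * cis (2 * pi * (x \<bullet> ?\<omega> k \<eta>))"
            by simp
        qed
        also have "\<dots> = of_real (a k) * dmode n s (i k) (j k) (x - \<tau> k)"
          unfolding dmode_def by (rule amplitude_integral)
        finally show "(\<Sum>m\<in>S. LINT \<eta>|\<nu>. ?e m k \<eta> * cis (2 * pi * (x \<bullet> ?\<omega> k \<eta>))) = of_real (a k) * dmode n s (i k) (j k) (x - \<tau> k)" .
      qed
      finally show ?thesis by (simp add: dtest_def)
    qed
    then have "Lp_norm q g = Lp_norm q (dtest n s J i j a \<tau>)"
      using Lq_unconditional_sum_finite[OF \<open>0 < q\<close> g(1) S h0] by (simp add: h)
    then have "Lp_norm q (dtest n s J i j a \<tau>) \<le> ennreal C * besov_norm A \<psi> \<psi>0 \<alpha> p r ?f"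
      using g(2) by simp
    also have "\<dots> \<le> ennreal (max C 0) * ennreal B"
      by (intro mult_mono B(2) ennreal_leI) auto
    finally show ?thesis using B(1) by (simp add: ennreal_mult)
  qed
  then show ?thesis by (intro exI[of _ "max C 0"]) auto
qed

lemma dmode_measurable: "dmode n s i j \<in> borel_measurable borel"
proof -
  obtain R where W: "waves \<nu> {0} (\<lambda>k::nat. freq i j) R" using exists_waves[of "{0}" "\<lambda>_. i" "\<lambda>_. j"] by auto
  interpret W: waves \<nu> "{0}" "\<lambda>k::nat. freq i j" R by (rule W)
  have "(\<lambda>k \<eta>. 1) \<in> W.amplitudes" unfolding W.amplitudes_def by (auto intro!: exI[of _ 1])
  from W.wave_measurable[OF W.amplitudes_derivative[OF this, of s n]]
  show ?thesis unfolding W.wave_def dmode_def[abs_def] by simp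
qed

text \<open>All frequencies have large positive coordinates, so the plane waves reinforce each other wherever
  their phases are close. The phase \<open>t\<close> serves to remove a modulation that they have in common.\<close>

lemma Re_dmode_ge:
  assumes "i \<le> j" "\<And>\<eta>. \<eta> \<in> space \<nu> \<Longrightarrow> \<bar>t + x \<bullet> freq i j \<eta>\<bar> \<le> 1/6"
  shows "Re (cis (2 * pi * t) * dmode n s i j x / \<i> ^ n) \<ge> growth s j ^ n / 2"
proof -
  obtain R where W: "waves \<nu> {0} (\<lambda>k::nat. freq i j) R" using exists_waves[of "{0}" "\<lambda>_. i" "\<lambda>_. j"] by auto
  interpret W: waves \<nu> "{0}" "\<lambda>k::nat. freq i j" R by (rule W)
  let ?f = "\<lambda>\<eta>. (2 * pi * \<i> * complex_of_real (freq i j \<eta> $ s)) ^ n * cis (2 * pi * (x \<bullet> freq i j \<eta>))"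
  have "(\<lambda>k \<eta>. 1) \<in> W.amplitudes" unfolding W.amplitudes_def by (auto intro!: exI[of _ 1])
  from W.wave_integrable[OF W.amplitudes_derivative[OF this, of s n], of 0 x]
  have int: "integrable \<nu> ?f" by simp
  let ?z = "cis (2 * pi * t) / \<i> ^ n"
  have int': "integrable \<nu> (\<lambda>\<eta>. ?z * ?f \<eta>)" using int by simp
  have "growth s j ^ n / 2 = (LINT \<eta>|\<nu>. growth s j ^ n / 2)" by (simp add: prob_space)
  also have "\<dots> \<le> (LINT \<eta>|\<nu>. Re (?z * ?f \<eta>))"
  proof (rule Bochner_Integration.integral_mono)
    show "integrable \<nu> (\<lambda>\<eta>. Re (?z * ?f \<eta>))" using int' by (rule integrable_Re)
    fix \<eta> assume \<eta>: "\<eta> \<in> space \<nu>"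
    let ?w = "freq i j \<eta> $ s"
    have "?z * ?f \<eta> = complex_of_real ((2 * pi * ?w) ^ n) * cis (2 * pi * (t + x \<bullet> freq i j \<eta>))"
      by (simp add: power_mult_distrib distrib_left flip: cis_mult)
    then have Re: "Re (?z * ?f \<eta>) = (2 * pi * ?w) ^ n * cos (2 * pi * (t + x \<bullet> freq i j \<eta>))" by simp
    have "growth s j \<le> 2 * pi * ?w"
    proof -
      have "growth s j \<le> 2 * ?w" using freq_ge[OF assms(1) \<eta>, of s] by simp
      also have "\<dots> \<le> pi * (2 * ?w)"
        using pi_ge_two freq_ge[OF assms(1) \<eta>, of s] growth_nonneg[of s j] mult_right_mono[of 1 pi "2 * ?w"] by simp
      finally show ?thesis by (simp add: mult_ac)
    qed
    moreover have "1/2 \<le> cos (2 * pi * (t + x \<bullet> freq i j \<eta>))"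
    proof -
      have "\<bar>2 * pi * (t + x \<bullet> freq i j \<eta>)\<bar> \<le> 2 * pi * (1/6)"
        unfolding abs_mult using assms(2)[OF \<eta>] by (intro mult_mono) auto
      then have "cos (pi / 3) \<le> cos \<bar>2 * pi * (t + x \<bullet> freq i j \<eta>)\<bar>"
        by (intro cos_monotone_0_pi_le) auto
      then show ?thesis by (simp add: cos_60)
    qed
    ultimately have "growth s j ^ n * (1/2) \<le> (2 * pi * ?w) ^ n * cos (2 * pi * (t + x \<bullet> freq i j \<eta>))"
      using growth_nonneg[of s j] by (intro mult_mono power_mono) auto
    then show "growth s j ^ n / 2 \<le> Re (?z * ?f \<eta>)" using Re by simp
  qed simp
  also have "\<dots> = Re (?z * (LINT \<eta>|\<nu>. ?f \<eta>))"
    using integral_Re[OF int'] integral_mult_right_zero[of \<nu> ?z ?f] by simp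
  finally show ?thesis by (simp add: dmode_def)
qed

end

section \<open>Besov norms of test functions and the growth of derivatives\<close>

lemma powr_bound_imp_le:
  assumes "\<And>N::nat. N \<ge> 1 \<Longrightarrow> real N powr a \<le> C * real N powr b"
  shows "a \<le> b"
proof (rule ccontr)
  assume "\<not> a \<le> b"
  then have "filterlim (\<lambda>N. real N powr (a - b)) at_top sequentially"
    by (intro real_powr_at_top[THEN filterlim_compose] filterlim_real_sequentially) simp
  then have "eventually (\<lambda>N. real N powr (a - b) > C) sequentially"
    by (simp add: filterlim_at_top_dense)
  then have "eventually (\<lambda>N. real N powr (a - b) > C \<and> N \<ge> 1) sequentially"
    by (intro eventually_conj eventually_ge_at_top)
  then obtain N where N: "real N powr (a - b) > C" "N \<ge> 1"
    using eventually_happens[of _ sequentially] by auto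
  then have "C * real N powr b < real N powr (a - b) * real N powr b" by simp
  also have "\<dots> = real N powr a" by (simp flip: powr_add)
  finally show False using assms[OF N(2)] by simp
qed

lemma ennreal_weighted_le:
  assumes "x \<le> ennreal v" "w * v \<le> B" "w \<ge> 0"
  shows "ennreal w * x \<le> ennreal B"
proof -
  have "ennreal w * x \<le> ennreal w * ennreal v" using assms by (intro mult_left_mono) auto
  also have "\<dots> = ennreal (w * v)" using assms(3) by (simp add: ennreal_mult')
  also have "\<dots> \<le> ennreal B" using assms(2) by (rule ennreal_leI)
  finally show ?thesis .
qed

lemma power_bound_imp_le:
  assumes "x > 0" "y > 0" "\<And>j. j \<ge> m \<Longrightarrow> x ^ j \<le> C * y ^ j"
  shows "x \<le> (y::real)"
proof (rule ccontr)
  assume "\<not> x \<le> y"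
  then have "1 < x / y" using assms by simp
  then obtain k where k: "C < (x / y) ^ k" using real_arch_pow by blast
  also have "\<dots> \<le> (x / y) ^ (k + m)" using \<open>1 < x / y\<close> by (intro power_increasing) auto
  finally have "C * y ^ (k + m) < x ^ (k + m)" using assms(2) by (simp add: power_divide field_simps)
  then show False using assms(3)[of "k + m"] by simp
qed

lemma nn_integral_le_Lp_norm:
  assumes "Q > 0" "B \<ge> 0" "Lp_norm (ennreal Q) g \<le> ennreal B"
  shows "(\<integral>\<^sup>+x. ennreal (norm (g x) powr Q) \<partial>lborel) \<le> ennreal (B powr Q)"
proof (cases "(\<integral>\<^sup>+x. ennreal (norm (g x) powr Q) \<partial>lborel)")
  case (real v)
  then have "v powr (1 / Q) \<le> B"
    using assms by (simp add: Lp_norm_ennreal ennreal_powr_ennreal)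
  then have "(v powr (1 / Q)) powr Q \<le> B powr Q"
    using assms by (intro powr_mono2) auto
  then show ?thesis using real assms by (simp add: powr_powr ennreal_leI)
next
  case top
  then show ?thesis using assms by (simp add: Lp_norm_ennreal ennreal_powr_def top_unique)
qed

lemma emeasure_cube:
  assumes "\<rho> > 0"
  shows "\<exists>m>0. emeasure lborel (cube \<rho> :: 'd::finite rvec set) = ennreal m"
proof -
  let ?u = "\<chi> l. \<rho> :: 'd rvec"
  have eq: "cube \<rho> = cbox (- ?u) ?u"
    by (auto simp: cube_def mem_box_cart abs_le_iff minus_le_iff)
  have B: "?u \<bullet> b = \<rho>" if "b \<in> Basis" for b
    using that by (auto simp: Basis_vec_def inner_axis)
  have "emeasure lborel (cube \<rho> :: 'd rvec set) = ennreal (\<Prod>b\<in>(Basis :: 'd rvec set). (?u - (- ?u)) \<bullet> b)"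
    unfolding eq by (rule emeasure_lborel_cbox) (use B assms in auto)
  moreover have "(?u - (- ?u)) \<bullet> b = \<rho> + \<rho>" if "b \<in> Basis" for b
    by (simp only: diff_minus_eq_add inner_add_left B[OF that])
  then have "(\<Prod>b\<in>(Basis :: 'd rvec set). (?u - (- ?u)) \<bullet> b) > 0"
    using assms by (intro prod_pos) simp
  ultimately show ?thesis by blast
qed

text \<open>The condition on \<open>L\<close> makes the \<open>p\<close>-th power of the envelope integrable.\<close>

locale sobolev_embedding = test_functions A \<psi> \<psi>0 \<nu> M L \<delta> D
  for A :: "(real, 'd::{finite,wellorder}) sqmat" and \<psi> \<psi>0 :: "'d rfun" and \<nu> :: "'d rvec measure"
    and M L :: nat and \<delta> D :: real +
  fixes p q r :: ennreal and \<alpha> :: real and n :: nat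
  assumes exponents_pos: "0 < p" "0 < q" "0 < r"
    and L_large: "\<And>P. p = ennreal P \<Longrightarrow> 0 < P \<Longrightarrow> real L * P \<ge> 2"
    and embedding: "besov_embeds_sobolev A \<psi> \<psi>0 \<alpha> p r n q"
begin

abbreviation test_norm where
  "test_norm J i j a \<tau> \<equiv> besov_norm A \<psi> \<psi>0 \<alpha> p r (distribution_of (test J i j a \<tau>))"

definition bump :: "real \<Rightarrow> nat \<Rightarrow> 'd rvec \<Rightarrow> 'd rvec set" where
  "bump \<rho> i \<tau> = {x. mat_pow A i *v (x - \<tau>) \<in> cube \<rho>}"

lemma bump_borel [measurable]: "bump \<rho> i \<tau> \<in> sets borel"
proof -
  have [measurable]: "(*v) (mat_pow A i) \<in> borel_measurable borel"
    by (intro borel_measurable_continuous_onI continuous_intros)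
  have "(\<lambda>x. mat_pow A i *v (x - \<tau>)) \<in> borel_measurable borel" by measurable
  from measurable_sets[OF this cube_borel] show ?thesis by (simp add: bump_def vimage_def)
qed

lemma emeasure_bump:
  assumes "emeasure lborel (cube \<rho> :: 'd rvec set) = ennreal m" "m > 0"
  shows "emeasure lborel (bump \<rho> i \<tau>) = ennreal (m / 2 ^ i)"
proof -
  let ?B = "mat_pow A i"
  have [measurable]: "(*v) ?B \<in> borel_measurable borel"
    by (intro borel_measurable_continuous_onI continuous_intros)
  have "emeasure lborel (bump \<rho> i \<tau>) = (\<integral>\<^sup>+x. indicator (cube \<rho>) (?B *v (x - \<tau>)) \<partial>lborel)"
  proof -
    have "indicator (cube \<rho>) (?B *v (x - \<tau>)) = (indicator (bump \<rho> i \<tau>) x :: ennreal)" for x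
      by (simp add: bump_def indicator_def)
    then show ?thesis by simp
  qed
  also have "\<dots> = (\<integral>\<^sup>+x. indicator (cube \<rho>) (?B *v x) \<partial>lborel)"
    by (rule nn_integral_lborel_shift[of "\<lambda>x. indicator (cube \<rho>) (?B *v x)"]) measurable
  finally have "ennreal (2 ^ i) * emeasure lborel (bump \<rho> i \<tau>) = ennreal m"
    using nn_integral_lborel_matrix[OF invertible_mat_pow, of "indicator (cube \<rho>)" i] assms
    by (simp add: det_mat_pow)
  also have "\<dots> = ennreal (2 ^ i) * ennreal (m / 2 ^ i)"
    using assms(2) by (simp flip: ennreal_mult)
  finally show ?thesis by (subst (asm) ennreal_mult_cancel_left) auto
qed

text \<open>A mode is large on its bump. At all scales the bumps stay within distance one of their centres in
  each coordinate, so translates by two are disjoint.\<close>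

lemma exists_bump_radius:
  "\<exists>\<rho>>0. (\<forall>y\<in>cube \<rho>. \<forall>\<eta>\<in>cube \<delta>. \<bar>y \<bullet> (\<eta> :: 'd rvec)\<bar> \<le> 1/6) \<and> (\<forall>i \<tau> x l. x \<in> bump \<rho> i \<tau> \<longrightarrow> \<bar>x $ l - \<tau> $ l\<bar> < 1)"
proof -
  obtain C where C: "C \<ge> 1" "\<And>k x i c. (\<forall>l. \<bar>x $ l\<bar> \<le> c) \<Longrightarrow> \<bar>(mat_pow iA k *v x) $ i\<bar> \<le> C * c"
    using pow_iA_bounded by blast
  \<comment> \<open>The first bound controls the phases, the second one the diameter.\<close>
  define \<rho> where "\<rho> = min (1 / (6 * (real CARD('d) * \<delta>))) (1 / (2 * C))"
  have \<rho>: "\<rho> > 0" "\<rho> \<le> 1 / (6 * (real CARD('d) * \<delta>))" "C * \<rho> \<le> 1 / 2"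
    using \<delta> C mult_left_mono[of \<rho> "1 / (2 * C)" C] by (auto simp: \<rho>_def)
  have 1: "\<bar>y \<bullet> \<eta>\<bar> \<le> 1/6" if "y \<in> cube \<rho>" "\<eta> \<in> cube \<delta>" for y \<eta> :: "'d rvec"
  proof -
    have "\<bar>y \<bullet> \<eta>\<bar> \<le> (\<Sum>l\<in>(UNIV :: 'd set). \<rho> * \<delta>)"
      unfolding inner_vec_def using that \<delta> \<rho>
      by (intro order.trans[OF sum_abs] sum_mono) (auto simp: abs_mult cube_def intro!: mult_mono)
    also have "\<dots> = \<rho> * (real CARD('d) * \<delta>)" by simp
    also have "\<dots> \<le> 1 / (6 * (real CARD('d) * \<delta>)) * (real CARD('d) * \<delta>)"
      using \<rho> \<delta> by (intro mult_right_mono) auto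
    also have "\<dots> = 1/6" using \<delta> by simp
    finally show ?thesis .
  qed
  have 2: "\<bar>x $ l - \<tau> $ l\<bar> < 1" if "x \<in> bump \<rho> i \<tau>" for i \<tau> x l
  proof -
    have "x - \<tau> = mat_pow iA i *v (mat_pow A i *v (x - \<tau>))"
      by (simp add: matrix_vector_mul_assoc pow_iA_pow_A)
    then have "\<bar>(x - \<tau>) $ l\<bar> \<le> C * \<rho>"
      using C(2)[of "mat_pow A i *v (x - \<tau>)" \<rho> i l] that by (simp add: bump_def cube_def)
    then show ?thesis using \<rho>(3) by simp
  qed
  show ?thesis by (intro exI[of _ \<rho>] conjI ballI allI impI \<rho>(1)) (rule 1, assumption+, rule 2)
qed

lemma norm_dmode_ge:
  assumes "i \<le> j" "\<And>y \<eta>. y \<in> cube \<rho> \<Longrightarrow> \<eta> \<in> cube \<delta> \<Longrightarrow> \<bar>y \<bullet> (\<eta> :: 'd rvec)\<bar> \<le> 1/6" "x \<in> bump \<rho> i \<tau>"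
  shows "growth s j ^ n / 2 \<le> norm (dmode n s i j (x - \<tau>))"
proof -
  let ?t = "- ((mat_pow A j *v (x - \<tau>)) \<bullet> ones)"
  have "growth s j ^ n / 2 \<le> Re (cis (2 * pi * ?t) * dmode n s i j (x - \<tau>) / \<i> ^ n)"
    using assms by (intro Re_dmode_ge) (auto simp: inner_freq space_\<nu> bump_def)
  also have "\<dots> \<le> norm (cis (2 * pi * ?t) * dmode n s i j (x - \<tau>) / \<i> ^ n)"
    by (rule complex_Re_le_cmod)
  also have "\<dots> = norm (dmode n s i j (x - \<tau>))" by (simp add: norm_mult norm_divide norm_power)
  finally show ?thesis .
qed

lemma card_near: "card {m. near m j} \<le> 2 * M"
proof -
  have "card {m. near m j} \<le> card {j - M..<j + M}"
    by (intro card_mono) (auto simp: near_def)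
  then show ?thesis by simp
qed

lemma weight_le:
  assumes "near m j"
  shows "\<bar>det A\<bar> powr (real m * \<alpha>) \<le> 2 powr (real j * \<alpha> + real M * \<bar>\<alpha>\<bar>)"
proof -
  have "\<bar>real m - real j\<bar> \<le> real M" using assms by (auto simp: near_def)
  then have "\<bar>(real m - real j) * \<alpha>\<bar> \<le> real M * \<bar>\<alpha>\<bar>"
    unfolding abs_mult by (intro mult_right_mono) auto
  then have "(real m - real j) * \<alpha> \<le> real M * \<bar>\<alpha>\<bar>" by linarith
  then show ?thesis by (simp add: det_A algebra_simps)
qed

text \<open>The bound on the coefficients \<open>a k\<close> normalises each mode to unit size in the Besov space.\<close>

definition scales_constant :: "real \<Rightarrow> bool" where
  "scales_constant C \<longleftrightarrow> C \<ge> 0 \<and> (\<forall>J i j a \<tau> N. admissible J i j \<longrightarrow> N \<ge> 1 \<longrightarrow> card J \<le> N \<longrightarrow>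
     (\<forall>k\<in>J. \<forall>l\<in>J. k \<noteq> l \<longrightarrow> j k + 2 * M \<le> j l \<or> j l + 2 * M \<le> j k) \<longrightarrow>
     (\<forall>k\<in>J. \<bar>a k\<bar> \<le> 2 powr (real (i k) * recip p - real (j k) * \<alpha>)) \<longrightarrow>
     test_norm J i j a \<tau> \<le> ennreal (C * real N powr recip r))"

lemma scales_constant_nonneg: "scales_constant C \<Longrightarrow> C \<ge> 0"
  by (simp add: scales_constant_def)

lemma scales_constantD:
  "scales_constant C \<Longrightarrow> admissible J i j \<Longrightarrow> N \<ge> 1 \<Longrightarrow> card J \<le> N \<Longrightarrow>
     (\<forall>k\<in>J. \<forall>l\<in>J. k \<noteq> l \<longrightarrow> j k + 2 * M \<le> j l \<or> j l + 2 * M \<le> j k) \<Longrightarrow>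
     (\<forall>k\<in>J. \<bar>a k\<bar> \<le> 2 powr (real (i k) * recip p - real (j k) * \<alpha>)) \<Longrightarrow>
     test_norm J i j a \<tau> \<le> ennreal (C * real N powr recip r)"
  unfolding scales_constant_def by blast

text \<open>Every dyadic block meets at most one of the scales, and every scale meets at most \<open>2 * M\<close> blocks. So
  the sequence of weighted block norms is, up to bounded multiplicity, a sequence of at most \<open>N\<close>
  bounded terms.\<close>

lemma exists_scales_constant: "\<exists>C. scales_constant C"
proof -
  obtain C where C: "C \<ge> 0" "\<And>J i j a \<tau> m x. admissible J i j \<Longrightarrow>
     norm (convolve (distribution_of (test J i j a \<tau>)) (dil m) x) \<le>
     (\<Sum>k\<in>{k \<in> J. near m (j k)}. \<bar>a k\<bar> * (C * envelope (2 * L) (mat_pow A (i k) *v (x - \<tau> k))))"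
    using convolve_test_bound by blast
  obtain W where W: "W \<ge> 0" "\<And>g C \<sigma> N s B. invertible B \<Longrightarrow> g \<in> borel_measurable borel \<Longrightarrow> C \<ge> 0 \<Longrightarrow> N \<ge> 1 \<Longrightarrow>
     (\<forall>k<N. \<forall>l<N. k \<noteq> l \<longrightarrow> \<bar>\<sigma> k $ s - \<sigma> l $ s\<bar> \<ge> 2 * real N) \<Longrightarrow>
     (\<forall>x. norm (g x) \<le> C * (\<Sum>k<N. envelope (2 * L) (B *v x - \<sigma> k))) \<Longrightarrow>
     Lp_norm p g \<le> ennreal (C * W * real N powr recip p * \<bar>det (B :: (real, 'd) sqmat)\<bar> powr - recip p)"
    using Lp_norm_separated_sum_bound[OF exponents_pos(1) L_large L, where 'd='d] by blast
  define B where "B = 2 powr (real M * \<bar>\<alpha>\<bar>) * (C * W)"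
  have "B \<ge> 0" using C(1) W(1) by (simp add: B_def)
  have "test_norm J i j a \<tau> \<le> ennreal (B * real (2 * M) powr recip r * real N powr recip r)"
    if adm: "admissible J i j" and N: "N \<ge> 1" "card J \<le> N"
      and sep: "\<forall>k\<in>J. \<forall>l\<in>J. k \<noteq> l \<longrightarrow> j k + 2 * M \<le> j l \<or> j l + 2 * M \<le> j k"
      and a: "\<forall>k\<in>J. \<bar>a k\<bar> \<le> 2 powr (real (i k) * recip p - real (j k) * \<alpha>)"
    for J i j a \<tau> N
  proof -
    let ?T = "distribution_of (test J i j a \<tau>)"
    have J: "finite J" using adm by (simp add: admissible_def)
    define S where "S = (\<Union>k\<in>J. {m. near m (j k)})"
    have "finite S" unfolding S_def using J finite_near by blast
    have "card S \<le> (\<Sum>k\<in>J. card {m. near m (j k)})" unfolding S_def by (rule card_UN_le[OF J])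
    also have "\<dots> \<le> (\<Sum>k\<in>J. 2 * M)" by (intro sum_mono card_near)
    also have "\<dots> \<le> 2 * M * N" using N by simp
    finally have card: "real (card S) \<le> real (2 * M) * real N" by (metis of_nat_le_iff of_nat_mult)
    have conv_m: "convolve ?T (dil m) \<in> borel_measurable borel" for m by (rule convolve_test_measurable[OF J])
    have block: "ennreal (\<bar>det A\<bar> powr (real m * \<alpha>)) * Lp_norm p (convolve ?T (dil m)) \<le> ennreal B" if mS: "m \<in> S" for m
    proof -
      obtain k where k: "k \<in> J" "near m (j k)" using mS by (auto simp: S_def)
      have "l = k" if "l \<in> J" "near m (j l)" for l
      proof (rule ccontr)
        assume "l \<noteq> k"
        then have "j k + 2 * M \<le> j l \<or> j l + 2 * M \<le> j k" using sep k(1) that(1) by blast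
        then show False using k(2) that(2) unfolding near_def by linarith
      qed
      then have "{k \<in> J. near m (j k)} = {k}" using k by blast
      then have "\<forall>x. norm (convolve ?T (dil m) x) \<le> (\<bar>a k\<bar> * C) * (\<Sum>l<(1::nat). envelope (2 * L) (mat_pow A (i k) *v x - mat_pow A (i k) *v \<tau> k))"
        using C(2)[OF adm, of a \<tau> m] by (simp add: mult.assoc flip: matrix_vector_mult_diff_distrib)
      from W(2)[OF invertible_mat_pow conv_m _ _ _ this]
      have "Lp_norm p (convolve ?T (dil m)) \<le> ennreal (\<bar>a k\<bar> * C * W * (2 ^ i k) powr - recip p)"
        using C(1) by (simp add: det_mat_pow)
      moreover have "\<bar>det A\<bar> powr (real m * \<alpha>) * (\<bar>a k\<bar> * C * W * (2 ^ i k) powr - recip p) \<le> B"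
      proof -
        have pw: "(2 ^ i k) powr - recip p = 2 powr - (real (i k) * recip p)"
          by (simp add: powr_powr flip: powr_realpow)
        have "\<bar>det A\<bar> powr (real m * \<alpha>) * (\<bar>a k\<bar> * C * W * (2 ^ i k) powr - recip p)
           = \<bar>det A\<bar> powr (real m * \<alpha>) * \<bar>a k\<bar> * (C * W * 2 powr - (real (i k) * recip p))"
          unfolding pw by (simp add: mult_ac)
        also have "\<dots> \<le> 2 powr (real (j k) * \<alpha> + real M * \<bar>\<alpha>\<bar>) * 2 powr (real (i k) * recip p - real (j k) * \<alpha>) * (C * W * 2 powr - (real (i k) * recip p))"
          using weight_le[OF k(2)] a k(1) C(1) W(1) by (intro mult_right_mono mult_mono) auto
        also have "2 powr (real (j k) * \<alpha> + real M * \<bar>\<alpha>\<bar>) * 2 powr (real (i k) * recip p - real (j k) * \<alpha>) * (C * W * 2 powr - (real (i k) * recip p))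
            = 2 powr ((real (j k) * \<alpha> + real M * \<bar>\<alpha>\<bar>) + (real (i k) * recip p - real (j k) * \<alpha>) + - (real (i k) * recip p)) * (C * W)"
          by (simp only: powr_add) (simp add: mult_ac)
        also have "\<dots> = B" by (simp add: B_def)
        finally show ?thesis .
      qed
      ultimately show ?thesis
        by (rule ennreal_weighted_le) simp
    qed
    have "Lp_norm p (\<lambda>_ :: 'd rvec. 0) = 0"
      using W(2)[OF invertible_mat_pow[of 0], of "\<lambda>_. 0" 0 1] by simp
    then have zero: "ennreal (\<bar>det A\<bar> powr (real m * \<alpha>)) * Lp_norm p (convolve ?T (dil m)) = 0" if "m \<notin> S" for m
      using convolve_test_eq_0[OF adm, of m a \<tau>] that by (simp add: S_def)
    have "real (2 * M) * real N \<ge> 1" using M N by (metis mult_le_mono of_nat_1 of_nat_le_iff of_nat_mult mult_1 one_le_mult_iff one_le_numeral)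
    with card have "test_norm J i j a \<tau> \<le> ennreal (B * (real (2 * M) * real N) powr recip r)"
      unfolding besov_norm_def
      by (intro lr_norm_finite_support[OF exponents_pos(3) \<open>finite S\<close>] block zero \<open>B \<ge> 0\<close>)
    then show ?thesis by (simp add: powr_mult mult.assoc)
  qed
  then show ?thesis
    unfolding scales_constant_def using \<open>B \<ge> 0\<close> by (intro exI[of _ "B * real (2 * M) powr recip r"]) auto
qed

text \<open>At a single scale the parameter \<open>r\<close> only enters through the constant.\<close>

lemma besov_norm_separated_translates:
  "\<exists>C\<ge>0. \<forall>a \<tau> N s. N \<ge> 1 \<longrightarrow> (\<forall>k<N. \<bar>a k\<bar> \<le> 1) \<longrightarrow>
     (\<forall>k<N. \<forall>l<N. k \<noteq> l \<longrightarrow> \<bar>\<tau> k $ s - \<tau> l $ s\<bar> \<ge> 2 * real N) \<longrightarrow>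
     test_norm {..<N} (\<lambda>_. 0) (\<lambda>_. 2 * M) a \<tau> \<le> ennreal (C * real N powr recip p)"
proof -
  obtain C where C: "C \<ge> 0" "\<And>J i j a \<tau> m x. admissible J i j \<Longrightarrow>
     norm (convolve (distribution_of (test J i j a \<tau>)) (dil m) x) \<le>
     (\<Sum>k\<in>{k \<in> J. near m (j k)}. \<bar>a k\<bar> * (C * envelope (2 * L) (mat_pow A (i k) *v (x - \<tau> k))))"
    using convolve_test_bound by blast
  obtain W where W: "W \<ge> 0" "\<And>g C \<sigma> N s B. invertible B \<Longrightarrow> g \<in> borel_measurable borel \<Longrightarrow> C \<ge> 0 \<Longrightarrow> N \<ge> 1 \<Longrightarrow>
     (\<forall>k<N. \<forall>l<N. k \<noteq> l \<longrightarrow> \<bar>\<sigma> k $ s - \<sigma> l $ s\<bar> \<ge> 2 * real N) \<Longrightarrow>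
     (\<forall>x. norm (g x) \<le> C * (\<Sum>k<N. envelope (2 * L) (B *v x - \<sigma> k))) \<Longrightarrow>
     Lp_norm p g \<le> ennreal (C * W * real N powr recip p * \<bar>det (B :: (real, 'd) sqmat)\<bar> powr - recip p)"
    using Lp_norm_separated_sum_bound[OF exponents_pos(1) L_large L, where 'd='d] by blast
  define B where "B = 2 powr (real (2 * M) * \<alpha> + real M * \<bar>\<alpha>\<bar>) * (C * W)"
  have "B \<ge> 0" using C(1) W(1) by (simp add: B_def)
  have "test_norm {..<N} (\<lambda>_. 0) (\<lambda>_. 2 * M) a \<tau> \<le> ennreal (B * real (2 * M) powr recip r * real N powr recip p)"
    if N: "N \<ge> 1" and a: "\<forall>k<N. \<bar>a k\<bar> \<le> 1"
      and sep: "\<forall>k<N. \<forall>l<N. k \<noteq> l \<longrightarrow> \<bar>\<tau> k $ s - \<tau> l $ s\<bar> \<ge> 2 * real N" for a \<tau> N s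
  proof -
    let ?T = "distribution_of (test {..<N} (\<lambda>_. 0) (\<lambda>_. 2 * M) a \<tau>)"
    let ?S = "{m. near m (2 * M)}"
    have adm: "admissible {..<N} (\<lambda>_. 0) (\<lambda>_. 2 * M)" by (simp add: admissible_def)
    have meas: "convolve ?T (dil m) \<in> borel_measurable borel" for m by (rule convolve_test_measurable) simp
    have block: "ennreal (\<bar>det A\<bar> powr (real m * \<alpha>)) * Lp_norm p (convolve ?T (dil m)) \<le> ennreal (B * real N powr recip p)"
      if m: "m \<in> ?S" for m
    proof -
      have "norm (convolve ?T (dil m) x) \<le> C * (\<Sum>k<N. envelope (2 * L) (x - \<tau> k))" for x
      proof -
        have "norm (convolve ?T (dil m) x) \<le> (\<Sum>k<N. \<bar>a k\<bar> * (C * envelope (2 * L) (x - \<tau> k)))"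
          using C(2)[OF adm, of a \<tau> m x] m by (simp add: lessThan_def)
        also have "\<dots> \<le> (\<Sum>k<N. 1 * (C * envelope (2 * L) (x - \<tau> k)))"
          using a C(1) by (intro sum_mono mult_right_mono) auto
        finally show ?thesis by (simp add: sum_distrib_left)
      qed
      then have "Lp_norm p (convolve ?T (dil m)) \<le> ennreal (C * W * real N powr recip p)"
        using W(2)[OF invertible_mat_pow[of 0] meas C(1) N, of \<tau> s] sep by simp
      moreover have "\<bar>det A\<bar> powr (real m * \<alpha>) * (C * W * real N powr recip p) \<le> B * real N powr recip p"
        using mult_right_mono[OF weight_le[of m "2 * M"], of "C * W * real N powr recip p"] m C(1) W(1)
        by (simp add: B_def mult.assoc)
      ultimately show ?thesis
        by (rule ennreal_weighted_le) simp
    qed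
    have "Lp_norm p (\<lambda>_ :: 'd rvec. 0) = 0" using W(2)[OF invertible_mat_pow[of 0], of "\<lambda>_. 0" 0 1] by simp
    then have zero: "ennreal (\<bar>det A\<bar> powr (real m * \<alpha>)) * Lp_norm p (convolve ?T (dil m)) = 0" if "m \<notin> ?S" for m
      using convolve_test_eq_0[OF adm, of m a \<tau>] that by simp
    have "test_norm {..<N} (\<lambda>_. 0) (\<lambda>_. 2 * M) a \<tau> \<le> ennreal (B * real N powr recip p * real (2 * M) powr recip r)"
      unfolding besov_norm_def
      by (intro lr_norm_finite_support[OF exponents_pos(3) finite_near[of "2 * M"]] block zero)
         (use card_near[of "2 * M"] M \<open>B \<ge> 0\<close> in auto)
    then show ?thesis by (simp add: mult_ac)
  qed
  then show ?thesis using \<open>B \<ge> 0\<close> by (intro exI[of _ "B * real (2 * M) powr recip r"]) auto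
qed

definition embedding_constant :: "'d \<Rightarrow> real \<Rightarrow> bool" where
  "embedding_constant s C \<longleftrightarrow> C \<ge> 0 \<and> (\<forall>J i j a \<tau> B. admissible J i j \<longrightarrow> B \<ge> 0 \<longrightarrow>
     test_norm J i j a \<tau> \<le> ennreal B \<longrightarrow>
     Lp_norm q (dtest n s J i j a \<tau>) \<le> ennreal (C * B))"

lemma exists_embedding_constant: "\<exists>C. embedding_constant s C"
  using embedding_test[OF embedding exponents_pos(2), of s] unfolding embedding_constant_def .

lemma embedding_constant_nonneg: "embedding_constant s C \<Longrightarrow> C \<ge> 0"
  by (simp add: embedding_constant_def)

lemma embedding_constantD:
  "embedding_constant s C \<Longrightarrow> admissible J i j \<Longrightarrow> B \<ge> 0 \<Longrightarrow>
     test_norm J i j a \<tau> \<le> ennreal B \<Longrightarrow>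
     Lp_norm q (dtest n s J i j a \<tau>) \<le> ennreal (C * B)"
  unfolding embedding_constant_def by blast

text \<open>A single mode with both scales equal to \<open>j\<close> is a dilated copy of a fixed function, up to its
  derivatives. So this compares the growth of the derivatives with the homogeneity of the norms.\<close>

lemma growth_bound:
  "\<exists>C. \<forall>j\<ge>2 * M. growth s j ^ n \<le> C * 2 powr (real j * (\<alpha> + recip q - recip p))"
proof -
  obtain C where C: "embedding_constant s C" using exists_embedding_constant by blast
  have C0: "C \<ge> 0" by (rule embedding_constant_nonneg[OF C])
  obtain C' where C': "scales_constant C'" using exists_scales_constant by blast
  have C'0: "C' \<ge> 0" by (rule scales_constant_nonneg[OF C'])
  obtain \<rho> where \<rho>: "\<rho> > 0" "\<And>y \<eta>. y \<in> cube \<rho> \<Longrightarrow> \<eta> \<in> cube \<delta> \<Longrightarrow> \<bar>y \<bullet> (\<eta> :: 'd rvec)\<bar> \<le> 1/6"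
    using exists_bump_radius by blast
  obtain m where m: "m > 0" "emeasure lborel (cube \<rho> :: 'd rvec set) = ennreal m"
    using emeasure_cube[OF \<rho>(1)] by blast
  have "growth s j ^ n \<le> (2 * C * C' / m powr recip q) * 2 powr (real j * (\<alpha> + recip q - recip p))" if j: "j \<ge> 2 * M" for j
  proof -
    define a where "a = (2::real) powr (real j * recip p - real j * \<alpha>)"
    have adm: "admissible {0} (\<lambda>_. j) (\<lambda>_. j)" using j by (simp add: admissible_def)
    have "test_norm {0} (\<lambda>_. j) (\<lambda>_. j) (\<lambda>_. a) (\<lambda>_. 0) \<le> ennreal (C' * real 1 powr recip r)"
      by (rule scales_constantD[OF C' adm]) (auto simp: a_def)
    then have "Lp_norm q (dtest n s {0} (\<lambda>_. j) (\<lambda>_. j) (\<lambda>_. a) (\<lambda>_. 0)) \<le> ennreal (C * C')"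
      using embedding_constantD[OF C adm C'0] by simp
    moreover have "ennreal (a * (growth s j ^ n / 2) * (m / 2 ^ j) powr recip q) \<le> Lp_norm q (dtest n s {0} (\<lambda>_. j) (\<lambda>_. j) (\<lambda>_. a) (\<lambda>_. 0))"
    proof (rule Lp_norm_lower[OF exponents_pos(2) bump_borel emeasure_bump[OF m(2,1)]])
      fix x assume x: "x \<in> bump \<rho> j 0"
      show "a * (growth s j ^ n / 2) \<le> norm (dtest n s {0} (\<lambda>_. j) (\<lambda>_. j) (\<lambda>_. a) (\<lambda>_. 0) x)"
        using norm_dmode_ge[OF order.refl \<rho>(2) x, where s = s] by (simp add: dtest_def norm_mult a_def)
    qed (use m growth_nonneg[of s j] in \<open>auto simp: a_def\<close>)
    ultimately have "a * (growth s j ^ n / 2) * (m / 2 ^ j) powr recip q \<le> C * C'"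
      using C0 C'0 order.trans by (fastforce simp: ennreal_le_iff)
    moreover have "(m / 2 ^ j) powr recip q = m powr recip q * 2 powr - (real j * recip q)"
      using m by (simp add: powr_divide powr_powr powr_minus_divide flip: powr_realpow)
    ultimately have "growth s j ^ n * (a * 2 powr - (real j * recip q)) \<le> 2 * C * C' / m powr recip q"
      using m by (simp add: field_simps)
    moreover have "a * 2 powr - (real j * recip q) = 1 / 2 powr (real j * (\<alpha> + recip q - recip p))"
      by (simp add: a_def algebra_simps flip: powr_add powr_minus_divide)
    ultimately have "growth s j ^ n * (1 / 2 powr (real j * (\<alpha> + recip q - recip p))) \<le> 2 * C * C' / m powr recip q"
      by (simp only:)
    then show ?thesis by (simp add: pos_divide_le_eq)
  qed
  then show ?thesis by blast
qed

end

section \<open>Necessary conditions\<close>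

text \<open>At every point at most one summand is non-zero, so any function may be applied termwise.\<close>

lemma function_of_disjoint_indicators:
  fixes E :: "'k \<Rightarrow> 'x set"
  assumes J: "finite J" and disj: "\<And>k l. k \<in> J \<Longrightarrow> l \<in> J \<Longrightarrow> k \<noteq> l \<Longrightarrow> E k \<inter> E l = {}"
  shows "F (\<Sum>k\<in>J. \<beta> k * indicator (E k) x) = (if \<exists>k\<in>J. x \<in> E k then \<Sum>k\<in>J. F (\<beta> k) * indicator (E k) x else F (0::real) :: real)"
proof (cases "\<exists>k\<in>J. x \<in> E k")
  case True
  then obtain k where k: "k \<in> J" "x \<in> E k" by blast
  have 0: "l \<in> J - {k} \<Longrightarrow> indicator (E l) x = (0::real)" for l
    using disj[of k l] k by (auto simp: indicator_def)
  have "(\<Sum>l\<in>J. G l * indicator (E l) x) = G k" for G :: "'k \<Rightarrow> real"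
  proof -
    have "(\<Sum>l\<in>J - {k}. G l * indicator (E l) x) = 0" by (rule sum.neutral) (simp add: 0)
    then show ?thesis using k sum.remove[OF J k(1), of "\<lambda>l. G l * indicator (E l) x"] by (simp del: sum_mult_indicator)
  qed
  then show ?thesis using True by simp
qed (simp add: indicator_def cong: if_cong)

context sobolev_embedding
begin

text \<open>For a suitable choice of signs the \<open>L\<^sup>q\<close> norm of a derivative is at least that of the square
  function, while the Besov norm does not see the signs.\<close>

lemma signed_lower_bound:
  fixes b :: "'d rvec \<Rightarrow> real"
  assumes q: "q = ennreal Q" "Q > 0" and C: "embedding_constant s C"
    and adm: "admissible J i j" and B: "B \<ge> 0"
      "\<forall>X\<subseteq>J. test_norm J i j (\<lambda>k. sign_on X k * a k) \<tau> \<le> ennreal B"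
    and b: "b \<in> borel_measurable borel" "\<And>x. b x \<ge> 0"
      "\<And>x. b x ^ 2 \<le> (\<Sum>k\<in>J. (\<bar>a k\<bar> * norm (dmode n s (i k) (j k) (x - \<tau> k))) ^ 2)"
  shows "(\<integral>\<^sup>+x. ennreal ((b x / 2) powr Q) \<partial>lborel) \<le> ennreal (12 * (C * B) powr Q)"
proof -
  have J: "finite J" using adm by (simp add: admissible_def)
  have [measurable]: "dmode n s i j \<in> borel_measurable borel" for i j by (rule dmode_measurable)
  have "\<exists>X\<subseteq>J. (\<integral>\<^sup>+x. ennreal ((b x / 2) powr Q) \<partial>lborel)
    \<le> 12 * (\<integral>\<^sup>+x. ennreal (norm (\<Sum>k\<in>J. of_real (sign_on X k) * (of_real (a k) * dmode n s (i k) (j k) (x - \<tau> k))) powr Q) \<partial>lborel)"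
    by (rule exists_good_signs[OF J q(2)]) (use b in \<open>auto simp: norm_mult\<close>)
  then obtain X where X: "X \<subseteq> J" "(\<integral>\<^sup>+x. ennreal ((b x / 2) powr Q) \<partial>lborel)
    \<le> 12 * (\<integral>\<^sup>+x. ennreal (norm (\<Sum>k\<in>J. of_real (sign_on X k) * (of_real (a k) * dmode n s (i k) (j k) (x - \<tau> k))) powr Q) \<partial>lborel)"
    by blast
  have "(\<Sum>k\<in>J. of_real (sign_on X k) * (of_real (a k) * dmode n s (i k) (j k) (x - \<tau> k))) = dtest n s J i j (\<lambda>k. sign_on X k * a k) \<tau> x" for x
    by (simp add: dtest_def mult.assoc)
  moreover have "Lp_norm (ennreal Q) (dtest n s J i j (\<lambda>k. sign_on X k * a k) \<tau>) \<le> ennreal (C * B)"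
    using embedding_constantD[OF C adm B(1)] B(2) X(1) q by blast
  then have "(\<integral>\<^sup>+x. ennreal (norm (dtest n s J i j (\<lambda>k. sign_on X k * a k) \<tau> x) powr Q) \<partial>lborel) \<le> ennreal ((C * B) powr Q)"
    using embedding_constant_nonneg[OF C] B(1) q(2) by (intro nn_integral_le_Lp_norm) auto
  ultimately have "(\<integral>\<^sup>+x. ennreal ((b x / 2) powr Q) \<partial>lborel) \<le> 12 * ennreal ((C * B) powr Q)"
    using X(2) by (simp add: order.trans[OF _ mult_left_mono])
  then show ?thesis by (simp add: ennreal_mult)
qed

text \<open>On disjoint bumps the square function is at least the size of the mode that belongs to the bump.
  Whatever the other modes do there is taken care of by the signs.\<close>

lemma disjoint_bumps_lower_bound:
  assumes q: "q = ennreal Q" "Q > 0" and C: "embedding_constant s C"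
  shows "\<exists>c>0. \<forall>J i j a \<tau> B. admissible J i j \<longrightarrow> B \<ge> 0 \<longrightarrow>
     (\<forall>X\<subseteq>J. test_norm J i j (\<lambda>k. sign_on X k * a k) \<tau> \<le> ennreal B) \<longrightarrow>
     (\<forall>k\<in>J. \<forall>l\<in>J. k \<noteq> l \<longrightarrow> \<bar>\<tau> k $ s - \<tau> l $ s\<bar> \<ge> 2) \<longrightarrow>
     (\<Sum>k\<in>J. (c * (\<bar>a k\<bar> * growth s (j k) ^ n)) powr Q / 2 ^ i k) \<le> (C * B) powr Q"
proof -
  obtain \<rho> where \<rho>: "\<rho> > 0" "\<And>y \<eta>. y \<in> cube \<rho> \<Longrightarrow> \<eta> \<in> cube \<delta> \<Longrightarrow> \<bar>y \<bullet> (\<eta> :: 'd rvec)\<bar> \<le> 1/6"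
    "\<And>i \<tau> x l. x \<in> bump \<rho> i \<tau> \<Longrightarrow> \<bar>x $ l - \<tau> $ l\<bar> < 1"
    using exists_bump_radius by blast
  obtain m where m: "m > 0" "emeasure lborel (cube \<rho> :: 'd rvec set) = ennreal m"
    using emeasure_cube[OF \<rho>(1)] by blast
  \<comment> \<open>The volume of a bump is \<open>m / 2 ^ i\<close>. The choice of signs costs a factor 12, and one factor 2 each
      comes from the size of the mode on the bump and from the passage to the square function.\<close>
  define c where "c = (m / 12) powr (1 / Q) / 4"
  have "c > 0" using m by (simp add: c_def)
  have cQ: "(c * y) powr Q = (m / 12) * (y / 4) powr Q" if "y \<ge> 0" for y
    using that m q(2) by (simp add: c_def powr_mult powr_divide powr_powr)
  have "(\<Sum>k\<in>J. (c * (\<bar>a k\<bar> * growth s (j k) ^ n)) powr Q / 2 ^ i k) \<le> (C * B) powr Q"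
    if adm: "admissible J i j" and B: "B \<ge> 0"
      "\<forall>X\<subseteq>J. test_norm J i j (\<lambda>k. sign_on X k * a k) \<tau> \<le> ennreal B"
      and sep: "\<forall>k\<in>J. \<forall>l\<in>J. k \<noteq> l \<longrightarrow> \<bar>\<tau> k $ s - \<tau> l $ s\<bar> \<ge> 2"
    for J i j a \<tau> B
  proof -
    have J: "finite J" using adm by (simp add: admissible_def)
    define E where "E k = bump \<rho> (i k) (\<tau> k)" for k
    have [measurable]: "E k \<in> sets borel" for k by (simp add: E_def bump_borel)
    have disj: "E k \<inter> E l = {}" if "k \<in> J" "l \<in> J" "k \<noteq> l" for k l
    proof (rule ccontr)
      assume "E k \<inter> E l \<noteq> {}"
      then obtain x where "x \<in> bump \<rho> (i k) (\<tau> k)" "x \<in> bump \<rho> (i l) (\<tau> l)" by (auto simp: E_def)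
      then have "\<bar>x $ s - \<tau> k $ s\<bar> < 1" "\<bar>x $ s - \<tau> l $ s\<bar> < 1" using \<rho>(3) by blast+
      moreover have "\<bar>\<tau> k $ s - \<tau> l $ s\<bar> \<ge> 2" using sep that by blast
      ultimately show False by linarith
    qed
    note bumps = function_of_disjoint_indicators[where E = E, OF J disj]
    define \<beta> where "\<beta> k = \<bar>a k\<bar> * (growth s (j k) ^ n / 2)" for k
    have \<beta>: "\<beta> k \<ge> 0" for k using growth_nonneg by (simp add: \<beta>_def)
    define b where "b x = (\<Sum>k\<in>J. \<beta> k * indicator (E k) x)" for x
    have b_sq: "b x ^ 2 \<le> (\<Sum>k\<in>J. (\<bar>a k\<bar> * norm (dmode n s (i k) (j k) (x - \<tau> k))) ^ 2)" for x
    proof (cases "\<exists>k\<in>J. x \<in> E k")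
      case True
      then have "b x ^ 2 = (\<Sum>k\<in>J. \<beta> k ^ 2 * indicator (E k) x)"
        unfolding b_def using bumps[of "\<lambda>t. t ^ 2" \<beta> x] by simp
      also have "\<dots> \<le> (\<Sum>k\<in>J. (\<bar>a k\<bar> * norm (dmode n s (i k) (j k) (x - \<tau> k))) ^ 2)"
      proof (rule sum_mono)
        fix k assume "k \<in> J"
        then have "i k \<le> j k" using adm by (simp add: admissible_def)
        show "\<beta> k ^ 2 * indicator (E k) x \<le> (\<bar>a k\<bar> * norm (dmode n s (i k) (j k) (x - \<tau> k))) ^ 2"
        proof (cases "x \<in> E k")
          case True
          then have "x \<in> bump \<rho> (i k) (\<tau> k)" by (simp add: E_def)
          then have "growth s (j k) ^ n / 2 \<le> norm (dmode n s (i k) (j k) (x - \<tau> k))"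
            by (rule norm_dmode_ge[OF \<open>i k \<le> j k\<close>, rotated]) (rule \<rho>(2))
          then have "\<beta> k \<le> \<bar>a k\<bar> * norm (dmode n s (i k) (j k) (x - \<tau> k))"
            unfolding \<beta>_def by (rule mult_left_mono) simp
          then have "\<beta> k ^ 2 \<le> (\<bar>a k\<bar> * norm (dmode n s (i k) (j k) (x - \<tau> k))) ^ 2"
            using \<beta> by (rule power_mono)
          then show ?thesis using True by simp
        qed simp
      qed
      finally show ?thesis .
    next
      case False
      then have "b x ^ 2 = 0" unfolding b_def using bumps[of "\<lambda>t. t ^ 2" \<beta> x] by simp
      then show ?thesis by (simp add: sum_nonneg)
    qed
    have "(\<integral>\<^sup>+x. ennreal ((b x / 2) powr Q) \<partial>lborel) = (\<integral>\<^sup>+x. (\<Sum>k\<in>J. ennreal ((\<beta> k / 2) powr Q) * indicator (E k) x) \<partial>lborel)"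
    proof (intro nn_integral_cong)
      fix x
      have "(b x / 2) powr Q = (\<Sum>k\<in>J. (\<beta> k / 2) powr Q * indicator (E k) x)"
        unfolding b_def using bumps[of "\<lambda>t. (t / 2) powr Q" \<beta> x] q(2) by (auto simp: indicator_def)
      then show "ennreal ((b x / 2) powr Q) = (\<Sum>k\<in>J. ennreal ((\<beta> k / 2) powr Q) * indicator (E k) x)"
        by (auto simp: ennreal_mult ennreal_indicator simp flip: sum_ennreal)
    qed
    also have "\<dots> = (\<Sum>k\<in>J. ennreal ((\<beta> k / 2) powr Q) * emeasure lborel (E k))"
      by (simp add: nn_integral_sum nn_integral_cmult)
    also have "\<dots> = (\<Sum>k\<in>J. ennreal ((\<beta> k / 2) powr Q * (m / 2 ^ i k)))"
      unfolding E_def emeasure_bump[OF m(2,1)]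
      by (intro sum.cong refl ennreal_mult[symmetric]) (use m in auto)
    also have "\<dots> = ennreal (\<Sum>k\<in>J. (\<beta> k / 2) powr Q * (m / 2 ^ i k))"
      using m by (intro sum_ennreal) auto
    finally have integral_b: "(\<integral>\<^sup>+x. ennreal ((b x / 2) powr Q) \<partial>lborel) = ennreal (\<Sum>k\<in>J. (\<beta> k / 2) powr Q * (m / 2 ^ i k))" .
    have "ennreal (\<Sum>k\<in>J. (\<beta> k / 2) powr Q * (m / 2 ^ i k)) \<le> ennreal (12 * (C * B) powr Q)"
    proof -
      have "b \<in> borel_measurable borel" unfolding b_def by measurable
      moreover have "b x \<ge> 0" for x unfolding b_def using \<beta> by (intro sum_nonneg) auto
      ultimately show ?thesis
        unfolding integral_b[symmetric] by (rule signed_lower_bound[OF q C adm B _ _ b_sq])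
    qed
    then have "(\<Sum>k\<in>J. (\<beta> k / 2) powr Q * (m / 2 ^ i k)) \<le> 12 * (C * B) powr Q"
      by (subst (asm) ennreal_le_iff) auto
    moreover have "(c * (\<bar>a k\<bar> * growth s (j k) ^ n)) powr Q / 2 ^ i k = (\<beta> k / 2) powr Q * (m / 2 ^ i k) / 12" for k
      by (subst cQ) (auto simp: \<beta>_def growth_nonneg mult_ac)
    then have "(\<Sum>k\<in>J. (c * (\<bar>a k\<bar> * growth s (j k) ^ n)) powr Q / 2 ^ i k) = (\<Sum>k\<in>J. (\<beta> k / 2) powr Q * (m / 2 ^ i k)) / 12"
      unfolding sum_divide_distrib by (intro sum.cong refl)
    ultimately show ?thesis by linarith
  qed
  then show ?thesis using \<open>c > 0\<close> by blast
qed

lemma abs_sign_on: "\<bar>sign_on X k * a\<bar> = \<bar>a :: real\<bar>"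
  by (simp add: sign_on_def)

text \<open>Translates of one mode: their number \<open>N\<close> enters the Besov norm with the power \<open>1/p\<close> and the Sobolev
  norm with the power \<open>1/q\<close>.\<close>

lemma p_le_q: "p \<le> q"
proof (cases rule: positive_exponent_cases[OF exponents_pos(2)])
  case (2 Q)
  obtain s where s: "A $ s $ s = lam" using lambda_max_diagonal by blast
  obtain C where C: "embedding_constant s C" using exists_embedding_constant by blast
  have C0: "C \<ge> 0" by (rule embedding_constant_nonneg[OF C])
  obtain c where c: "c > 0" "\<And>J i j a \<tau> B. admissible J i j \<Longrightarrow> B \<ge> 0 \<Longrightarrow>
     (\<forall>X\<subseteq>J. test_norm J i j (\<lambda>k. sign_on X k * a k) \<tau> \<le> ennreal B) \<Longrightarrow>
     (\<forall>k\<in>J. \<forall>l\<in>J. k \<noteq> l \<longrightarrow> \<bar>\<tau> k $ s - \<tau> l $ s\<bar> \<ge> 2) \<Longrightarrow>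
     (\<Sum>k\<in>J. (c * (\<bar>a k\<bar> * growth s (j k) ^ n)) powr Q / 2 ^ i k) \<le> (C * B) powr Q"
    using disjoint_bumps_lower_bound[OF 2 C] by blast
  obtain C' where C': "C' \<ge> 0" "\<And>a \<tau> N s. N \<ge> 1 \<Longrightarrow> (\<forall>k<N. \<bar>a k\<bar> \<le> 1) \<Longrightarrow>
     (\<forall>k<N. \<forall>l<N. k \<noteq> l \<longrightarrow> \<bar>\<tau> k $ s - \<tau> l $ s\<bar> \<ge> 2 * real N) \<Longrightarrow>
     test_norm {..<N} (\<lambda>_. 0) (\<lambda>_. 2 * M) a \<tau> \<le> ennreal (C' * real N powr recip p)"
    using besov_norm_separated_translates by blast
  define g where "g = (c * growth s (2 * M) ^ n) powr Q"
  have "0 < lam ^ (2 * M)" using lambda_max_gt_1 by simp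
  also have "\<dots> \<le> growth s (2 * M)"
    using mat_pow_diagonal_ge[of s "2 * M"] growth_ge_entry[of "2 * M" s s] by (simp add: s)
  finally have g: "g > 0" using c(1) by (simp add: g_def)
  have "real N powr 1 \<le> ((C * C') powr Q / g) * real N powr (recip p * Q)" if N: "N \<ge> 1" for N :: nat
  proof -
    define \<tau> :: "nat \<Rightarrow> 'd rvec" where "\<tau> k = (2 * real N * real k) *\<^sub>R axis s 1" for k
    have \<tau>: "\<bar>\<tau> k $ s - \<tau> l $ s\<bar> \<ge> 2 * real N" if "k \<noteq> l" for k l
    proof -
      have "\<tau> k $ s - \<tau> l $ s = 2 * real N * (real k - real l)" by (simp add: \<tau>_def axis_def algebra_simps)
      moreover have "1 \<le> \<bar>real k - real l\<bar>" using that by linarith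
      ultimately show ?thesis using mult_left_mono[of 1 "\<bar>real k - real l\<bar>" "2 * real N"] by (simp add: abs_mult)
    qed
    have "(\<Sum>k<N. (c * (\<bar>1\<bar> * growth s (2 * M) ^ n)) powr Q / 2 ^ 0) \<le> (C * (C' * real N powr recip p)) powr Q"
    proof (rule c(2))
      show "admissible {..<N} (\<lambda>_. 0) (\<lambda>_. 2 * M)" by (simp add: admissible_def)
      show "\<forall>X\<subseteq>{..<N}. test_norm {..<N} (\<lambda>_. 0) (\<lambda>_. 2 * M) (\<lambda>k. sign_on X k * 1) \<tau> \<le> ennreal (C' * real N powr recip p)"
      proof (intro allI impI)
        fix X
        have "\<forall>k<N. \<bar>sign_on X k * 1\<bar> \<le> 1" by (simp add: sign_on_def)
        moreover have "\<forall>k<N. \<forall>l<N. k \<noteq> l \<longrightarrow> \<bar>\<tau> k $ s - \<tau> l $ s\<bar> \<ge> 2 * real N" using \<tau> by blast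
        ultimately show "test_norm {..<N} (\<lambda>_. 0) (\<lambda>_. 2 * M) (\<lambda>k. sign_on X k * 1) \<tau> \<le> ennreal (C' * real N powr recip p)"
          by (rule C'(2)[OF N])
      qed
      show "\<forall>k\<in>{..<N}. \<forall>l\<in>{..<N}. k \<noteq> l \<longrightarrow> \<bar>\<tau> k $ s - \<tau> l $ s\<bar> \<ge> 2"
      proof (intro ballI impI)
        fix k l :: nat assume "k \<noteq> l"
        from \<tau>[OF this] N show "\<bar>\<tau> k $ s - \<tau> l $ s\<bar> \<ge> 2" by linarith
      qed
    qed (use C'(1) in \<open>auto simp: admissible_def\<close>)
    then have "real N * g \<le> (C * C') powr Q * real N powr (recip p * Q)"
      using C0 C'(1) 2 by (simp add: g_def powr_mult powr_powr mult.assoc[symmetric])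
    then show ?thesis using g N by (simp add: field_simps)
  qed
  then have "1 \<le> recip p * Q" by (rule powr_bound_imp_le)
  then have "recip q \<le> recip p" using 2 by (simp add: recip_ennreal divide_le_eq)
  then show ?thesis by (intro recip_le_imp_le exponents_pos)
qed simp

context
  assumes endpoint: "lam ^ n = 2 powr (\<alpha> + recip q - recip p)"
begin

text \<open>In the critical case the normalised modes of all scales have derivatives of the same size.\<close>

lemma growth_endpoint:
  assumes "A $ s $ s = lam"
  shows "growth s j ^ n \<ge> 2 powr (real j * (\<alpha> + recip q - recip p))"
proof -
  have "2 powr (real j * (\<alpha> + recip q - recip p)) = (2 powr (\<alpha> + recip q - recip p)) ^ j"
    by (simp add: powr_powr mult.commute flip: powr_realpow)
  also have "\<dots> = (lam ^ j) ^ n" unfolding endpoint[symmetric] by (simp add: mult.commute flip: power_mult)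
  also have "\<dots> \<le> growth s j ^ n"
    using mat_pow_diagonal_ge[of s j] growth_ge_entry[of j s s] lambda_max_gt_1
    by (intro power_mono) (auto simp: assms)
  finally show ?thesis .
qed

lemma scales_apart:
  assumes "k \<noteq> l"
  shows "2 * M * (k + 1) + 2 * M \<le> 2 * M * (l + 1) \<or> 2 * M * (l + 1) + 2 * M \<le> 2 * M * (k + 1)"
proof -
  have "k + 1 + 1 \<le> l + 1 \<or> l + 1 + 1 \<le> k + 1" using assms by linarith
  then show ?thesis using mult_le_mono2[of "k + 1 + 1" "l + 1" "2 * M"] mult_le_mono2[of "l + 1 + 1" "k + 1" "2 * M"] by auto
qed

text \<open>Dilated modes at \<open>N\<close> different scales, pulled apart in space: the Besov norm only sees the scales
  and grows with the power \<open>1/r\<close>, the Sobolev norm sees disjoint bumps.\<close>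

lemma r_le_q: "r \<le> q"
proof (cases rule: positive_exponent_cases[OF exponents_pos(2)])
  case (2 Q)
  obtain s where s: "A $ s $ s = lam" using lambda_max_diagonal by blast
  obtain C where C: "embedding_constant s C" using exists_embedding_constant by blast
  have C0: "C \<ge> 0" by (rule embedding_constant_nonneg[OF C])
  obtain c where c: "c > 0" "\<And>J i j a \<tau> B. admissible J i j \<Longrightarrow> B \<ge> 0 \<Longrightarrow>
     (\<forall>X\<subseteq>J. test_norm J i j (\<lambda>k. sign_on X k * a k) \<tau> \<le> ennreal B) \<Longrightarrow>
     (\<forall>k\<in>J. \<forall>l\<in>J. k \<noteq> l \<longrightarrow> \<bar>\<tau> k $ s - \<tau> l $ s\<bar> \<ge> 2) \<Longrightarrow>
     (\<Sum>k\<in>J. (c * (\<bar>a k\<bar> * growth s (j k) ^ n)) powr Q / 2 ^ i k) \<le> (C * B) powr Q"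
    using disjoint_bumps_lower_bound[OF 2 C] by blast
  obtain C' where C': "scales_constant C'" using exists_scales_constant by blast
  have C'0: "C' \<ge> 0" by (rule scales_constant_nonneg[OF C'])
  define j where "j k = 2 * M * (k + 1)" for k
  have apart: "\<forall>k\<in>J. \<forall>l\<in>J. k \<noteq> l \<longrightarrow> j k + 2 * M \<le> j l \<or> j l + 2 * M \<le> j k" for J
    unfolding j_def using scales_apart by blast
  define a where "a k = (2::real) powr (real (j k) * recip p - real (j k) * \<alpha>)" for k
  define \<tau> :: "nat \<Rightarrow> 'd rvec" where "\<tau> k = (2 * real k) *\<^sub>R axis s 1" for k
  have \<tau>: "\<bar>\<tau> k $ s - \<tau> l $ s\<bar> \<ge> 2" if "k \<noteq> l" for k l
  proof -
    have "\<tau> k $ s - \<tau> l $ s = 2 * (real k - real l)" by (simp add: \<tau>_def axis_def)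
    moreover have "1 \<le> \<bar>real k - real l\<bar>" using that by linarith
    ultimately show ?thesis by (simp add: abs_mult)
  qed
  have scale_term: "c powr Q \<le> (c * (\<bar>a k\<bar> * growth s (j k) ^ n)) powr Q / 2 ^ j k" for k
  proof -
    have "2 powr (real (j k) * recip q) = a k * 2 powr (real (j k) * (\<alpha> + recip q - recip p))"
      by (simp add: a_def algebra_simps flip: powr_add)
    also have "\<dots> \<le> a k * growth s (j k) ^ n"
      by (intro mult_left_mono growth_endpoint[OF s]) (simp add: a_def)
    finally have "c * 2 powr (real (j k) * recip q) \<le> c * (\<bar>a k\<bar> * growth s (j k) ^ n)"
      using c(1) by (simp add: a_def)
    then have "(c * 2 powr (real (j k) * recip q)) powr Q \<le> (c * (\<bar>a k\<bar> * growth s (j k) ^ n)) powr Q"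
      using c(1) 2 by (intro powr_mono2) auto
    moreover have "(c * 2 powr (real (j k) * recip q)) powr Q = c powr Q * 2 ^ j k"
      using 2 c(1) by (simp add: powr_mult powr_powr recip_ennreal powr_realpow)
    ultimately show ?thesis by (simp add: le_divide_eq)
  qed
  have "real N powr 1 \<le> ((C * C') powr Q / c powr Q) * real N powr (recip r * Q)" if N: "N \<ge> 1" for N :: nat
  proof -
    have adm: "admissible {..<N} j j" by (simp add: admissible_def j_def)
    have "real N * c powr Q = (\<Sum>k<N. c powr Q)" by simp
    also have "\<dots> \<le> (\<Sum>k<N. (c * (\<bar>a k\<bar> * growth s (j k) ^ n)) powr Q / 2 ^ j k)"
      by (intro sum_mono scale_term)
    also have "\<dots> \<le> (C * (C' * real N powr recip r)) powr Q"
    proof (rule c(2)[OF adm])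
      show "\<forall>X\<subseteq>{..<N}. test_norm {..<N} j j (\<lambda>k. sign_on X k * a k) \<tau> \<le> ennreal (C' * real N powr recip r)"
        by (intro allI impI scales_constantD[OF C' adm N _ apart]) (auto simp: abs_sign_on a_def)
    qed (use C'0 \<tau> in auto)
    also have "\<dots> = (C * C') powr Q * real N powr (recip r * Q)"
      using C0 C'0 2 by (simp add: powr_mult powr_powr)
    finally show ?thesis using c(1) N by (simp add: field_simps)
  qed
  then have "1 \<le> recip r * Q" by (rule powr_bound_imp_le)
  then have "recip q \<le> recip r" using 2 by (simp add: recip_ennreal divide_le_eq)
  then show ?thesis by (intro recip_le_imp_le exponents_pos)
qed simp

text \<open>Dilated modes at \<open>N\<close> different scales, all centred at the origin, where their derivatives add up.\<close>

lemma r_le_1: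
  assumes q: "q = \<top>"
  shows "r \<le> 1"
proof -
  obtain s where s: "A $ s $ s = lam" using lambda_max_diagonal by blast
  obtain C where C: "embedding_constant s C" using exists_embedding_constant by blast
  have C0: "C \<ge> 0" by (rule embedding_constant_nonneg[OF C])
  obtain C' where C': "scales_constant C'" using exists_scales_constant by blast
  have C'0: "C' \<ge> 0" by (rule scales_constant_nonneg[OF C'])
  define j where "j k = 2 * M * (k + 1)" for k
  have apart: "\<forall>k\<in>J. \<forall>l\<in>J. k \<noteq> l \<longrightarrow> j k + 2 * M \<le> j l \<or> j l + 2 * M \<le> j k" for J
    unfolding j_def using scales_apart by blast
  define a where "a k = (2::real) powr (real (j k) * recip p - real (j k) * \<alpha>)" for k
  have a: "1 \<le> a k * growth s (j k) ^ n" for k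
  proof -
    have "1 = a k * 2 powr (real (j k) * (\<alpha> + recip q - recip p))"
      by (simp add: a_def q algebra_simps flip: powr_add)
    also have "\<dots> \<le> a k * growth s (j k) ^ n"
      by (intro mult_left_mono growth_endpoint[OF s]) (simp add: a_def)
    finally show ?thesis .
  qed
  have "real N powr 1 \<le> (2 * C * C') * real N powr recip r" if N: "N \<ge> 1" for N :: nat
  proof -
    have adm: "admissible {..<N} j j" by (simp add: admissible_def j_def)
    have "test_norm {..<N} j j a (\<lambda>_. 0) \<le> ennreal (C' * real N powr recip r)"
      by (intro scales_constantD[OF C' adm N _ apart]) (auto simp: a_def)
    then have upper: "Lp_norm q (dtest n s {..<N} j j a (\<lambda>_. 0)) \<le> ennreal (C * (C' * real N powr recip r))"
      using C'0 by (intro embedding_constantD[OF C adm]) auto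
    obtain R where W: "waves \<nu> {..<N} (\<lambda>k. freq (j k) (j k)) R" using exists_waves[of "{..<N}"] by blast
    interpret W: waves \<nu> "{..<N}" "\<lambda>k. freq (j k) (j k)" R by (rule W)
    \<comment> \<open>As finitely many modes have bounded frequencies, all phases are close on a small cube.\<close>
    define e where "e = 1 / (6 * (1 + \<bar>R\<bar>))"
    have e: "e > 0" by (simp add: e_def)
    obtain m where m: "m > 0" "emeasure lborel (cube (e / real CARD('d)) :: 'd rvec set) = ennreal m"
      using emeasure_cube[of "e / real CARD('d)"] e by auto
    have "ennreal (real N / 2 * m powr recip q) \<le> Lp_norm q (dtest n s {..<N} j j a (\<lambda>_. 0))"
    proof (rule Lp_norm_lower[OF exponents_pos(2) cube_borel m(2,1)])
      fix x :: "'d rvec" assume "x \<in> cube (e / real CARD('d))"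
      then have x: "norm x \<le> e"
        using norm_le_index_bound[of x "e / real CARD('d)"] by (simp add: cube_def)
      have mode_ge: "a k * Re (dmode n s (j k) (j k) x / \<i> ^ n) \<ge> 1 / 2" if k: "k \<in> {..<N}" for k
      proof -
        have "\<bar>0 + x \<bullet> freq (j k) (j k) \<eta>\<bar> \<le> 1/6" if "\<eta> \<in> space \<nu>" for \<eta>
        proof -
          have "\<bar>x \<bullet> freq (j k) (j k) \<eta>\<bar> \<le> norm x * norm (freq (j k) (j k) \<eta>)" by (rule Cauchy_Schwarz_ineq2)
          also have "\<dots> \<le> e * \<bar>R\<bar>"
            using W.freq_bounded[OF k that] x e by (intro mult_mono) auto
          also have "\<dots> \<le> e * (1 + \<bar>R\<bar>)" using e by (intro mult_left_mono) auto
          also have "\<dots> = 1/6" by (simp add: e_def add_pos_nonneg)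
          finally show ?thesis by simp
        qed
        from Re_dmode_ge[OF order.refl this, of s]
        have "growth s (j k) ^ n / 2 \<le> Re (dmode n s (j k) (j k) x / \<i> ^ n)" by simp
        then have "a k * (growth s (j k) ^ n / 2) \<le> a k * Re (dmode n s (j k) (j k) x / \<i> ^ n)"
          by (rule mult_left_mono) (simp add: a_def)
        then show ?thesis using a[of k] by simp
      qed
      have "real N / 2 = (\<Sum>k<N. 1 / 2)" by simp
      also have "\<dots> \<le> (\<Sum>k<N. a k * Re (dmode n s (j k) (j k) x / \<i> ^ n))" by (intro sum_mono mode_ge)
      also have "\<dots> = Re (dtest n s {..<N} j j a (\<lambda>_. 0) x / \<i> ^ n)"
        by (simp add: dtest_def sum_divide_distrib Re_sum flip: times_divide_eq_right)
      also have "\<dots> \<le> norm (dtest n s {..<N} j j a (\<lambda>_. 0) x / \<i> ^ n)" by (rule complex_Re_le_cmod)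
      also have "\<dots> = norm (dtest n s {..<N} j j a (\<lambda>_. 0) x)" by (simp add: norm_divide norm_power)
      finally show "real N / 2 \<le> norm (dtest n s {..<N} j j a (\<lambda>_. 0) x)" .
    qed simp
    then have "ennreal (real N / 2 * m powr recip q) \<le> ennreal (C * (C' * real N powr recip r))"
      using upper by (rule order.trans)
    then have "real N / 2 \<le> C * (C' * real N powr recip r)"
      using q m C0 C'0 by (subst (asm) ennreal_le_iff) auto
    then show ?thesis using N by (simp add: mult_ac)
  qed
  then have "1 \<le> recip r" by (rule powr_bound_imp_le)
  then show ?thesis
    using recip_le_imp_le[OF exponents_pos(3), of 1] recip_ennreal[of 1] by simp
qed

text \<open>For equal exponents modes of unit size can be used at all scales. They live on the same set and
  have different modulations, so that their square function has size \<open>sqrt N\<close>.\<close>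

lemma r_le_2:
  assumes "p = q"
  shows "r \<le> 2"
proof (cases rule: positive_exponent_cases[OF exponents_pos(2)])
  case 1
  then have "r \<le> 1" by (rule r_le_1)
  then show ?thesis by (rule order.trans) simp
next
  case (2 Q)
  obtain s where s: "A $ s $ s = lam" using lambda_max_diagonal by blast
  obtain C where C: "embedding_constant s C" using exists_embedding_constant by blast
  have C0: "C \<ge> 0" by (rule embedding_constant_nonneg[OF C])
  obtain C' where C': "scales_constant C'" using exists_scales_constant by blast
  have C'0: "C' \<ge> 0" by (rule scales_constant_nonneg[OF C'])
  obtain \<rho> where \<rho>: "\<rho> > 0" "\<And>y \<eta>. y \<in> cube \<rho> \<Longrightarrow> \<eta> \<in> cube \<delta> \<Longrightarrow> \<bar>y \<bullet> (\<eta> :: 'd rvec)\<bar> \<le> 1/6"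
    using exists_bump_radius by blast
  obtain m where m: "m > 0" "emeasure lborel (cube \<rho> :: 'd rvec set) = ennreal m"
    using emeasure_cube[OF \<rho>(1)] by blast
  let ?E = "bump \<rho> 0 0"
  define j where "j k = 2 * M * (k + 1)" for k
  have apart: "\<forall>k\<in>J. \<forall>l\<in>J. k \<noteq> l \<longrightarrow> j k + 2 * M \<le> j l \<or> j l + 2 * M \<le> j k" for J
    unfolding j_def using scales_apart by blast
  define a where "a k = (2::real) powr (- (real (j k) * \<alpha>))" for k
  have a: "1 \<le> a k * growth s (j k) ^ n" for k
  proof -
    have "1 = a k * 2 powr (real (j k) * (\<alpha> + recip q - recip p))"
      by (simp add: a_def assms flip: powr_add)
    also have "\<dots> \<le> a k * growth s (j k) ^ n"
      by (intro mult_left_mono growth_endpoint[OF s]) (simp add: a_def)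
    finally show ?thesis .
  qed
  have mode_ge: "1 / 2 \<le> \<bar>a k\<bar> * norm (dmode n s 0 (j k) (x - 0))" if "x \<in> ?E" for k x
  proof -
    have "1 / 2 \<le> a k * (growth s (j k) ^ n / 2)" using a[of k] by simp
    also have "\<dots> \<le> a k * norm (dmode n s 0 (j k) (x - 0))"
      by (rule mult_left_mono[OF norm_dmode_ge[OF _ \<rho>(2) that]]) (auto simp: a_def)
    finally show ?thesis by (simp add: a_def)
  qed
  have "real N powr (Q / 2) \<le> (12 * (C * C') powr Q * 4 powr Q / m) * real N powr (recip r * Q)" if N: "N \<ge> 1" for N :: nat
  proof -
    have adm: "admissible {..<N} (\<lambda>_. 0) j" by (simp add: admissible_def j_def)
    define b where "b x = sqrt (real N) / 2 * indicator ?E x" for x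
    have [measurable]: "?E \<in> sets borel" by (rule bump_borel)
    have "(\<integral>\<^sup>+x. ennreal ((b x / 2) powr Q) \<partial>lborel) \<le> ennreal (12 * (C * (C' * real N powr recip r)) powr Q)"
    proof (rule signed_lower_bound[OF 2 C adm])
      show "\<forall>X\<subseteq>{..<N}. test_norm {..<N} (\<lambda>_. 0) j (\<lambda>k. sign_on X k * a k) (\<lambda>_. 0) \<le> ennreal (C' * real N powr recip r)"
        by (intro allI impI scales_constantD[OF C' adm N _ apart]) (auto simp: abs_sign_on a_def)
    next
      fix x
      show "b x ^ 2 \<le> (\<Sum>k\<in>{..<N}. (\<bar>a k\<bar> * norm (dmode n s 0 (j k) (x - 0))) ^ 2)"
      proof (cases "x \<in> ?E")
        case True
        then have "b x ^ 2 = (\<Sum>k<N. (1 / 2) ^ 2)" by (simp add: b_def power_divide)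
        also have "\<dots> \<le> (\<Sum>k<N. (\<bar>a k\<bar> * norm (dmode n s 0 (j k) (x - 0))) ^ 2)"
          by (intro sum_mono power_mono mode_ge True) simp
        finally show ?thesis .
      next
        case False
        then show ?thesis by (simp add: b_def sum_nonneg)
      qed
    qed (use C'0 in \<open>auto simp: b_def\<close>)
    moreover have "(\<integral>\<^sup>+x. ennreal ((b x / 2) powr Q) \<partial>lborel) = ennreal ((sqrt (real N) / 4) powr Q * m)"
    proof -
      have "(\<integral>\<^sup>+x. ennreal ((b x / 2) powr Q) \<partial>lborel) = (\<integral>\<^sup>+x. ennreal ((sqrt (real N) / 4) powr Q) * indicator ?E x \<partial>lborel)"
        using 2 by (intro nn_integral_cong) (auto simp: b_def indicator_def)
      also have "\<dots> = ennreal ((sqrt (real N) / 4) powr Q) * ennreal m"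
        using emeasure_bump[OF m(2,1), of 0 0] by (subst nn_integral_cmult_indicator) auto
      also have "\<dots> = ennreal ((sqrt (real N) / 4) powr Q * m)"
        using m by (intro ennreal_mult[symmetric]) auto
      finally show ?thesis .
    qed
    ultimately have "(sqrt (real N) / 4) powr Q * m \<le> 12 * (C * (C' * real N powr recip r)) powr Q"
      by (simp add: ennreal_le_iff)
    moreover have "(sqrt (real N) / 4) powr Q = real N powr (Q / 2) / 4 powr Q"
      using N by (simp add: powr_divide powr_half_sqrt[symmetric] powr_powr)
    moreover have "(C * (C' * real N powr recip r)) powr Q = (C * C') powr Q * real N powr (recip r * Q)"
      using C0 C'0 by (simp add: powr_mult powr_powr)
    ultimately show ?thesis using m by (simp add: field_simps)
  qed
  then have "Q / 2 \<le> recip r * Q" by (rule powr_bound_imp_le)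
  then have "1 / 2 \<le> recip r" using 2 by (simp add: field_simps)
  then show ?thesis
    using recip_le_imp_le[OF exponents_pos(3), of 2] recip_ennreal[of 2] by simp
qed

text \<open>In a nontrivial Jordan block some entry of the \<open>j\<close>-th power exceeds the power of the eigenvalue by
  a factor of order \<open>j\<close>. In the critical case there is no room for the \<open>n\<close>-th power of this factor.\<close>

lemma not_AND_imp_order_zero:
  assumes "\<not> asymptotically_norm_diagonal A"
  shows "n = 0"
proof (rule ccontr)
  assume "n \<noteq> 0"
  obtain s t where st: "s \<noteq> t" "A $ s $ s = lam" "A $ t $ t = lam" "A $ s $ t = 1"
    using not_AND_superdiagonal[OF assms] by blast
  obtain C where C: "\<And>j. j \<ge> 2 * M \<Longrightarrow> growth t j ^ n \<le> C * 2 powr (real j * (\<alpha> + recip q - recip p))"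
    using growth_bound by blast
  have "real j / lam \<le> C" if j: "j \<ge> 2 * M" "real j \<ge> lam" for j
  proof -
    have "j \<ge> 1" using j(1) M by simp
    have "real j / lam \<le> (real j / lam) ^ n"
      using j lambda_max_gt_1 \<open>n \<noteq> 0\<close> by (intro self_le_power) auto
    also have "\<dots> = (real j * lam ^ (j - 1)) ^ n / (lam ^ n) ^ j"
    proof -
      have "lam ^ j = lam * lam ^ (j - 1)" using \<open>j \<ge> 1\<close> by (cases j) auto
      then have "real j / lam = real j * lam ^ (j - 1) / lam ^ j" using lambda_max_gt_1 by simp
      moreover have "(lam ^ j) ^ n = (lam ^ n) ^ j" unfolding power_mult[symmetric] by (simp only: mult.commute)
      ultimately show ?thesis by (simp only: power_divide)
    qed
    also have "\<dots> \<le> growth t j ^ n / (lam ^ n) ^ j"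
      using mat_pow_superdiagonal_ge[OF st, of j] growth_ge_entry[of j s t] lambda_max_gt_1
      by (intro divide_right_mono power_mono) auto
    also have "\<dots> \<le> C * 2 powr (real j * (\<alpha> + recip q - recip p)) / (lam ^ n) ^ j"
      using C[OF j(1)] lambda_max_gt_1 by (intro divide_right_mono) auto
    also have "(lam ^ n) ^ j = 2 powr (real j * (\<alpha> + recip q - recip p))"
      unfolding endpoint by (simp add: powr_powr mult.commute flip: powr_realpow)
    finally show ?thesis by simp
  qed
  note bounded = this
  obtain k where k: "real k > max (C * lam) (max lam (real (2 * M)))"
    using reals_Archimedean2 by blast
  then have "real k / lam \<le> C" by (intro bounded) auto
  then show False using k lambda_max_gt_1 by (simp add: field_simps)
qed

end

end

text \<open>The wavelet determines how far scales have to be apart, the exponent \<open>p\<close> how fast the characteristic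
  function has to decay.\<close>

lemma sobolev_embedding_intro:
  fixes A :: "(real, 'd::{finite,wellorder}) sqmat"
  assumes "besov_setting A \<psi> \<psi>0" "0 < p" "0 < q" "0 < r" "besov_embeds_sobolev A \<psi> \<psi>0 \<alpha> p r n q"
  shows "\<exists>\<nu> M L \<delta> D. sobolev_embedding A \<psi> \<psi>0 \<nu> M L \<delta> D p q r \<alpha> n"
proof -
  interpret besov_setting A \<psi> \<psi>0 by (rule assms(1))
  obtain M where M: "M \<ge> 1" "\<And>k \<zeta>. k \<ge> M \<Longrightarrow> \<zeta> \<in> frequency_cell \<Longrightarrow>
     fourier \<psi> (up k \<zeta>) = 0 \<and> fourier \<psi> (down k \<zeta>) = 0 \<and> fourier \<psi>0 (up k \<zeta>) = 0"
    using exists_scale_separation by blast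
  obtain \<delta> where \<delta>: "\<delta> > 0" "\<And>\<eta> k l. \<eta> \<in> cube \<delta> \<Longrightarrow> \<bar>down k \<eta> $ l\<bar> \<le> 1/2"
    using exists_small_cube by blast
  obtain L :: nat where L: "L \<ge> 1" "\<And>P. p = ennreal P \<Longrightarrow> 0 < P \<Longrightarrow> real L * P \<ge> 2"
  proof -
    obtain K :: nat where K: "2 * recip p < real K" using reals_Archimedean2 by blast
    have "real (Suc K) * P \<ge> 2" if "p = ennreal P" "0 < P" for P
    proof -
      have "2 / P < real (Suc K)" using K that by (simp add: recip_ennreal)
      then show ?thesis using that(2) by (simp add: divide_less_eq less_imp_le)
    qed
    then show ?thesis using that[of "Suc K"] by auto
  qed
  obtain \<nu> :: "'d rvec measure" and D where \<nu>: "prob_space \<nu>" "space \<nu> = cube \<delta>"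
    "sets \<nu> = sets (restrict_space borel (cube \<delta>))"
    "\<And>y. norm (LINT \<eta>|\<nu>. cis (2 * pi * (y \<bullet> \<eta>))) \<le> D * envelope (2 * L) y"
    using exists_spectral_distribution[OF \<delta>(1), of "2 * L", where 'd = 'd] L(1) by auto
  interpret prob_space \<nu> by (rule \<nu>(1))
  have "sobolev_embedding A \<psi> \<psi>0 \<nu> M L \<delta> D p q r \<alpha> n"
    using M \<delta> L \<nu> assms by unfold_locales auto
  then show ?thesis by blast
qed

theorem theorem4p3:
  fixes A :: "real ^ 'd::{finite,wellorder} ^ 'd::{finite,wellorder}"
    and \<psi> \<psi>0 :: "real ^ 'd::{finite,wellorder} \<Rightarrow> complex"
    and n :: nat
    and p q r :: ennreal
    and \<alpha> n_star :: real
  assumes "0 < p" and "0 < q" and "0 < r"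
    and "invertible A"
    and "expansive_jordan_normal_form A"
    and "A_wavelet A \<psi>"
    and "low_pass_complement A \<psi> \<psi>0"
    and n_star: "n_star = \<alpha> + recip q - recip p"
    and "besov_embeds_sobolev A \<psi> \<psi>0 \<alpha> p r n q"
  shows "p \<le> q \<and>
         (real n \<le> ln \<bar>det A\<bar> / ln (lambda_max A) * n_star \<and> n_star \<ge> 0) \<and>
         (real n = ln \<bar>det A\<bar> / ln (lambda_max A) * n_star \<longrightarrow>
            r \<le> q \<and>
            (q = \<infinity> \<longrightarrow> r \<le> 1) \<and>
            (p = q \<longrightarrow> r \<le> 2) \<and>
            (\<not> asymptotically_norm_diagonal A \<longrightarrow> n = 0 \<and> n_star = 0))"
proof -
  have "besov_setting A \<psi> \<psi>0" using assms by unfold_locales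
  then obtain \<nu> M L \<delta> D where "sobolev_embedding A \<psi> \<psi>0 \<nu> M L \<delta> D p q r \<alpha> n"
    using sobolev_embedding_intro assms(1-3,9) by blast
  then interpret sobolev_embedding A \<psi> \<psi>0 \<nu> M L \<delta> D p q r \<alpha> n .
  have ln_lam: "ln lam > 0" using lambda_max_gt_1 by simp
  obtain s where s: "A $ s $ s = lam" using lambda_max_diagonal by blast
  obtain C where C: "\<And>j. j \<ge> 2 * M \<Longrightarrow> growth s j ^ n \<le> C * 2 powr (real j * n_star)"
    using growth_bound unfolding n_star by blast
  have "(lam ^ n) ^ j \<le> C * (2 powr n_star) ^ j" if "j \<ge> 2 * M" for j
  proof -
    have "(lam ^ n) ^ j = (lam ^ j) ^ n" by (simp add: mult.commute flip: power_mult)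
    also have "\<dots> \<le> growth s j ^ n"
      using mat_pow_diagonal_ge[of s j] growth_ge_entry[of j s s] lambda_max_gt_1
      by (intro power_mono) (auto simp: s)
    also have "\<dots> \<le> C * 2 powr (real j * n_star)" using C[OF that] .
    also have "2 powr (real j * n_star) = (2 powr n_star) ^ j"
      by (simp add: powr_powr mult.commute flip: powr_realpow)
    finally show ?thesis .
  qed
  then have "lam ^ n \<le> 2 powr n_star"
    using lambda_max_gt_1 by (intro power_bound_imp_le[of "lam ^ n" "2 powr n_star" "2 * M" C]) auto
  then have "ln (lam ^ n) \<le> ln (2 powr n_star)"
    using lambda_max_gt_1 by (subst ln_le_cancel_iff) auto
  then have le: "real n * ln lam \<le> n_star * ln 2"
    using lambda_max_gt_1 by (simp add: ln_realpow ln_powr)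
  then have order: "real n \<le> ln \<bar>det A\<bar> / ln lam * n_star"
    using ln_lam by (simp add: det_A field_simps)
  have "0 \<le> n_star * ln 2" using le ln_lam by (meson mult_nonneg_nonneg of_nat_0_le_iff less_imp_le order.trans)
  then have pos: "n_star \<ge> 0" by (simp add: zero_le_mult_iff)
  have crit: "r \<le> q \<and> (q = \<infinity> \<longrightarrow> r \<le> 1) \<and> (p = q \<longrightarrow> r \<le> 2) \<and>
      (\<not> asymptotically_norm_diagonal A \<longrightarrow> n = 0 \<and> n_star = 0)"
    if eq: "real n = ln \<bar>det A\<bar> / ln lam * n_star"
  proof -
    have eq': "real n * ln lam = n_star * ln 2" using eq ln_lam by (simp add: det_A)
    have "lam ^ n = exp (real n * ln lam)"
      using lambda_max_gt_1 by (simp add: exp_of_nat_mult)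
    also have "\<dots> = 2 powr n_star" unfolding eq' by (simp add: powr_def)
    finally have endpoint: "lam ^ n = 2 powr (\<alpha> + recip q - recip p)" by (simp add: n_star)
    have "n_star = 0" if "n = 0" using eq' that by simp
    then show ?thesis
      using r_le_q[OF endpoint] r_le_1[OF endpoint] r_le_2[OF endpoint] not_AND_imp_order_zero[OF endpoint]
      by auto
  qed
  show ?thesis using p_le_q order pos crit by blast
qed

end
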